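(* Let $p \in \{a,e\}^*$ be a pattern. (1) If $p \preceq e^*a$, then $\mathrm{p\text{-}FD}(E_1^{=}p) \subseteq \mathrm{para\text{-}AC}^0$. (2) If $aa \preceq p$ or $ae \preceq p$, then $\mathrm{p\text{-}FD}(E_1^{=}p)$ contains a $\mathrm{W}[1]$-hard problem. Both items also hold with $\mathrm{p\text{-}FD}(E_1^{=}p)$ replaced by $\mathrm{p\text{-}FD}_{\mathrm{undirected}}(E_1^{=}p)$ and by $\mathrm{p\text{-}FD}_{\mathrm{basic}}(E_1^{=}p)$.
   Context: Vocabularies contain only relation symbols; all structures are finite. A pattern is a word $p\in\{a,e\}^*$. For $\bowtie\in\{=,\le,\ge\}$, a formula with pattern $E_1^{\bowtie}p$ is a sentence $\exists^{\bowtie}X\,\varphi(X)$ where $X$ is a unary (monadic) second-order variable and $\varphi(X)$ is a first-order formula (with equality) in prenex normal form whose quantifier prefix, writing $a$ for $\forall$ and $e$ for $\exists$, is $p$, followed by a quantifier-free part. For a structure $\mathcal S$ with universe $U$ and $k\in\mathbb N$: $(\mathcal S,k)\models\exists^{\le}X\,\varphi(X)$ iff there is $C\subseteq U$ with $|C|\le k$ and $\mathcal S\models\varphi(C)$; analogously for $\exists^{=}$ ($|C|=k$) and $\exists^{\ge}$ ($|C|\ge k$). The parameterized problem described is $\mathrm{p\text{-}models}(\psi)=\{(\mathcal S,k)\mid(\mathcal S,k)\models\psi\}$ (parameter $k$). $\mathrm{p\text{-}FD}(E_1^{\bowtie}p)$ is the class of all $\mathrm{p\text{-}models}(\psi)$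 for $\psi$ of pattern $E_1^{\bowtie}p$ over arbitrary vocabularies. Graphs are structures over the vocabulary $\{\sim\}$ with one binary relation; undirected graphs are those where $\sim$ is symmetric (self-loops allowed); basic graphs are undirected graphs without self-loops. $\mathrm{p\text{-}FD}_{\mathrm{undirected}}(E_1^{\bowtie}p)$ (resp. $\mathrm{p\text{-}FD}_{\mathrm{basic}}$) is the class of problems $\mathrm{p\text{-}models}(\psi)$ restricted to pairs $(\mathcal G,k)$ with $\mathcal G$ an undirected (resp. basic) graph, for $\psi$ over $\{\sim\}$ of that pattern. For words $p,q$, $p\preceq q$ means $p$ is a (not necessarily contiguous) subsequence of $q$; "$p\preceq e^*a$" means $p\preceq e^ma$ for some $m\ge0$. $\mathrm{para\text{-}AC}^0$ is the class of parameterized problems decidable by families $(C_{n,k})$ of unbounded fan-in circuits of constant depth and size $f(k)\cdot n^{O(1)}$ for a computable $f$. $\mathrm{W}[1]$ is the usual class of parameterized complexity. *)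

theory Defs
  imports Main "HOL-Library.Sublist"
begin

section \<open>Finite relational structures\<close>

text \<open>A vocabulary is the list of the arities of its relation symbols; symbol number \<open>i\<close> has arity
  \<open>\<tau> ! i\<close>. Structures are taken up to isomorphism: the universe is an initial segment of the naturals,
  and relations are sets of tuples, a tuple being a list. Universes are nonempty.\<close>

type_synonym vocabulary = "nat list"

datatype struct = Struct (usize: nat) (rels: "nat list set list")

definition universe :: "struct \<Rightarrow> nat set" where
  "universe A = {..<usize A}"

definition tuples :: "struct \<Rightarrow> nat \<Rightarrow> nat list set" where
  "tuples A r = {t. length t = r \<and> set t \<subseteq> universe A}"

definition is_structure :: "vocabulary \<Rightarrow> struct \<Rightarrow> bool" where
  "is_structure \<tau> A \<longleftrightarrow>
     usize A > 0 \<and> length (rels A) = length \<tau> \<and> (\<forall>i<length \<tau>. rels A ! i \<subseteq> tuples A (\<tau> ! i))"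

definition graph_voc :: vocabulary where
  "graph_voc = [2]"

abbreviation edges :: "struct \<Rightarrow> nat list set" where
  "edges G \<equiv> rels G ! 0"

definition undirected :: "struct \<Rightarrow> bool" where
  "undirected G \<longleftrightarrow> is_structure graph_voc G \<and> (\<forall>u v. [u, v] \<in> edges G \<longrightarrow> [v, u] \<in> edges G)"

definition basic :: "struct \<Rightarrow> bool" where
  "basic G \<longleftrightarrow> undirected G \<and> (\<forall>v. [v, v] \<notin> edges G)"

section \<open>First-order formulas with one free relation variable\<close>

text \<open>\<open>SO xs\<close> is the atom \<open>X(xs)\<close> for the second-order variable \<open>X\<close>. First-order variables are
  natural numbers.\<close>

datatype fm =
    Fls
  | Rel nat "nat list"
  | SO "nat list"
  | Equal nat nat
  | Neg fm
  | Conj fm fm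
  | Disj fm fm
  | Forall nat fm
  | Exists nat fm

primrec sat :: "struct \<Rightarrow> nat list set \<Rightarrow> (nat \<Rightarrow> nat) \<Rightarrow> fm \<Rightarrow> bool" where
  "sat A S v Fls \<longleftrightarrow> False"
| "sat A S v (Rel i xs) \<longleftrightarrow> map v xs \<in> rels A ! i"
| "sat A S v (SO xs) \<longleftrightarrow> map v xs \<in> S"
| "sat A S v (Equal x y) \<longleftrightarrow> v x = v y"
| "sat A S v (Neg \<phi>) \<longleftrightarrow> \<not> sat A S v \<phi>"
| "sat A S v (Conj \<phi> \<psi>) \<longleftrightarrow> sat A S v \<phi> \<and> sat A S v \<psi>"
| "sat A S v (Disj \<phi> \<psi>) \<longleftrightarrow> sat A S v \<phi> \<or> sat A S v \<psi>"
| "sat A S v (Forall x \<phi>) \<longleftrightarrow> (\<forall>u\<in>universe A. sat A S (v(x := u)) \<phi>)"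
| "sat A S v (Exists x \<phi>) \<longleftrightarrow> (\<exists>u\<in>universe A. sat A S (v(x := u)) \<phi>)"

primrec free_vars :: "fm \<Rightarrow> nat set" where
  "free_vars Fls = {}"
| "free_vars (Rel i xs) = set xs"
| "free_vars (SO xs) = set xs"
| "free_vars (Equal x y) = {x, y}"
| "free_vars (Neg \<phi>) = free_vars \<phi>"
| "free_vars (Conj \<phi> \<psi>) = free_vars \<phi> \<union> free_vars \<psi>"
| "free_vars (Disj \<phi> \<psi>) = free_vars \<phi> \<union> free_vars \<psi>"
| "free_vars (Forall x \<phi>) = free_vars \<phi> - {x}"
| "free_vars (Exists x \<phi>) = free_vars \<phi> - {x}"

text \<open>Well-formedness over the vocabulary \<open>\<tau>\<close>, with \<open>X\<close> of arity \<open>s\<close>.\<close>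

primrec wf_fm :: "vocabulary \<Rightarrow> nat \<Rightarrow> fm \<Rightarrow> bool" where
  "wf_fm \<tau> s Fls \<longleftrightarrow> True"
| "wf_fm \<tau> s (Rel i xs) \<longleftrightarrow> i < length \<tau> \<and> length xs = \<tau> ! i"
| "wf_fm \<tau> s (SO xs) \<longleftrightarrow> length xs = s"
| "wf_fm \<tau> s (Equal x y) \<longleftrightarrow> True"
| "wf_fm \<tau> s (Neg \<phi>) \<longleftrightarrow> wf_fm \<tau> s \<phi>"
| "wf_fm \<tau> s (Conj \<phi> \<psi>) \<longleftrightarrow> wf_fm \<tau> s \<phi> \<and> wf_fm \<tau> s \<psi>"
| "wf_fm \<tau> s (Disj \<phi> \<psi>) \<longleftrightarrow> wf_fm \<tau> s \<phi> \<and> wf_fm \<tau> s \<psi>"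
| "wf_fm \<tau> s (Forall x \<phi>) \<longleftrightarrow> wf_fm \<tau> s \<phi>"
| "wf_fm \<tau> s (Exists x \<phi>) \<longleftrightarrow> wf_fm \<tau> s \<phi>"

primrec quantifier_free :: "fm \<Rightarrow> bool" where
  "quantifier_free Fls \<longleftrightarrow> True"
| "quantifier_free (Rel i xs) \<longleftrightarrow> True"
| "quantifier_free (SO xs) \<longleftrightarrow> True"
| "quantifier_free (Equal x y) \<longleftrightarrow> True"
| "quantifier_free (Neg \<phi>) \<longleftrightarrow> quantifier_free \<phi>"
| "quantifier_free (Conj \<phi> \<psi>) \<longleftrightarrow> quantifier_free \<phi> \<and> quantifier_free \<psi>"
| "quantifier_free (Disj \<phi> \<psi>) \<longleftrightarrow> quantifier_free \<phi> \<and> quantifier_free \<psi>"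
| "quantifier_free (Forall x \<phi>) \<longleftrightarrow> False"
| "quantifier_free (Exists x \<phi>) \<longleftrightarrow> False"

text \<open>The letters \<open>a\<close> (universal) and \<open>e\<close> (existential) of a pattern.\<close>

datatype quant = Qa | Qe

type_synonym pattern = "quant list"

fun prenex :: "pattern \<Rightarrow> fm \<Rightarrow> bool" where
  "prenex [] \<phi> \<longleftrightarrow> quantifier_free \<phi>"
| "prenex (Qa # p) (Forall x \<phi>) \<longleftrightarrow> prenex p \<phi>"
| "prenex (Qe # p) (Exists x \<phi>) \<longleftrightarrow> prenex p \<phi>"
| "prenex _ _ \<longleftrightarrow> False"

text \<open>Formulas over \<open>\<tau>\<close> with prefix \<open>p\<close> whose only free variable is \<open>X\<close>, of arity \<open>s\<close>.\<close>

definition prenex_fms :: "vocabulary \<Rightarrow> nat \<Rightarrow> pattern \<Rightarrow> fm set" where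
  "prenex_fms \<tau> s p = {\<phi>. wf_fm \<tau> s \<phi> \<and> free_vars \<phi> = {} \<and> prenex p \<phi>}"

text \<open>Since \<open>\<phi>\<close> has no free first-order variables, the assignment is irrelevant.\<close>

definition models :: "struct \<Rightarrow> nat list set \<Rightarrow> fm \<Rightarrow> bool" where
  "models A S \<phi> \<longleftrightarrow> sat A S (\<lambda>_. 0) \<phi>"

section \<open>Parameterized problems\<close>

text \<open>A structure is encoded by its size in unary, a separator, and the characteristic bit vectors of its
  relations. Words that encode no structure are no-instances.\<close>

type_synonym param_problem = "(bool list \<times> nat) set"

definition encode :: "vocabulary \<Rightarrow> struct \<Rightarrow> bool list" where
  "encode \<tau> A = replicate (usize A) True @ [False] @
     concat (map2 (\<lambda>r R. map (\<lambda>t. t \<in> R) (List.n_lists r [0..<usize A])) \<tau> (rels A))"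

definition encode_problem :: "vocabulary \<Rightarrow> (struct \<times> nat) set \<Rightarrow> param_problem" where
  "encode_problem \<tau> P = (\<lambda>(A, k). (encode \<tau> A, k)) ` P"

text \<open>The models of \<open>\<exists>\<^sup>\<bowtie>X \<phi>(X)\<close> for monadic \<open>X\<close>, where \<open>cmp\<close> is the comparison \<open>\<bowtie>\<close> (one of \<open>=\<close>, \<open>\<le>\<close>, \<open>\<ge>\<close>).
  A set \<open>C\<close> of elements is passed to \<^const>\<open>models\<close> as a set of 1-tuples.\<close>

definition p_models :: "(nat \<Rightarrow> nat \<Rightarrow> bool) \<Rightarrow> vocabulary \<Rightarrow> fm \<Rightarrow> (struct \<times> nat) set" where
  "p_models cmp \<tau> \<phi> = {(A, k). is_structure \<tau> A \<and>
     (\<exists>C \<subseteq> universe A. cmp (card C) k \<and> models A ((\<lambda>c. [c]) ` C) \<phi>)}"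

definition p_FD :: "(nat \<Rightarrow> nat \<Rightarrow> bool) \<Rightarrow> pattern \<Rightarrow> param_problem set" where
  "p_FD cmp p = {encode_problem \<tau> (p_models cmp \<tau> \<phi>) |\<tau> \<phi>. \<phi> \<in> prenex_fms \<tau> 1 p}"

definition p_FD_undirected :: "(nat \<Rightarrow> nat \<Rightarrow> bool) \<Rightarrow> pattern \<Rightarrow> param_problem set" where
  "p_FD_undirected cmp p =
     {encode_problem graph_voc {(G, k) \<in> p_models cmp graph_voc \<phi>. undirected G} |\<phi>.
        \<phi> \<in> prenex_fms graph_voc 1 p}"

definition p_FD_basic :: "(nat \<Rightarrow> nat \<Rightarrow> bool) \<Rightarrow> pattern \<Rightarrow> param_problem set" where
  "p_FD_basic cmp p =
     {encode_problem graph_voc {(G, k) \<in> p_models cmp graph_voc \<phi>. basic G} |\<phi>.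
        \<phi> \<in> prenex_fms graph_voc 1 p}"

section \<open>A machine model\<close>

text \<open>Algorithms are while-programs over finitely many stacks of bits, every push, pop and test costing
  one time unit. Up to constant factors in the running time these are the multi-tape Turing machines
  (a tape is a pair of stacks).\<close>

datatype test = Nonempty nat | Top nat

datatype com =
    Skip
  | Push nat bool
  | Pop nat
  | Seq com com
  | If test com com
  | While test com

type_synonym state = "nat \<Rightarrow> bool list"

primrec holds :: "test \<Rightarrow> state \<Rightarrow> bool" where
  "holds (Nonempty r) \<sigma> \<longleftrightarrow> \<sigma> r \<noteq> []"
| "holds (Top r) \<sigma> \<longleftrightarrow> \<sigma> r \<noteq> [] \<and> hd (\<sigma> r)"

text \<open>\<open>exec c \<sigma> t \<sigma>'\<close>: started in \<open>\<sigma>\<close>, the program \<open>c\<close> halts in \<open>\<sigma>'\<close> after \<open>t\<close> steps.\<close>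

inductive exec :: "com \<Rightarrow> state \<Rightarrow> nat \<Rightarrow> state \<Rightarrow> bool" where
  exec_Skip: "exec Skip \<sigma> 1 \<sigma>"
| exec_Push: "exec (Push r b) \<sigma> 1 (\<sigma>(r := b # \<sigma> r))"
| exec_Pop: "exec (Pop r) \<sigma> 1 (\<sigma>(r := tl (\<sigma> r)))"
| exec_Seq: "exec c \<sigma> t \<sigma>' \<Longrightarrow> exec c' \<sigma>' t' \<sigma>'' \<Longrightarrow> exec (Seq c c') \<sigma> (t + t') \<sigma>''"
| exec_IfTrue: "holds b \<sigma> \<Longrightarrow> exec c \<sigma> t \<sigma>' \<Longrightarrow> exec (If b c c') \<sigma> (Suc t) \<sigma>'"
| exec_IfFalse: "\<not> holds b \<sigma> \<Longrightarrow> exec c' \<sigma> t \<sigma>' \<Longrightarrow> exec (If b c c') \<sigma> (Suc t) \<sigma>'"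
| exec_WhileTrue: "holds b \<sigma> \<Longrightarrow> exec c \<sigma> t \<sigma>' \<Longrightarrow> exec (While b c) \<sigma>' t' \<sigma>'' \<Longrightarrow>
    exec (While b c) \<sigma> (Suc (t + t')) \<sigma>''"
| exec_WhileFalse: "\<not> holds b \<sigma> \<Longrightarrow> exec (While b c) \<sigma> 1 \<sigma>"

text \<open>The word is on stack 0 and the parameter, in unary, on stack 1; all other stacks are empty. As the
  time bounds below are of the form \<open>f(k) \<cdot> n\<^sup>c\<close> with \<open>f\<close> computable, the encoding of the parameter is
  immaterial.\<close>

definition init :: "bool list \<Rightarrow> nat \<Rightarrow> state" where
  "init x k = (\<lambda>_. [])(0 := x, 1 := replicate k True)"

definition computable :: "(nat \<Rightarrow> nat) \<Rightarrow> bool" where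
  "computable f \<longleftrightarrow> (\<exists>c. \<forall>k. \<exists>t \<sigma>. exec c (init [] k) t \<sigma> \<and> \<sigma> 1 = replicate (f k) True)"

section \<open>Fpt-reductions and W[1]\<close>

definition fpt_reducible :: "param_problem \<Rightarrow> param_problem \<Rightarrow> bool" (infix "\<le>\<^sub>f\<^sub>p\<^sub>t" 50) where
  "P \<le>\<^sub>f\<^sub>p\<^sub>t Q \<longleftrightarrow> (\<exists>prog f g c. computable f \<and> computable g \<and>
     (\<forall>x k. \<exists>t \<sigma> x' k'. exec prog (init x k) t \<sigma> \<and> t \<le> f k * (length x + 1) ^ c \<and>
        \<sigma> 0 = x' \<and> \<sigma> 1 = replicate k' True \<and> k' \<le> g k \<and>
        ((x, k) \<in> P \<longleftrightarrow> (x', k') \<in> Q)))"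

text \<open>Weighted Fagin-definable problems; \<open>X\<close> may have any arity \<open>s\<close>.\<close>

definition p_WD :: "vocabulary \<Rightarrow> nat \<Rightarrow> fm \<Rightarrow> (struct \<times> nat) set" where
  "p_WD \<tau> s \<phi> = {(A, k). is_structure \<tau> A \<and> (\<exists>S \<subseteq> tuples A s. card S = k \<and> models A S \<phi>)}"

text \<open>W[1] as defined by Flum and Grohe (Parameterized Complexity Theory, Springer 2006, Chapter 5): the
  closure under fpt-reductions of the problems \<open>p-WD\<^sub>\<phi>\<close> for \<open>\<phi> \<in> \<Pi>\<^sub>1\<close>.\<close>

definition W1 :: "param_problem set" where
  "W1 = {P. \<exists>\<tau> s m. \<exists>\<phi> \<in> prenex_fms \<tau> s (replicate m Qa). P \<le>\<^sub>f\<^sub>p\<^sub>t encode_problem \<tau> (p_WD \<tau> s \<phi>)}"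

definition W1_hard :: "param_problem \<Rightarrow> bool" where
  "W1_hard Q \<longleftrightarrow> (\<forall>P \<in> W1. P \<le>\<^sub>f\<^sub>p\<^sub>t Q)"

section \<open>Circuits and para-AC0\<close>

text \<open>A circuit is a topologically sorted list of gates, each referring to predecessors by position; the
  last gate is the output. Its size is the number of gates.\<close>

datatype gate = Input nat | NotGate nat | AndGate "nat list" | OrGate "nat list"

type_synonym circuit = "gate list"

primrec wires :: "gate \<Rightarrow> nat set" where
  "wires (Input j) = {}"
| "wires (NotGate i) = {i}"
| "wires (AndGate is) = set is"
| "wires (OrGate is) = set is"

definition is_circuit :: "nat \<Rightarrow> circuit \<Rightarrow> bool" where
  "is_circuit n C \<longleftrightarrow> C \<noteq> [] \<and>
     (\<forall>i<length C. wires (C ! i) \<subseteq> {..<i} \<and> (\<forall>j. C ! i = Input j \<longrightarrow> j < n))"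

primrec gate_value :: "bool list \<Rightarrow> bool list \<Rightarrow> gate \<Rightarrow> bool" where
  "gate_value x vs (Input j) = x ! j"
| "gate_value x vs (NotGate i) = (\<not> vs ! i)"
| "gate_value x vs (AndGate is) = (\<forall>i\<in>set is. vs ! i)"
| "gate_value x vs (OrGate is) = (\<exists>i\<in>set is. vs ! i)"

definition accepts :: "circuit \<Rightarrow> bool list \<Rightarrow> bool" where
  "accepts C x \<longleftrightarrow> last (foldl (\<lambda>vs g. vs @ [gate_value x vs g]) [] C)"

primrec gate_depth :: "nat list \<Rightarrow> gate \<Rightarrow> nat" where
  "gate_depth ds (Input j) = 0"
| "gate_depth ds (NotGate i) = Suc (ds ! i)"
| "gate_depth ds (AndGate is) = Suc (Max (insert 0 ((!) ds ` set is)))"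
| "gate_depth ds (OrGate is) = Suc (Max (insert 0 ((!) ds ` set is)))"

definition depth :: "circuit \<Rightarrow> nat" where
  "depth C = Max (set (foldl (\<lambda>ds g. ds @ [gate_depth ds g]) [] C))"

text \<open>The base \<open>n + 1\<close> instead of \<open>n\<close> only serves to admit nonempty circuits for \<open>n = 0\<close>.\<close>

definition para_AC0 :: "param_problem set" where
  "para_AC0 = {Q. \<exists>(C :: nat \<Rightarrow> nat \<Rightarrow> circuit) f c d. computable f \<and>
     (\<forall>n k. is_circuit n (C n k) \<and> depth (C n k) \<le> d \<and> length (C n k) \<le> f k * (n + 1) ^ c) \<and>
     (\<forall>x k. (x, k) \<in> Q \<longleftrightarrow> accepts (C (length x) k) x)}"

end

(*
Item (1): for a prefix e^m a, fix the values of the existential variables and the trace of X on these at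
most m elements. Each of the remaining elements is then forced into X, forced out of X, free or impossible,
so a set X of weight k exists iff k lies between two counts. Such counts are compared with k by circuits of
constant depth built from a perfect hash family, which exists by an averaging argument.

Item (2): a weighted Pi_1 sentence asks for a set S of k tuples that satisfies clauses with boundedly many
literals. Guess S as an increasing sequence. For every bounded set of positions, the clauses whose negative
literals lie in the chosen elements form an instance of hitting set with sets of bounded size. A bounded
search tree of depth k branches on only boundedly many of these clauses, and S hits all of the instance iff
it hits the clauses branched on: walking down the tree into S, each step adds an element of S. So every such
clause gets one auxiliary variable that names a position whose element hits it, and all conditions become
binary. Such a binary constraint system is an instance of independent set (prefix aa), and, with guards for
the variables and one vertex per forbidden pair, of total dominating set (prefix ae). Both graphs are basic,
so one reduction serves all three classes. The program is obtained from closure properties of the functions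
on unary numbers that are computable in polynomial time with the input word as an oracle; the search tree is
tabulated by a recursion that prepends computed bits to the word.
*)

theory Submission
  imports Defs "HOL-Library.FuncSet"
begin

section \<open>Programs on unary numbers\<close>

text \<open>A constraint between two variables cannot look at a clause with several literals. But a
  value may range over a polynomial domain, so one value codes a whole bounded set, a position and
  an element, and binary constraints merely compare these claims with the variables that hold the
  elements of S. The number of variables is the new parameter and must be bounded in k alone; hence
  they are indexed by positions in S, not by elements.

  A search tree is built from the bounded set and never from S. For a fixed sentence there are
  polynomially many such sets, so all trees are tabulated in advance; only the number of nodes,
  \<open>(D + 1) ^ k\<close>, is exponential in k. Every clause branched on is implied by the
  sentence once its set lies in S, so demanding witnesses at all nodes loses no solution.

  In item (1) the weight is exact, so two counts are compared with it; the upper comparison is a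
  negated threshold, and all thresholds stay at most k + 1. As only the size bound of the circuits
  has to be computable, the mere existence of hash families suffices.\<close>

definition run :: "com \<Rightarrow> state \<Rightarrow> nat \<Rightarrow> state \<Rightarrow> bool" where
  "run c \<sigma> T \<sigma>' \<longleftrightarrow> (\<exists>t\<le>T. exec c \<sigma> t \<sigma>')"

lemma run_mono: "run c \<sigma> T \<sigma>' \<Longrightarrow> T \<le> T' \<Longrightarrow> run c \<sigma> T' \<sigma>'"
  unfolding run_def by (meson order_trans)

lemma run_Skip: "run Skip \<sigma> 1 \<sigma>"
  and run_Push: "run (Push r b) \<sigma> 1 (\<sigma>(r := b # \<sigma> r))"
  and run_Pop: "run (Pop r) \<sigma> 1 (\<sigma>(r := tl (\<sigma> r)))"
  unfolding run_def using exec.intros(1-3) by blast+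

lemma run_Seq: "run c \<sigma> T \<sigma>' \<Longrightarrow> run c' \<sigma>' T' \<sigma>'' \<Longrightarrow> run (Seq c c') \<sigma> (T + T') \<sigma>''"
  unfolding run_def by (meson add_mono exec_Seq)

lemma run_If:
  "(holds b \<sigma> \<Longrightarrow> run c \<sigma> T \<sigma>') \<Longrightarrow> (\<not> holds b \<sigma> \<Longrightarrow> run c' \<sigma> T \<sigma>') \<Longrightarrow> run (If b c c') \<sigma> (Suc T) \<sigma>'"
  unfolding run_def by (meson Suc_le_mono exec_IfFalse exec_IfTrue)

text \<open>The loop is given by its whole sequence of states: a closed form of the state after i
  rounds takes the place of an invariant. The \<open>Suc\<close> around \<open>\<tau> i\<close> pays
  for the test.\<close>

lemma run_While:
  assumes "\<And>i. i < n \<Longrightarrow> holds b (st i)"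
    and "\<And>i. i < n \<Longrightarrow> run c (st i) (\<tau> i) (st (Suc i))"
    and "\<not> holds b (st n)"
  shows "run (While b c) (st 0) (Suc (\<Sum>i<n. Suc (\<tau> i))) (st n)"
  using assms
proof (induction n arbitrary: st \<tau>)
  case 0
  then show ?case unfolding run_def using exec_WhileFalse by fastforce
next
  case (Suc n)
  have "run (While b c) (st (Suc 0)) (Suc (\<Sum>i<n. Suc (\<tau> (Suc i)))) (st (Suc n))"
    using Suc.IH[of "\<lambda>i. st (Suc i)" "\<lambda>i. \<tau> (Suc i)"] Suc.prems by auto
  then obtain t' where t': "t' \<le> Suc (\<Sum>i<n. Suc (\<tau> (Suc i)))"
      "exec (While b c) (st (Suc 0)) t' (st (Suc n))"
    unfolding run_def by blast
  obtain t where t: "t \<le> \<tau> 0" "exec c (st 0) t (st (Suc 0))"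
    using Suc.prems(2)[of 0] unfolding run_def by blast
  have "exec (While b c) (st 0) (Suc (t + t')) (st (Suc n))"
    using exec_WhileTrue[OF _ t(2) t'(2)] Suc.prems(1)[of 0] by simp
  moreover have "Suc (t + t') \<le> Suc (\<Sum>i<Suc n. Suc (\<tau> i))"
    using t(1) t'(1) by (simp add: sum.lessThan_Suc_shift del: sum.lessThan_Suc)
  ultimately show ?case unfolding run_def by blast
qed

abbreviation un :: "nat \<Rightarrow> bool list" where "un n \<equiv> replicate n True"

definition clear :: "nat \<Rightarrow> com" where "clear r = While (Nonempty r) (Pop r)"

lemma run_clear: "run (clear r) \<sigma> (2 * length (\<sigma> r) + 1) (\<sigma>(r := []))"
proof -
  have "run (clear r) ((\<lambda>i. \<sigma>(r := drop i (\<sigma> r))) 0)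
     (Suc (\<Sum>i<length (\<sigma> r). Suc 1)) ((\<lambda>i. \<sigma>(r := drop i (\<sigma> r))) (length (\<sigma> r)))"
    unfolding clear_def
  proof (rule run_While)
    fix i assume "i < length (\<sigma> r)"
    have "run (Pop r) (\<sigma>(r := drop i (\<sigma> r))) 1
      ((\<sigma>(r := drop i (\<sigma> r)))(r := tl ((\<sigma>(r := drop i (\<sigma> r))) r)))" by (rule run_Pop)
    then show "run (Pop r) (\<sigma>(r := drop i (\<sigma> r))) 1 (\<sigma>(r := drop (Suc i) (\<sigma> r)))"
      by (simp add: drop_Suc tl_drop)
  qed auto
  then show ?thesis by (simp add: mult_2)
qed

definition mv :: "nat \<Rightarrow> nat \<Rightarrow> com" where
  "mv a b = While (Nonempty a) (Seq (Pop a) (Push b True))"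

lemma run_mv:
  assumes "\<sigma> a = un n" "a \<noteq> b"
  shows "run (mv a b) \<sigma> (3 * n + 1) (\<sigma>(a := [], b := un n @ \<sigma> b))"
proof -
  let ?st = "\<lambda>i. \<sigma>(a := un (n - i), b := un i @ \<sigma> b)"
  have "run (mv a b) (?st 0) (Suc (\<Sum>i<n. Suc 2)) (?st n)"
    unfolding mv_def
  proof (rule run_While)
    fix i assume "i < n"
    have "run (Seq (Pop a) (Push b True)) (?st i) (1 + 1)
       ((?st i)(a := tl (?st i a), b := True # ((?st i)(a := tl (?st i a))) b))"
      by (rule run_Seq[OF run_Pop run_Push])
    moreover have "(?st i)(a := tl (?st i a), b := True # ((?st i)(a := tl (?st i a))) b) = ?st (Suc i)"
      using assms by (auto simp: fun_eq_iff tl_replicate)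
    ultimately show "run (Seq (Pop a) (Push b True)) (?st i) 2 (?st (Suc i))" by (simp only: one_add_one)
  qed (use assms in auto)
  moreover have "?st 0 = \<sigma>" using assms by auto
  ultimately show ?thesis by (simp add: mult.commute)
qed

definition mv2 :: "nat \<Rightarrow> nat \<Rightarrow> nat \<Rightarrow> com" where
  "mv2 a b c = While (Nonempty a) (Seq (Pop a) (Seq (Push b True) (Push c True)))"

lemma run_mv2:
  assumes "\<sigma> a = un n" "a \<noteq> b" "a \<noteq> c" "b \<noteq> c"
  shows "run (mv2 a b c) \<sigma> (4 * n + 1) (\<sigma>(a := [], b := un n @ \<sigma> b, c := un n @ \<sigma> c))"
proof -
  let ?st = "\<lambda>i. \<sigma>(a := un (n - i), b := un i @ \<sigma> b, c := un i @ \<sigma> c)"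
  have "run (mv2 a b c) (?st 0) (Suc (\<Sum>i<n. Suc 3)) (?st n)"
    unfolding mv2_def
  proof (rule run_While)
    fix i assume "i < n"
    let ?s1 = "(?st i)(a := tl (?st i a))"
    let ?s2 = "?s1(b := True # ?s1 b)"
    have "run (Seq (Pop a) (Seq (Push b True) (Push c True))) (?st i) (1 + (1 + 1)) (?s2(c := True # ?s2 c))"
      by (rule run_Seq[OF run_Pop run_Seq[OF run_Push run_Push]])
    moreover have "?s2(c := True # ?s2 c) = ?st (Suc i)"
      using assms by (auto simp: fun_eq_iff tl_replicate)
    ultimately show "run (Seq (Pop a) (Seq (Push b True) (Push c True))) (?st i) 3 (?st (Suc i))"
      by (simp add: numeral_3_eq_3)
  qed (use assms in auto)
  moreover have "?st 0 = \<sigma>" using assms by auto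
  ultimately show ?thesis by (simp add: mult.commute)
qed

text \<open>A stack is read only by popping, so the source is emptied onto the target and a scratch
  stack and then refilled from the latter.\<close>

definition copy :: "nat \<Rightarrow> nat \<Rightarrow> nat \<Rightarrow> com" where
  "copy a b s = Seq (mv2 a b s) (mv s a)"

lemma run_copy:
  assumes "\<sigma> a = un n" "a \<noteq> b" "a \<noteq> s" "b \<noteq> s" "\<sigma> s = []"
  shows "run (copy a b s) \<sigma> (7 * n + 2) (\<sigma>(b := un n @ \<sigma> b))"
proof -
  let ?s1 = "\<sigma>(a := [], b := un n @ \<sigma> b, s := un n @ \<sigma> s)"
  have "run (copy a b s) \<sigma> ((4 * n + 1) + (3 * n + 1)) (?s1(s := [], a := un n @ ?s1 a))"
    unfolding copy_def by (rule run_Seq[OF run_mv2 run_mv]) (use assms in auto)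
  moreover have "?s1(s := [], a := un n @ ?s1 a) = \<sigma>(b := un n @ \<sigma> b)"
    using assms by (auto simp: fun_eq_iff)
  ultimately show ?thesis by simp
qed

definition mvb :: "nat \<Rightarrow> nat \<Rightarrow> com" where
  "mvb a b = Seq (If (Top a) (Push b True) (Push b False)) (Pop a)"

lemma run_mvb:
  assumes "\<sigma> a \<noteq> []" "a \<noteq> b"
  shows "run (mvb a b) \<sigma> 3 (\<sigma>(a := tl (\<sigma> a), b := hd (\<sigma> a) # \<sigma> b))"
proof -
  let ?s1 = "\<sigma>(b := hd (\<sigma> a) # \<sigma> b)"
  have "run (mvb a b) \<sigma> (Suc 1 + 1) (?s1(a := tl (?s1 a)))"
    unfolding mvb_def
  proof (rule run_Seq[OF run_If run_Pop])
    show "run (Push b True) \<sigma> 1 ?s1" if "holds (Top a) \<sigma>"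
      using that run_Push[of b True \<sigma>] by simp
    show "run (Push b False) \<sigma> 1 ?s1" if "\<not> holds (Top a) \<sigma>"
      using that assms run_Push[of b False \<sigma>] by simp
  qed
  moreover have "?s1(a := tl (?s1 a)) = \<sigma>(a := tl (\<sigma> a), b := hd (\<sigma> a) # \<sigma> b)"
    using assms by (auto simp: fun_eq_iff)
  ultimately show ?thesis by (simp add: numeral_3_eq_3)
qed

text \<open>The test of \<open>a\<close> admits a counter larger than the stack, which occurs when a
  bit beyond the end of the word is asked for. The popped part arrives reversed;
  \<open>mvall\<close> restores it by a second reversal.\<close>

definition mvn :: "nat \<Rightarrow> nat \<Rightarrow> nat \<Rightarrow> com" where
  "mvn c a b = While (Nonempty c) (Seq (Pop c) (If (Nonempty a) (mvb a b) Skip))"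

lemma run_mvn:
  assumes "\<sigma> c = un n" "a \<noteq> b" "a \<noteq> c" "b \<noteq> c"
  shows "run (mvn c a b) \<sigma> (6 * n + 1) (\<sigma>(c := [], a := drop n (\<sigma> a), b := rev (take n (\<sigma> a)) @ \<sigma> b))"
proof -
  let ?st = "\<lambda>i. \<sigma>(c := un (n - i), a := drop i (\<sigma> a), b := rev (take i (\<sigma> a)) @ \<sigma> b)"
  have "run (mvn c a b) (?st 0) (Suc (\<Sum>i<n. Suc (1 + Suc 3))) (?st n)"
    unfolding mvn_def
  proof (rule run_While)
    fix i assume i: "i < n"
    let ?s1 = "(?st i)(c := tl (?st i c))"
    show "run (Seq (Pop c) (If (Nonempty a) (mvb a b) Skip)) (?st i) (1 + Suc 3) (?st (Suc i))"
    proof (rule run_Seq[OF run_Pop], rule run_If)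
      assume "holds (Nonempty a) ?s1"
      then have l: "i < length (\<sigma> a)" using assms by auto
      have "run (mvb a b) ?s1 3 (?s1(a := tl (?s1 a), b := hd (?s1 a) # ?s1 b))"
        by (rule run_mvb) (use assms l in auto)
      moreover have "?s1(a := tl (?s1 a), b := hd (?s1 a) # ?s1 b) = ?st (Suc i)"
        using assms l by (auto simp: fun_eq_iff tl_replicate hd_drop_conv_nth take_Suc_conv_app_nth
            drop_Suc tl_drop)
      ultimately show "run (mvb a b) ?s1 3 (?st (Suc i))" by simp
    next
      assume "\<not> holds (Nonempty a) ?s1"
      then have l: "length (\<sigma> a) \<le> i" using assms by auto
      have "?s1 = ?st (Suc i)"
        using assms l by (auto simp: fun_eq_iff tl_replicate)
      then show "run Skip ?s1 3 (?st (Suc i))"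
        using run_mono[OF run_Skip] by simp
    qed
  qed (use assms in auto)
  moreover have "?st 0 = \<sigma>" using assms by auto
  ultimately show ?thesis by (simp add: mult.commute)
qed

definition mvall :: "nat \<Rightarrow> nat \<Rightarrow> com" where
  "mvall a b = While (Nonempty a) (mvb a b)"

lemma run_mvall:
  assumes "a \<noteq> b"
  shows "run (mvall a b) \<sigma> (4 * length (\<sigma> a) + 1) (\<sigma>(a := [], b := rev (\<sigma> a) @ \<sigma> b))"
proof -
  let ?st = "\<lambda>i. \<sigma>(a := drop i (\<sigma> a), b := rev (take i (\<sigma> a)) @ \<sigma> b)"
  let ?n = "length (\<sigma> a)"
  have "run (mvall a b) (?st 0) (Suc (\<Sum>i<?n. Suc 3)) (?st ?n)"
    unfolding mvall_def
  proof (rule run_While)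
    fix i assume i: "i < ?n"
    have "run (mvb a b) (?st i) 3 ((?st i)(a := tl (?st i a), b := hd (?st i a) # ?st i b))"
      by (rule run_mvb) (use assms i in auto)
    moreover have "(?st i)(a := tl (?st i a), b := hd (?st i a) # ?st i b) = ?st (Suc i)"
      using assms i by (auto simp: fun_eq_iff hd_drop_conv_nth take_Suc_conv_app_nth
          drop_Suc tl_drop)
    ultimately show "run (mvb a b) (?st i) 3 (?st (Suc i))" by simp
  qed (use assms in auto)
  moreover have "?st 0 = \<sigma>" using assms by auto
  ultimately show ?thesis using assms by (simp add: mult.commute)
qed

section \<open>Programs for functions of a word and an environment: composition and primitive
  recursion\<close>

type_synonym env = "nat \<Rightarrow> nat"

text \<open>Calling convention: in \<open>computes C f T\<close>, the program \<open>C \<rho> r m\<close> finds the word \<open>x\<close> on stack 0 and variable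
  \<open>i\<close> in unary on stack \<open>\<rho> i\<close>, writes \<open>f x e\<close> to the empty stack \<open>r\<close> and leaves everything else unchanged.
  The stacks from \<open>m\<close> on are empty and serve as scratch space. Environments are infinite, but as \<open>\<rho> i < m\<close>, only
  those with finitely many values occur. Binders extend them at index 0 by \<^const>\<open>case_nat\<close>.\<close>

definition pre :: "(nat \<Rightarrow> nat) \<Rightarrow> nat \<Rightarrow> nat \<Rightarrow> state \<Rightarrow> bool list \<Rightarrow> env \<Rightarrow> bool" where
  "pre \<rho> r m \<sigma> x e \<longleftrightarrow> (\<forall>i. \<rho> i < m \<and> \<rho> i \<noteq> 0 \<and> \<rho> i \<noteq> r \<and> \<sigma> (\<rho> i) = un (e i)) \<and>
     0 < r \<and> r < m \<and> \<sigma> 0 = x \<and> \<sigma> r = [] \<and> (\<forall>i\<ge>m. \<sigma> i = [])"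

definition computes ::
    "((nat \<Rightarrow> nat) \<Rightarrow> nat \<Rightarrow> nat \<Rightarrow> com) \<Rightarrow> (bool list \<Rightarrow> env \<Rightarrow> nat) \<Rightarrow> (bool list \<Rightarrow> env \<Rightarrow> nat) \<Rightarrow> bool" where
  "computes C f T \<longleftrightarrow> (\<forall>\<rho> r m \<sigma> x e. pre \<rho> r m \<sigma> x e \<longrightarrow>
     run (C \<rho> r m) \<sigma> (T x e) (\<sigma>(r := un (f x e))))"

lemma computesD:
  "computes C f T \<Longrightarrow> pre \<rho> r m \<sigma> x e \<Longrightarrow> run (C \<rho> r m) \<sigma> (T x e) (\<sigma>(r := un (f x e)))"
  by (auto simp: computes_def)

lemma computes_var: "computes (\<lambda>\<rho> r m. copy (\<rho> i) r m) (\<lambda>x e. e i) (\<lambda>x e. 7 * e i + 2)"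
  unfolding computes_def
proof (intro allI impI)
  fix \<rho> r m \<sigma> x e assume p: "pre \<rho> r m \<sigma> x e"
  have "run (copy (\<rho> i) r m) \<sigma> (7 * e i + 2) (\<sigma>(r := un (e i) @ \<sigma> r))"
    by (rule run_copy) (use p in \<open>auto simp: pre_def less_imp_neq dest: spec[of _ i]\<close>)
  then show "run (copy (\<rho> i) r m) \<sigma> (7 * e i + 2) (\<sigma>(r := un (e i)))"
    using p by (simp add: pre_def)
qed

lemma computes_zero: "computes (\<lambda>\<rho> r m. Skip) (\<lambda>x e. 0) (\<lambda>x e. 1)"
  unfolding computes_def
  by (metis (no_types, lifting) fun_upd_triv pre_def replicate_0 run_Skip)

lemma computes_Suc:
  "computes (\<lambda>\<rho> r m. Seq (copy (\<rho> i) r m) (Push r True)) (\<lambda>x e. Suc (e i)) (\<lambda>x e. 7 * e i + 3)"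
  unfolding computes_def
proof (intro allI impI)
  fix \<rho> r m \<sigma> x e assume p: "pre \<rho> r m \<sigma> x e"
  let ?s = "\<sigma>(r := un (e i))"
  have "run (Seq (copy (\<rho> i) r m) (Push r True)) \<sigma> ((7 * e i + 2) + 1) (?s(r := True # ?s r))"
    by (rule run_Seq[OF computesD[OF computes_var p] run_Push])
  then show "run (Seq (copy (\<rho> i) r m) (Push r True)) \<sigma> (7 * e i + 3) (\<sigma>(r := un (Suc (e i))))"
    by (simp add: numeral_3_eq_3)
qed

text \<open>Programs are parametrized by the address map \<open>\<rho>\<close>, which may send
  several variables to one stack. So renaming variables is a change of addresses and costs no
  time.\<close>

lemma computes_rename:
  "computes C f T \<Longrightarrow> computes (\<lambda>\<rho>. C (\<lambda>i. \<rho> (\<theta> i))) (\<lambda>x e. f x (\<lambda>i. e (\<theta> i))) (\<lambda>x e. T x (\<lambda>i. e (\<theta> i)))"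
  unfolding computes_def
  by (intro allI impI, elim allE, erule mp) (auto simp: pre_def)

definition mvc :: "nat \<Rightarrow> nat \<Rightarrow> nat \<Rightarrow> com" where
  "mvc a b r = While (Nonempty a) (Seq (mvb a b) (Push r True))"

lemma run_mvc:
  assumes "a \<noteq> b" "a \<noteq> r" "b \<noteq> r"
  shows "run (mvc a b r) \<sigma> (5 * length (\<sigma> a) + 1)
     (\<sigma>(a := [], b := rev (\<sigma> a) @ \<sigma> b, r := un (length (\<sigma> a)) @ \<sigma> r))"
proof -
  let ?st = "\<lambda>i. \<sigma>(a := drop i (\<sigma> a), b := rev (take i (\<sigma> a)) @ \<sigma> b, r := un i @ \<sigma> r)"
  let ?n = "length (\<sigma> a)"
  have "run (mvc a b r) (?st 0) (Suc (\<Sum>i<?n. Suc (3 + 1))) (?st ?n)"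
    unfolding mvc_def
  proof (rule run_While)
    fix i assume i: "i < ?n"
    let ?s1 = "(?st i)(a := tl (?st i a), b := hd (?st i a) # ?st i b)"
    have "run (Seq (mvb a b) (Push r True)) (?st i) (3 + 1) (?s1(r := True # ?s1 r))"
      by (rule run_Seq[OF run_mvb run_Push]) (use assms i in auto)
    moreover have "?s1(r := True # ?s1 r) = ?st (Suc i)"
      using assms i by (auto simp: fun_eq_iff hd_drop_conv_nth take_Suc_conv_app_nth
          drop_Suc tl_drop)
    ultimately show "run (Seq (mvb a b) (Push r True)) (?st i) (3 + 1) (?st (Suc i))" by simp
  qed (use assms in auto)
  moreover have "?st 0 = \<sigma>" using assms by auto
  ultimately show ?thesis using assms by (simp add: mult.commute)
qed

lemma computes_length:
  "computes (\<lambda>\<rho> r m. Seq (mvc 0 m r) (mvall m 0)) (\<lambda>x e. length x) (\<lambda>x e. 9 * length x + 2)"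
  unfolding computes_def
proof (intro allI impI)
  fix \<rho> r m \<sigma> x e assume p: "pre \<rho> r m \<sigma> x e"
  let ?s1 = "\<sigma>(0 := [], m := rev (\<sigma> 0) @ \<sigma> m, r := un (length (\<sigma> 0)) @ \<sigma> r)"
  have "run (Seq (mvc 0 m r) (mvall m 0)) \<sigma> ((5 * length (\<sigma> 0) + 1) + (4 * length (?s1 m) + 1))
     (?s1(m := [], 0 := rev (?s1 m) @ ?s1 0))"
    by (rule run_Seq[OF run_mvc run_mvall]) (use p in \<open>auto simp: pre_def\<close>)
  moreover have "?s1(m := [], 0 := rev (?s1 m) @ ?s1 0) = \<sigma>(r := un (length x))"
    using p by (auto simp: fun_eq_iff pre_def)
  ultimately show "run (Seq (mvc 0 m r) (mvall m 0)) \<sigma> (9 * length x + 2) (\<sigma>(r := un (length x)))"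
    using p by (simp add: pre_def)
qed

lemma computes_bit:
  "computes (\<lambda>\<rho> r m. Seq (copy (\<rho> i) m (m + 1)) (Seq (mvn m 0 (m + 1))
      (Seq (If (Top 0) (Push r True) Skip) (mvall (m + 1) 0))))
    (\<lambda>x e. of_bool (e i < length x \<and> x ! e i)) (\<lambda>x e. 17 * e i + 6)"
  unfolding computes_def
proof (intro allI impI)
  fix \<rho> r m \<sigma> x e assume p: "pre \<rho> r m \<sigma> x e"
  have i: "\<rho> i < m" "\<rho> i \<noteq> 0" "\<rho> i \<noteq> r" "\<sigma> (\<rho> i) = un (e i)" "0 < r" "r < m" "\<sigma> 0 = x" "\<sigma> r = []"
    "\<sigma> m = []" "\<sigma> (Suc m) = []" using p by (auto simp: pre_def)
  let ?n = "e i"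
  let ?s1 = "\<sigma>(m := un ?n @ \<sigma> m)"
  let ?s2 = "?s1(m := [], 0 := drop ?n (?s1 0), (m + 1) := rev (take ?n (?s1 0)) @ ?s1 (m + 1))"
  let ?b = "of_bool (?n < length x \<and> x ! ?n) :: nat"
  let ?s3 = "?s2(r := un ?b)"
  let ?s4 = "?s3(m + 1 := [], 0 := rev (?s3 (m + 1)) @ ?s3 0)"
  have 1: "run (copy (\<rho> i) m (m + 1)) \<sigma> (7 * ?n + 2) ?s1"
    using i by (intro run_copy) auto
  have 2: "run (mvn m 0 (m + 1)) ?s1 (6 * ?n + 1) ?s2"
    using i by (intro run_mvn) auto
  have 3: "run (If (Top 0) (Push r True) Skip) ?s2 (Suc 1) ?s3"
  proof (rule run_If)
    assume "holds (Top 0) ?s2"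
    then have "?b = 1" using i by (auto simp: hd_drop_conv_nth)
    moreover have "?s2 r = []" using i by auto
    ultimately show "run (Push r True) ?s2 1 ?s3" using run_Push[of r True ?s2] by simp
  next
    assume "\<not> holds (Top 0) ?s2"
    then have "?b = 0" using i by (auto simp: hd_drop_conv_nth)
    then have "?s3 = ?s2" using i by (auto simp: fun_eq_iff)
    then show "run Skip ?s2 1 ?s3" using run_Skip[of ?s2] by (simp only:)
  qed
  have 4: "run (mvall (m + 1) 0) ?s3 (4 * length (?s3 (m + 1)) + 1) ?s4"
    by (rule run_mvall) simp
  have 5: "?s4 = \<sigma>(r := un ?b)" using i by (auto simp: fun_eq_iff)
  show "run (Seq (copy (\<rho> i) m (m + 1)) (Seq (mvn m 0 (m + 1))
      (Seq (If (Top 0) (Push r True) Skip) (mvall (m + 1) 0)))) \<sigma> (17 * ?n + 6) (\<sigma>(r := un ?b))"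
    using run_Seq[OF 1 run_Seq[OF 2 run_Seq[OF 3 4]]] unfolding 5
    by (rule run_mono) (use i in auto)
qed

definition clet where
  "clet C D \<rho> r m = Seq (C \<rho> m (m + 1)) (Seq (D (case_nat m \<rho>) r (m + 1)) (clear m))"

lemma computes_let:
  assumes C: "computes C f T" and D: "computes D g T'"
  shows "computes (clet C D) (\<lambda>x e. g x (case_nat (f x e) e))
     (\<lambda>x e. T x e + T' x (case_nat (f x e) e) + 2 * f x e + 1)"
  unfolding computes_def
proof (intro allI impI)
  fix \<rho> r m \<sigma> x e assume p: "pre \<rho> r m \<sigma> x e"
  let ?a = "f x e" let ?e = "case_nat ?a e"
  let ?s1 = "\<sigma>(m := un ?a)"
  let ?s2 = "?s1(r := un (g x ?e))"
  have 1: "run (C \<rho> m (m + 1)) \<sigma> (T x e) ?s1"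
    by (rule computesD[OF C]) (use p in \<open>auto simp: pre_def less_imp_neq less_SucI\<close>)
  have 2: "run (D (case_nat m \<rho>) r (m + 1)) ?s1 (T' x ?e) ?s2"
    by (rule computesD[OF D])
      (use p in \<open>auto simp: pre_def less_imp_neq less_SucI split: nat.split\<close>)
  have 3: "run (clear m) ?s2 (2 * length (?s2 m) + 1) (?s2(m := []))"
    by (rule run_clear)
  have 4: "?s2(m := []) = \<sigma>(r := un (g x ?e))" "length (?s2 m) = ?a"
    using p by (auto simp: fun_eq_iff pre_def)
  show "run (clet C D \<rho> r m) \<sigma> (T x e + T' x ?e + 2 * f x e + 1) (\<sigma>(r := un (g x ?e)))"
    unfolding clet_def using run_Seq[OF 1 run_Seq[OF 2 3]] unfolding 4 by (simp add: add_ac)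
qed

text \<open>Stack m counts down, m + 1 holds the index of the round, m + 2 the accumulator, and m +
  3 receives the next value before it replaces the accumulator.\<close>

definition citer where
  "citer N G H \<rho> r m = Seq (N \<rho> m (m + 1)) (Seq (G \<rho> (m + 2) (m + 3)) (Seq
     (While (Nonempty m) (Seq (Pop m) (Seq (H (case_nat (m + 2) (case_nat (m + 1) \<rho>)) (m + 3) (m + 4))
        (Seq (clear (m + 2)) (Seq (mv (m + 3) (m + 2)) (Push (m + 1) True))))))
     (Seq (clear (m + 1)) (mv (m + 2) r))))"

text \<open>Moving a unary number costs its value, so the time is kept as a sum over the actual
  accumulators. Bounds on them enter only where time matters, in \<open>pf_iter\<close> and
  \<open>power_program\<close>.\<close>

lemma computes_iter:
  fixes n g h
  defines "R \<equiv> \<lambda>x e. rec_nat (g x e) (\<lambda>i a. h x (case_nat a (case_nat i e)))"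
  assumes N: "computes N n TN" and G: "computes G g TG" and H: "computes H h TH"
  shows "computes (citer N G H) (\<lambda>x e. R x e (n x e))
     (\<lambda>x e. TN x e + TG x e + (\<Sum>i<n x e. TH x (case_nat (R x e i) (case_nat i e)) + 2 * R x e i
        + 3 * R x e (Suc i) + 5) + 2 * n x e + 3 * R x e (n x e) + 3)"
  unfolding computes_def
proof (intro allI impI)
  fix \<rho> r m \<sigma> x e assume p: "pre \<rho> r m \<sigma> x e"
  let ?n = "n x e" let ?R = "R x e"
  let ?st = "\<lambda>i. \<sigma>(m := un (?n - i), m + 1 := un i, m + 2 := un (?R i))"
  have R0: "?R 0 = g x e" and RS: "?R (Suc i) = h x (case_nat (?R i) (case_nat i e))" for i
    by (auto simp: R_def)
  have e: "\<sigma> m = []" "\<sigma> (Suc m) = []" "\<sigma> (Suc (Suc m)) = []" "\<sigma> (m + 3) = []"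
    and rm: "r < m" "0 < r" and srm: "\<sigma> r = []" using p by (auto simp: pre_def)
  have 1: "run (N \<rho> m (m + 1)) \<sigma> (TN x e) (\<sigma>(m := un ?n))"
    by (rule computesD[OF N]) (use p in \<open>auto simp: pre_def less_imp_neq less_SucI\<close>)
  have "run (G \<rho> (m + 2) (m + 3)) (\<sigma>(m := un ?n)) (TG x e) (\<sigma>(m := un ?n, m + 2 := un (g x e)))"
  proof (rule computesD[OF G])
    have "\<rho> i < m" for i using p by (simp add: pre_def)
    then have "\<rho> i \<noteq> m \<and> \<rho> i \<noteq> m + 2 \<and> \<rho> i < m + 3" for i
      by (metis add_lessD1 less_irrefl less_add_same_cancel1 trans_less_add1)
    then show "pre \<rho> (m + 2) (m + 3) (\<sigma>(m := un ?n)) x e"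
      using p by (auto simp: pre_def)
  qed
  moreover have "\<sigma>(m := un ?n, m + 2 := un (g x e)) = ?st 0"
    using e by (auto simp: fun_eq_iff R0)
  ultimately have 2: "run (G \<rho> (m + 2) (m + 3)) (\<sigma>(m := un ?n)) (TG x e) (?st 0)" by simp
  let ?body = "Seq (Pop m) (Seq (H (case_nat (m + 2) (case_nat (m + 1) \<rho>)) (m + 3) (m + 4))
        (Seq (clear (m + 2)) (Seq (mv (m + 3) (m + 2)) (Push (m + 1) True))))"
  let ?t = "\<lambda>i. 1 + (TH x (case_nat (?R i) (case_nat i e)) + ((2 * ?R i + 1) + ((3 * ?R (Suc i) + 1) + 1)))"
  have 3: "run (While (Nonempty m) ?body) (?st 0) (Suc (\<Sum>i<?n. Suc (?t i))) (?st ?n)"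
  proof (rule run_While)
    fix i assume i: "i < ?n"
    show "holds (Nonempty m) (?st i)" using i by simp
    let ?s1 = "(?st i)(m := tl (?st i m))"
    let ?s2 = "?s1(m + 3 := un (?R (Suc i)))"
    let ?s3 = "?s2(m + 2 := [])"
    let ?s4 = "?s3(m + 3 := [], m + 2 := un (?R (Suc i)) @ ?s3 (m + 2))"
    let ?s5 = "?s4(m + 1 := True # ?s4 (m + 1))"
    have b: "run (H (case_nat (m + 2) (case_nat (m + 1) \<rho>)) (m + 3) (m + 4)) ?s1
        (TH x (case_nat (?R i) (case_nat i e))) ?s2"
      unfolding RS
      by (rule computesD[OF H])
       (use p in \<open>auto simp: pre_def less_imp_neq less_SucI trans_less_add1 split: nat.split\<close>)
    have c: "run (clear (m + 2)) ?s2 (2 * ?R i + 1) ?s3"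
      using run_clear[of "m + 2" ?s2] by simp
    have d: "run (mv (m + 3) (m + 2)) ?s3 (3 * ?R (Suc i) + 1) ?s4"
      by (rule run_mv) auto
    have "?s5 = ?st (Suc i)" using e i by (auto simp: fun_eq_iff tl_replicate)
    then show "run ?body (?st i) (?t i) (?st (Suc i))"
      using run_Seq[OF run_Pop[of m "?st i"] run_Seq[OF b run_Seq[OF c run_Seq[OF d run_Push[of "m + 1" True]]]]]
      by simp
  qed simp
  let ?s6 = "(?st ?n)(m + 1 := [])"
  let ?s7 = "?s6(m + 2 := [], r := un (?R ?n) @ ?s6 r)"
  have 4: "run (clear (m + 1)) (?st ?n) (2 * ?n + 1) ?s6"
    using run_clear[of "m + 1" "?st ?n"] by simp
  have 5: "run (mv (m + 2) r) ?s6 (3 * ?R ?n + 1) ?s7"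
    by (rule run_mv) (use rm in auto)
  have 6: "?s7 = \<sigma>(r := un (?R ?n))" using e rm srm by (auto simp: fun_eq_iff)
  have 7: "(\<Sum>i<?n. Suc (?t i)) = (\<Sum>i<?n. TH x (case_nat (?R i) (case_nat i e)) + 2 * ?R i
        + 3 * ?R (Suc i) + 5)"
    by (rule sum.cong) auto
  show "run (citer N G H \<rho> r m) \<sigma> (TN x e + TG x e + (\<Sum>i<?n. TH x (case_nat (?R i) (case_nat i e)) + 2 * ?R i
        + 3 * ?R (Suc i) + 5) + 2 * ?n + 3 * ?R ?n + 3) (\<sigma>(r := un (?R ?n)))"
    using run_Seq[OF 1 run_Seq[OF 2 run_Seq[OF 3 run_Seq[OF 4 5]]]] unfolding 6 7 citer_def
    by (rule run_mono) simp
qed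

section \<open>Polynomially bounded functions\<close>

text \<open>The summand 2 keeps the base at least 2, so that constants and sums are absorbed by a
  larger exponent. Environments are infinite, hence the restriction to the first n
  variables.\<close>

definition sz :: "nat \<Rightarrow> bool list \<Rightarrow> env \<Rightarrow> nat" where
  "sz n x e = length x + (\<Sum>i<n. e i) + 2"

definition pbd :: "(bool list \<Rightarrow> env \<Rightarrow> nat) \<Rightarrow> bool" where
  "pbd T \<longleftrightarrow> (\<exists>n d. \<forall>x e. T x e \<le> sz n x e ^ d)"

lemma sz_mono: "n \<le> n' \<Longrightarrow> sz n x e \<le> sz n' x e"
  unfolding sz_def by (intro add_mono sum_mono2) auto

lemma sz_power_mono: "n \<le> n' \<Longrightarrow> d \<le> d' \<Longrightarrow> sz n x e ^ d \<le> sz n' x e ^ d'"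
  by (meson order_trans power_increasing power_mono sz_mono le_add2 one_le_numeral sz_def zero_le
      le_trans[OF one_le_numeral] eq_refl[OF sz_def[symmetric]])

lemma pbdE2:
  assumes "pbd S" "pbd T"
  obtains n d where "\<And>x e. S x e \<le> sz n x e ^ d" "\<And>x e. T x e \<le> sz n x e ^ d"
proof -
  obtain n d n' d' where "\<And>x e. S x e \<le> sz n x e ^ d" "\<And>x e. T x e \<le> sz n' x e ^ d'"
    using assms unfolding pbd_def by blast
  then show ?thesis
    by (intro that[of "max n n'" "max d d'"]) (meson order_trans sz_power_mono max.cobounded1 max.cobounded2)+
qed

lemma pbd_le: "pbd T' \<Longrightarrow> (\<And>x e. T x e \<le> T' x e) \<Longrightarrow> pbd T"
  unfolding pbd_def by (meson order_trans)

lemma pbd_const: "pbd (\<lambda>x e. c)"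
proof -
  have "c \<le> sz 0 x e ^ c" for x e
  proof -
    have "c \<le> 2 ^ c" by (simp add: less_imp_le)
    also have "\<dots> \<le> sz 0 x e ^ c" by (rule power_mono) (auto simp: sz_def)
    finally show ?thesis .
  qed
  then show ?thesis unfolding pbd_def by blast
qed

lemma pbd_var: "pbd (\<lambda>x e. e i)"
  unfolding pbd_def by (rule exI[of _ "Suc i"], rule exI[of _ 1]) (simp add: sz_def)

lemma pbd_length: "pbd (\<lambda>x e. length x)"
  unfolding pbd_def by (rule exI[of _ 0], rule exI[of _ 1]) (simp add: sz_def)

lemma pbd_add: assumes "pbd S" "pbd T" shows "pbd (\<lambda>x e. S x e + T x e)"
proof -
  obtain n d where *: "\<And>x e. S x e \<le> sz n x e ^ d" "\<And>x e. T x e \<le> sz n x e ^ d"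
    by (rule pbdE2[OF assms]) blast
  have "S x e + T x e \<le> sz n x e ^ Suc d" for x e
  proof -
    have "S x e + T x e \<le> 2 * sz n x e ^ d" using *[of x e] by simp
    also have "\<dots> \<le> sz n x e ^ Suc d" by (simp add: sz_def)
    finally show ?thesis .
  qed
  then show ?thesis unfolding pbd_def by blast
qed

lemma pbd_mult: assumes "pbd S" "pbd T" shows "pbd (\<lambda>x e. S x e * T x e)"
proof -
  obtain n d where *: "\<And>x e. S x e \<le> sz n x e ^ d" "\<And>x e. T x e \<le> sz n x e ^ d"
    by (rule pbdE2[OF assms]) blast
  have "S x e * T x e \<le> sz n x e ^ (d + d)" for x e
    unfolding power_add using * by (rule mult_le_mono)
  then show ?thesis unfolding pbd_def by blast
qed

lemma pbd_power: "pbd T \<Longrightarrow> pbd (\<lambda>x e. T x e ^ c)"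
  by (induction c) (simp_all add: pbd_mult pbd_const pbd_const[of 1, simplified])

lemma pbd_Suc: "pbd T \<Longrightarrow> pbd (\<lambda>x e. Suc (T x e))"
  using pbd_add[OF _ pbd_const[of 1]] by simp

lemma pbd_sum_const: "(\<And>i. i < n \<Longrightarrow> pbd (\<lambda>x e. T x e i)) \<Longrightarrow> pbd (\<lambda>x e. \<Sum>i<(n::nat). T x e i)"
  by (induction n) (simp_all add: pbd_add pbd_const)

lemma pbd_env:
  assumes T: "pbd T" and \<theta>: "\<And>i. pbd (\<lambda>x e. \<theta> x e i)"
  shows "pbd (\<lambda>x e. T x (\<theta> x e))"
proof -
  obtain n d where *: "\<And>x e. T x e \<le> sz n x e ^ d" using T unfolding pbd_def by blast
  have "pbd (\<lambda>x e. sz n x (\<theta> x e) ^ d)"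
    unfolding sz_def by (intro pbd_power pbd_add pbd_length pbd_const pbd_sum_const \<theta>)
  then show ?thesis by (rule pbd_le) (rule *)
qed

lemma pbd_case_nat: "pbd F \<Longrightarrow> (\<And>i. pbd (\<lambda>x e. \<theta> x e i)) \<Longrightarrow> pbd (\<lambda>x e. case_nat (F x e) (\<theta> x e) i)"
  by (cases i) auto

text \<open>The bound \<open>sz\<close> is monotone in the environment, so each summand is at most
  the bound taken at the largest index and at \<open>V\<close>. The a priori bound \<open>V\<close>
  is what excludes exponentially growing accumulators.\<close>

lemma pbd_sum2:
  assumes h: "pbd h" and N: "pbd N" and V: "pbd V"
    and S: "\<And>x e i. i < N x e \<Longrightarrow> S x e i \<le> V x e"
  shows "pbd (\<lambda>x e. \<Sum>i<N x e. h x (case_nat (S x e i) (case_nat i e)))"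
proof -
  obtain n d where *: "\<And>x e. h x e \<le> sz n x e ^ d" using h unfolding pbd_def by blast
  let ?B = "\<lambda>x e. sz n x (case_nat (V x e) (case_nat (N x e) e)) ^ d"
  have "pbd (\<lambda>x e. sz n x e ^ d)" unfolding pbd_def by blast
  then have "pbd ?B"
    by (rule pbd_env) (intro pbd_case_nat V N pbd_var)
  then have B: "pbd (\<lambda>x e. N x e * ?B x e)" using N by (rule pbd_mult[rotated])
  have "(\<Sum>i<N x e. h x (case_nat (S x e i) (case_nat i e))) \<le> N x e * ?B x e" for x e
  proof -
    have "h x (case_nat (S x e i) (case_nat i e)) \<le> ?B x e" if i: "i < N x e" for i
    proof -
      have "case_nat (S x e i) (case_nat i e) j \<le> case_nat (V x e) (case_nat (N x e) e) j" for j
        using S[OF i] i by (simp split: nat.split)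
      then have "sz n x (case_nat (S x e i) (case_nat i e)) \<le> sz n x (case_nat (V x e) (case_nat (N x e) e))"
        unfolding sz_def by (intro add_mono sum_mono) auto
      then show ?thesis by (intro order_trans[OF *] power_mono) auto
    qed
    then have "(\<Sum>i<N x e. h x (case_nat (S x e i) (case_nat i e))) \<le> (\<Sum>i<N x e. ?B x e)"
      by (intro sum_mono) auto
    then show ?thesis by simp
  qed
  then show ?thesis by (rule pbd_le[OF B])
qed

text \<open>Polynomial time, with polynomially bounded values, as opposed to mere computability \<open>cf\<close>. All numbers are
  unary, so polynomial means polynomial in their values.\<close>

definition pf :: "(bool list \<Rightarrow> env \<Rightarrow> nat) \<Rightarrow> bool" where
  "pf f \<longleftrightarrow> pbd f \<and> (\<exists>C T. computes C f T \<and> pbd T)"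

definition cf :: "(bool list \<Rightarrow> env \<Rightarrow> nat) \<Rightarrow> bool" where
  "cf f \<longleftrightarrow> (\<exists>C T. computes C f T)"

lemma pfI: "computes C f T \<Longrightarrow> pbd T \<Longrightarrow> pbd f \<Longrightarrow> pf f"
  unfolding pf_def by blast

lemma pf_imp_cf: "pf f \<Longrightarrow> cf f"
  unfolding pf_def cf_def by blast

lemmas pbd_intros = pbd_add pbd_mult pbd_const pbd_var pbd_length pbd_Suc pbd_power pbd_case_nat

lemma pf_var: "pf (\<lambda>x e. e i)"
  by (rule pfI[OF computes_var]; intro pbd_intros)

lemma pf_zero: "pf (\<lambda>x e. 0)"
  by (rule pfI[OF computes_zero]; intro pbd_intros)

lemma pf_length: "pf (\<lambda>x e. length x)"
  by (rule pfI[OF computes_length]; intro pbd_intros)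

lemma pf_bit_var: "pf (\<lambda>x e. of_bool (e i < length x \<and> x ! e i))"
  by (rule pfI[OF computes_bit], intro pbd_intros, rule pbd_le[OF pbd_const[of 1]], auto)

lemma pf_Suc_var: "pf (\<lambda>x e. Suc (e i))"
  by (rule pfI[OF computes_Suc]; intro pbd_intros)

lemma pf_rename: "pf f \<Longrightarrow> pf (\<lambda>x e. f x (\<lambda>i. e (\<theta> i)))"
proof -
  assume "pf f"
  then obtain C T where *: "pbd f" "computes C f T" "pbd T" unfolding pf_def by blast
  show ?thesis
    by (rule pfI[OF computes_rename[OF *(2)]])
      (rule pbd_env[where \<theta> = "\<lambda>x e i. e (\<theta> i)"], fact, rule pbd_var)+
qed

lemma cf_rename: "cf f \<Longrightarrow> cf (\<lambda>x e. f x (\<lambda>i. e (\<theta> i)))"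
  unfolding cf_def by (elim exE, intro exI, rule computes_rename)

lemma pf_let: "pf f \<Longrightarrow> pf g \<Longrightarrow> pf (\<lambda>x e. g x (case_nat (f x e) e))"
proof -
  assume "pf f" "pf g"
  then obtain C T D T' where *: "pbd f" "pbd g" "computes C f T" "pbd T" "computes D g T'" "pbd T'"
    unfolding pf_def by blast
  show ?thesis
    by (rule pfI[OF computes_let[OF *(3,5)]]) (intro pbd_intros * pbd_env[OF *(6)] pbd_env[OF *(2)])+
qed

lemma cf_let: "cf f \<Longrightarrow> cf g \<Longrightarrow> cf (\<lambda>x e. g x (case_nat (f x e) e))"
  unfolding cf_def by (elim exE, intro exI, rule computes_let)

text \<open>Limited recursion: polynomial time is closed under iteration only if all intermediate
  values obey a polynomial bound known beforehand. Repeated doubling shows why \<open>V\<close> is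
  demanded.\<close>

lemma pf_iter:
  assumes n: "pf n" and g: "pf g" and h: "pf (\<lambda>x e. h x (e 0) (e 1) (\<lambda>i. e (Suc (Suc i))))"
    and V: "pbd V" "\<And>x e i. i \<le> n x e \<Longrightarrow> rec_nat (g x e) (\<lambda>i a. h x a i e) i \<le> V x e"
  shows "pf (\<lambda>x e. rec_nat (g x e) (\<lambda>i a. h x a i e) (n x e))"
proof -
  obtain N TN G TG H TH where c: "computes N n TN" "pbd TN" "computes G g TG" "pbd TG"
      "computes H (\<lambda>x e. h x (e 0) (e 1) (\<lambda>i. e (Suc (Suc i)))) TH" "pbd TH" "pbd n" "pbd g"
    using n g h unfolding pf_def by blast
  let ?R = "\<lambda>x e. rec_nat (g x e) (\<lambda>i a. h x a i e)"
  have s: "pbd (\<lambda>x e. \<Sum>i<n x e. TH x (case_nat (?R x e i) (case_nat i e)))"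
    by (rule pbd_sum2[OF c(6,7) V(1)]) (rule V(2), simp)
  have s2: "pbd (\<lambda>x e. \<Sum>i<n x e. 2 * ?R x e i + 3 * ?R x e (Suc i) + 5)"
  proof (rule pbd_le)
    show "pbd (\<lambda>x e. n x e * (5 * V x e + 5))" by (intro pbd_intros V c)
    show "(\<Sum>i<n x e. 2 * ?R x e i + 3 * ?R x e (Suc i) + 5) \<le> n x e * (5 * V x e + 5)" for x e
    proof -
      have "2 * ?R x e i + 3 * ?R x e (Suc i) + 5 \<le> 5 * V x e + 5" if "i < n x e" for i
        using V(2)[of i x e] V(2)[of "Suc i" x e] that by linarith
      then have "(\<Sum>i<n x e. 2 * ?R x e i + 3 * ?R x e (Suc i) + 5) \<le> (\<Sum>i<n x e. 5 * V x e + 5)"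
        by (intro sum_mono) auto
      then show ?thesis by simp
    qed
  qed
  have v: "pbd (\<lambda>x e. ?R x e (n x e))" by (rule pbd_le[OF V(1)]) (rule V(2), simp)
  show ?thesis
    unfolding pf_def
  proof (intro conjI exI)
    show "pbd (\<lambda>x e. ?R x e (n x e))" by (rule v)
    show "computes (citer N G H) (\<lambda>x e. ?R x e (n x e))
     (\<lambda>x e. TN x e + TG x e + ((\<Sum>i<n x e. TH x (case_nat (?R x e i) (case_nat i e)))
        + (\<Sum>i<n x e. 2 * ?R x e i + 3 * ?R x e (Suc i) + 5)) + 2 * n x e + 3 * ?R x e (n x e) + 3)"
      using computes_iter[OF c(1,3,5)] by (simp add: sum.distrib add_ac)
    show "pbd (\<lambda>x e. TN x e + TG x e + ((\<Sum>i<n x e. TH x (case_nat (?R x e i) (case_nat i e)))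
        + (\<Sum>i<n x e. 2 * ?R x e i + 3 * ?R x e (Suc i) + 5)) + 2 * n x e + 3 * ?R x e (n x e) + 3)"
      by (intro pbd_add s s2 pbd_mult pbd_const c v)
  qed
qed

lemma cf_iter:
  assumes n: "cf n" and g: "cf g" and h: "cf (\<lambda>x e. h x (e 0) (e 1) (\<lambda>i. e (Suc (Suc i))))"
  shows "cf (\<lambda>x e. rec_nat (g x e) (\<lambda>i a. h x a i e) (n x e))"
proof -
  obtain N TN G TG H TH where c: "computes N n TN" "computes G g TG"
      "computes H (\<lambda>x e. h x (e 0) (e 1) (\<lambda>i. e (Suc (Suc i)))) TH"
    using n g h unfolding cf_def by blast
  show ?thesis unfolding cf_def using computes_iter[OF c] by auto
qed

section \<open>Arithmetic, comparisons and bounded quantifiers in polynomial time\<close>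

lemma pf_comp1:
  assumes h: "pf (\<lambda>x e. h x (e 0))" and f: "pf f"
  shows "pf (\<lambda>x e. h x (f x e))"
  using pf_let[OF f h] by simp

lemma pf_comp2:
  assumes h: "pf (\<lambda>x e. h x (e 0) (e 1))" and f: "pf f" and g: "pf g"
  shows "pf (\<lambda>x e. h x (f x e) (g x e))"
proof -
  \<comment> \<open>Binding \<open>f\<close> first and \<open>g\<close> second leaves the value of
    \<open>g\<close> at index 0, so the arguments are swapped.\<close>
  have h': "pf (\<lambda>x e. h x (e 1) (e 0))"
    using pf_rename[OF h, of "case_nat 1 (\<lambda>_. 0)"] by simp
  have "pf (\<lambda>x e. g x (\<lambda>i. e (Suc i)))" by (rule pf_rename[OF g])
  from pf_let[OF f pf_let[OF this h']] show ?thesis by simp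
qed

lemma pf_Suc: "pf f \<Longrightarrow> pf (\<lambda>x e. Suc (f x e))"
  by (rule pf_comp1[OF pf_Suc_var])

lemma pf_const: "pf (\<lambda>x e. c)"
  by (induction c) (simp_all add: pf_zero pf_Suc)

lemma pf_bit: "pf f \<Longrightarrow> pf (\<lambda>x e. of_bool (f x e < length x \<and> x ! f x e))"
  by (rule pf_comp1[OF pf_bit_var])

lemma rec_nat_add: "rec_nat a (\<lambda>_. Suc) b = a + b" by (induction b) auto
lemma rec_nat_pred: "rec_nat 0 (\<lambda>i _. i) n = n - 1" by (cases n) auto
lemma rec_nat_diff: "rec_nat a (\<lambda>_ s. s - 1) b = a - b" by (induction b) auto
lemma rec_nat_mult: "rec_nat 0 (\<lambda>_ s. s + a) b = (a::nat) * b" by (induction b) auto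
lemma rec_nat_sum: "rec_nat 0 (\<lambda>i s. s + f i) n = (\<Sum>i<n. f i :: nat)" by (induction n) auto

lemma pf_add: "pf f \<Longrightarrow> pf g \<Longrightarrow> pf (\<lambda>x e. f x e + g x e)"
proof (erule (1) pf_comp2[rotated])
  have "pf (\<lambda>x e. rec_nat (e 0) (\<lambda>i a. Suc a) (e 1))"
    by (rule pf_iter[where V = "\<lambda>x e. e 0 + e 1"]) (auto intro!: pf_var pf_Suc pbd_intros simp: rec_nat_add)
  then show "pf (\<lambda>x e. e 0 + e 1)" by (simp add: rec_nat_add)
qed

lemma pf_diff: "pf f \<Longrightarrow> pf g \<Longrightarrow> pf (\<lambda>x e. f x e - g x e)"
proof (erule (1) pf_comp2[rotated])
  have "pf (\<lambda>x e. rec_nat 0 (\<lambda>i a. i) (e 0))"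
    by (rule pf_iter[where V = "\<lambda>x e. e 0"]) (auto intro!: pf_var pf_zero pbd_intros simp: rec_nat_pred)
  then have p: "pf (\<lambda>x e. e 0 - 1)" by (simp add: rec_nat_pred)
  have "pf (\<lambda>x e. rec_nat (e 0) (\<lambda>i a. a - 1) (e 1))"
    by (rule pf_iter[where V = "\<lambda>x e. e 0", OF _ _ p])
      (auto intro!: pf_var pbd_intros simp: rec_nat_diff[unfolded One_nat_def])
  then show "pf (\<lambda>x e. e 0 - e 1)" by (simp only: rec_nat_diff)
qed

lemma pf_mult: "pf f \<Longrightarrow> pf g \<Longrightarrow> pf (\<lambda>x e. f x e * g x e)"
proof (erule (1) pf_comp2[rotated])
  have "pf (\<lambda>x e. rec_nat 0 (\<lambda>i a. a + e 0) (e 1))"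
    by (rule pf_iter[where V = "\<lambda>x e. e 0 * e 1"])
      (auto intro!: pf_var pf_zero pf_add pbd_intros simp: rec_nat_mult)
  then show "pf (\<lambda>x e. e 0 * e 1)" by (simp add: rec_nat_mult)
qed

lemma pf_power: "pf f \<Longrightarrow> pf (\<lambda>x e. f x e ^ c)"
  by (induction c) (simp_all add: pf_mult pf_const)

lemma pf_sum:
  assumes n: "pf n" and f: "pf (\<lambda>x e. f x (e 0) (\<lambda>i. e (Suc i)))"
  shows "pf (\<lambda>x e. \<Sum>i<n x e. f x i e)"
proof -
  have f': "pf (\<lambda>x e. f x (e 1) (\<lambda>i. e (Suc (Suc i))))"
    using pf_rename[OF f, of Suc] by simp
  have p: "pbd (\<lambda>x e. \<Sum>i<n x e. f x i e)"
    using pbd_sum2[of "\<lambda>x e. f x (e 1) (\<lambda>i. e (Suc (Suc i)))" n "\<lambda>x e. 0" "\<lambda>x e i. 0"] f' n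
    by (simp add: pf_def pbd_const)
  have "pf (\<lambda>x e. rec_nat 0 (\<lambda>i a. a + f x i e) (n x e))"
    by (rule pf_iter[OF n pf_zero _ p]) (auto intro!: pf_add pf_var f' sum_mono2 simp: rec_nat_sum simp del: One_nat_def)
  then show ?thesis by (simp add: rec_nat_sum)
qed

abbreviation pb :: "(bool list \<Rightarrow> env \<Rightarrow> bool) \<Rightarrow> bool" where
  "pb P \<equiv> pf (\<lambda>x e. of_bool (P x e))"

lemma pb_cong: "pf f \<Longrightarrow> (\<And>x e. f x e = of_bool (P x e)) \<Longrightarrow> pb P"
proof -
  assume "pf f" and f: "\<And>x e. f x e = of_bool (P x e)"
  moreover have "f = (\<lambda>x e. of_bool (P x e))" by (intro ext f)
  ultimately show ?thesis by (simp only:)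
qed

lemma pb_le: "pf f \<Longrightarrow> pf g \<Longrightarrow> pb (\<lambda>x e. f x e \<le> g x e)"
  by (rule pb_cong[of "\<lambda>x e. 1 - (f x e - g x e)"]) (intro pf_diff pf_const, auto)

lemma pb_less: "pf f \<Longrightarrow> pf g \<Longrightarrow> pb (\<lambda>x e. f x e < g x e)"
  using pb_le[OF pf_Suc, of f g] by (simp only: Suc_le_eq)

lemma pb_conj: "pb P \<Longrightarrow> pb Q \<Longrightarrow> pb (\<lambda>x e. P x e \<and> Q x e)"
  by (rule pb_cong[of "\<lambda>x e. of_bool (P x e) * of_bool (Q x e)"]) (auto intro!: pf_mult)

lemma pb_not: "pb P \<Longrightarrow> pb (\<lambda>x e. \<not> P x e)"
  by (rule pb_cong[of "\<lambda>x e. 1 - of_bool (P x e)"]) (auto intro!: pf_diff pf_const simp del: One_nat_def)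

lemma pb_disj: "pb P \<Longrightarrow> pb Q \<Longrightarrow> pb (\<lambda>x e. P x e \<or> Q x e)"
  using pb_not[OF pb_conj[OF pb_not pb_not], of P Q] by (simp only: de_Morgan_conj not_not)

lemma pb_imp: "pb P \<Longrightarrow> pb Q \<Longrightarrow> pb (\<lambda>x e. P x e \<longrightarrow> Q x e)"
  using pb_disj[OF pb_not, of P Q] by (simp only: imp_conv_disj)

lemma pb_iff: "pb P \<Longrightarrow> pb Q \<Longrightarrow> pb (\<lambda>x e. P x e \<longleftrightarrow> Q x e)"
  using pb_conj[OF pb_imp pb_imp, of P Q Q P] by (simp only: iff_conv_conj_imp)

lemma pb_eq: "pf f \<Longrightarrow> pf g \<Longrightarrow> pb (\<lambda>x e. f x e = g x e)"
  using pb_conj[OF pb_le pb_le, of f g g f] by (simp only: eq_iff)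

lemma pb_const: "pb (\<lambda>x e. P)"
  by (cases P) (simp_all add: pf_const)

lemma pb_ex:
  assumes n: "pf n" and P: "pb (\<lambda>x e. P x (e 0) (\<lambda>i. e (Suc i)))"
  shows "pb (\<lambda>x e. \<exists>i<n x e. P x i e)"
proof (rule pb_cong)
  show "pf (\<lambda>x e. of_bool (0 < (\<Sum>i<n x e. of_bool (P x i e) :: nat)))"
    using pf_sum[OF n, of "\<lambda>x i e. of_bool (P x i e)"] P by (intro pb_less pf_zero) auto
qed (auto simp: sum_nonneg_eq_0_iff)

lemma pb_all:
  assumes n: "pf n" and P: "pb (\<lambda>x e. P x (e 0) (\<lambda>i. e (Suc i)))"
  shows "pb (\<lambda>x e. \<forall>i<n x e. P x i e)"
  using pb_not[OF pb_ex[OF n, of "\<lambda>x i e. \<not> P x i e"]] pb_not[OF P] by simp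

lemma pf_if: "pb P \<Longrightarrow> pf f \<Longrightarrow> pf g \<Longrightarrow> pf (\<lambda>x e. if P x e then f x e else g x e)"
proof -
  assume "pb P" "pf f" "pf g"
  then have "pf (\<lambda>x e. of_bool (P x e) * f x e + (1 - of_bool (P x e)) * g x e)"
    by (intro pf_add pf_mult pf_diff pf_const)
  moreover have "(\<lambda>x e. of_bool (P x e) * f x e + (1 - of_bool (P x e)) * g x e) =
      (\<lambda>x e. if P x e then f x e else g x e)" by (auto simp: fun_eq_iff)
  ultimately show ?thesis by simp
qed

text \<open>Division as a bounded count of multiples, which sums and comparisons already provide.
  The guard \<open>0 < b\<close> yields the convention that division by 0 is 0.\<close>

lemma div_eq_sum: "a div b = (\<Sum>i<a. of_bool (0 < b \<and> Suc i * b \<le> (a::nat)))"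
proof (cases "b = 0")
  case False
  have "{i. i < a \<and> Suc i * b \<le> a} = {..<a div b}"
  proof -
    have "Suc i * b \<le> a \<longleftrightarrow> i < a div b" for i
      using False by (metis Suc_le_eq less_eq_div_iff_mult_less_eq neq0_conv)
    moreover have "i < a div b \<Longrightarrow> i < a" for i by (meson div_le_dividend order_less_le_trans)
    ultimately show ?thesis by auto
  qed
  then have "card {i. i < a \<and> Suc i * b \<le> a} = a div b" by simp
  moreover have "(\<Sum>i<a. of_bool (0 < b \<and> Suc i * b \<le> a)) = card ({..<a} \<inter> {i. 0 < b \<and> Suc i * b \<le> a})"
    by (simp add: sum_of_bool_eq)
  moreover have "{..<a} \<inter> {i. 0 < b \<and> Suc i * b \<le> a} = {i. i < a \<and> Suc i * b \<le> a}"
    using False by auto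
  ultimately show ?thesis by metis
qed simp

lemma pf_div: "pf f \<Longrightarrow> pf g \<Longrightarrow> pf (\<lambda>x e. f x e div g x e)"
proof (erule (1) pf_comp2[rotated])
  show "pf (\<lambda>x e. e 0 div e 1)"
    unfolding div_eq_sum
    by (intro pf_sum pb_conj pb_less pb_le pf_mult pf_Suc pf_var pf_const)
qed

lemma pf_mod: "pf f \<Longrightarrow> pf g \<Longrightarrow> pf (\<lambda>x e. f x e mod g x e)"
  using pf_diff[OF _ pf_mult[OF _ pf_div]] by (simp add: minus_mult_div_eq_mod[symmetric])

definition digit :: "nat \<Rightarrow> nat \<Rightarrow> nat \<Rightarrow> nat" where
  "digit b j a = a div b ^ j mod b"

lemma rec_nat_div: "rec_nat a (\<lambda>_ s. s div b) j = a div (b::nat) ^ j"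
  by (induction j) (auto simp: div_mult2_eq[symmetric] mult.commute)

text \<open>The power \<open>b ^ j\<close> is not polynomially bounded in b and j, so it is never
  computed: j successive divisions keep every intermediate value below the dividend.\<close>

lemma pf_digit: assumes f: "pf f" "pf g" "pf h" shows "pf (\<lambda>x e. digit (f x e) (g x e) (h x e))"
proof -
  have "pf (\<lambda>x e. rec_nat (h x e) (\<lambda>i s. s div f x e) (g x e))"
  proof (rule pf_iter[where V = h])
    show "pf (\<lambda>x e. e 0 div f x (\<lambda>i. e (Suc (Suc i))))"
      by (intro pf_div pf_var pf_rename[OF f(1)])
    show "pbd h" using f by (simp add: pf_def)
  qed (use f in \<open>simp_all add: rec_nat_div\<close>)
  then show ?thesis unfolding digit_def rec_nat_div by (intro pf_mod f)
qed

lemmas pf_intros = pf_add pf_diff pf_mult pf_Suc pf_length pf_sum pf_div pf_mod pf_digit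
  pb_le pb_less pb_conj pb_not pb_disj pb_imp pb_iff pb_eq pb_ex pb_all pf_if pf_power pf_var pb_const pf_const

section \<open>Computable functions and fpt-reductions\<close>

lemma cf_comp1:
  assumes h: "cf (\<lambda>x e. h x (e 0))" and f: "cf f"
  shows "cf (\<lambda>x e. h x (f x e))"
  using cf_let[OF f h] by simp

lemma cf_comp2:
  assumes h: "cf (\<lambda>x e. h x (e 0) (e 1))" and f: "cf f" and g: "cf g"
  shows "cf (\<lambda>x e. h x (f x e) (g x e))"
proof -
  have h': "cf (\<lambda>x e. h x (e 1) (e 0))"
    using cf_rename[OF h, of "case_nat 1 (\<lambda>_. 0)"] by simp
  have "cf (\<lambda>x e. g x (\<lambda>i. e (Suc i)))" by (rule cf_rename[OF g])
  from cf_let[OF f cf_let[OF this h']] show ?thesis by simp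
qed

lemma cf_const: "cf (\<lambda>x e. c)"
  by (rule pf_imp_cf[OF pf_const])

lemma cf_var: "cf (\<lambda>x e. e i)"
  by (rule pf_imp_cf[OF pf_var])

lemma cf_add: "cf f \<Longrightarrow> cf g \<Longrightarrow> cf (\<lambda>x e. f x e + g x e)"
  by (rule cf_comp2[of "\<lambda>x a b. a + b"]) (intro pf_imp_cf pf_add pf_var)

lemma cf_mult: "cf f \<Longrightarrow> cf g \<Longrightarrow> cf (\<lambda>x e. f x e * g x e)"
  by (rule cf_comp2[of "\<lambda>x a b. a * b"]) (intro pf_imp_cf pf_mult pf_var)

lemma cf_power_const: "cf f \<Longrightarrow> cf (\<lambda>x e. f x e ^ c)"
  by (induction c) (simp_all add: cf_mult cf_const[of 1, simplified])

lemma rec_nat_power: "rec_nat (Suc 0) (\<lambda>_ s. s * b) k = (b::nat) ^ k" by (induction k) auto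

lemma cf_power: "cf f \<Longrightarrow> cf g \<Longrightarrow> cf (\<lambda>x e. f x e ^ g x e)"
proof (erule (1) cf_comp2[rotated])
  have "cf (\<lambda>x e. rec_nat (Suc 0) (\<lambda>i a. a * e 0) (e 1))"
    by (rule cf_iter[where h = "\<lambda>x a i e. a * e 0"]) (intro cf_var cf_const cf_mult)+
  then show "cf (\<lambda>x e. e 0 ^ e 1)" by (simp only: rec_nat_power)
qed

section \<open>Embedding an arbitrary program: its stacks, their relocation and their
  clean-up\<close>

primrec written :: "com \<Rightarrow> nat set" where
  "written Skip = {}"
| "written (Push r b) = {r}"
| "written (Pop r) = {r}"
| "written (Seq c d) = written c \<union> written d"
| "written (If b c d) = written c \<union> written d"
| "written (While b c) = written c"

lemma finite_written: "finite (written c)" by (induction c) auto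

lemma exec_not_written: "exec c \<sigma> t \<sigma>' \<Longrightarrow> r \<notin> written c \<Longrightarrow> \<sigma>' r = \<sigma> r"
  by (induction rule: exec.induct) auto

lemma exec_length: "exec c \<sigma> t \<sigma>' \<Longrightarrow> length (\<sigma>' r) \<le> length (\<sigma> r) + t"
  by (induction rule: exec.induct) auto

primrec shift_test :: "nat \<Rightarrow> test \<Rightarrow> test" where
  "shift_test m (Nonempty r) = Nonempty (r + m)"
| "shift_test m (Top r) = Top (r + m)"

primrec shift :: "nat \<Rightarrow> com \<Rightarrow> com" where
  "shift m Skip = Skip"
| "shift m (Push r b) = Push (r + m) b"
| "shift m (Pop r) = Pop (r + m)"
| "shift m (Seq c d) = Seq (shift m c) (shift m d)"
| "shift m (If b c d) = If (shift_test m b) (shift m c) (shift m d)"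
| "shift m (While b c) = While (shift_test m b) (shift m c)"

definition above :: "nat \<Rightarrow> state \<Rightarrow> state \<Rightarrow> state" where
  "above m \<tau> \<sigma> = (\<lambda>r. if r < m then \<tau> r else \<sigma> (r - m))"

lemma holds_shift: "holds (shift_test m b) (above m \<tau> \<sigma>) = holds b \<sigma>"
  by (cases b) (auto simp: above_def)

lemma above_upd: "(above m \<tau> \<sigma>)(r + m := v) = above m \<tau> (\<sigma>(r := v))"
  by (auto simp: above_def fun_eq_iff)

lemma above_at: "above m \<tau> \<sigma> (r + m) = \<sigma> r"
  by (simp add: above_def)

lemma exec_shift: "exec c \<sigma> t \<sigma>' \<Longrightarrow> exec (shift m c) (above m \<tau> \<sigma>) t (above m \<tau> \<sigma>')"
proof (induction rule: exec.induct)
  case (exec_Push r b \<sigma>)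
  show ?case
    using exec.exec_Push[of "r + m" b "above m \<tau> \<sigma>"] by (simp only: above_upd above_at shift.simps)
next
  case (exec_Pop r \<sigma>)
  show ?case
    using exec.exec_Pop[of "r + m" "above m \<tau> \<sigma>"] by (simp only: above_upd above_at shift.simps)
qed (auto intro: exec.intros simp: holds_shift simp del: One_nat_def)

primrec clears :: "nat \<Rightarrow> nat \<Rightarrow> com" where
  "clears 0 m = Skip"
| "clears (Suc n) m = Seq (clear (m + n)) (clears n m)"

lemma run_clears:
  "run (clears n m) \<sigma> ((\<Sum>i<n. 2 * length (\<sigma> (m + i)) + 1) + 1) (\<lambda>r. if m \<le> r \<and> r < m + n then [] else \<sigma> r)"
proof (induction n arbitrary: \<sigma>)
  case 0
  have "(\<lambda>r. if m \<le> r \<and> r < m + 0 then [] else \<sigma> r) = \<sigma>" by (auto simp: fun_eq_iff)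
  then show ?case using run_Skip[of \<sigma>] by simp
next
  case (Suc n)
  let ?s = "\<sigma>(m + n := [])"
  have "run (clears (Suc n) m) \<sigma> ((2 * length (\<sigma> (m + n)) + 1) + ((\<Sum>i<n. 2 * length (?s (m + i)) + 1) + 1))
     (\<lambda>r. if m \<le> r \<and> r < m + n then [] else ?s r)"
    using run_Seq[OF run_clear Suc.IH[of ?s]] by simp
  moreover have "(\<lambda>r. if m \<le> r \<and> r < m + n then [] else ?s r) = (\<lambda>r. if m \<le> r \<and> r < m + Suc n then [] else \<sigma> r)"
    by (auto simp: fun_eq_iff)
  moreover have "(\<Sum>i<n. 2 * length (?s (m + i)) + 1) = (\<Sum>i<n. 2 * length (\<sigma> (m + i)) + 1)"
    by (rule sum.cong) auto
  ultimately show ?case by (simp add: add_ac)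
qed

text \<open>A program for \<open>f\<close> follows no calling convention. It is relocated to the
  stacks from m on, with its parameter on stack m + 1, and all stacks it may have used are emptied
  afterwards.\<close>

lemma cf_computable:
  assumes "computable f"
  shows "cf (\<lambda>x e. f (e 0))"
proof -
  obtain c where "\<forall>k. \<exists>t \<sigma>. exec c (init [] k) t \<sigma> \<and> \<sigma> 1 = un (f k)"
    using assms unfolding computable_def by blast
  then obtain t s where c: "\<And>k. exec c (init [] k) (t k) (s k)" "\<And>k. s k 1 = un (f k)"
    by metis
  \<comment> \<open>\<open>2 <= K\<close> because stacks 0 and 1 carry the input; from K on all
    stacks start empty and are never written.\<close>
  obtain K where K: "\<And>r. r \<in> written c \<Longrightarrow> r < K" "2 \<le> K"
  proof -
    obtain K0 where "\<forall>r\<in>written c. r < K0" using finite_written[of c] finite_nat_set_iff_bounded by blast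
    then show ?thesis by (intro that[of "max K0 2"]) auto
  qed
  let ?P = "\<lambda>\<rho> r m. Seq (copy (\<rho> 0) (m + 1) m) (Seq (shift m c) (Seq (mv (m + 1) r) (clears K m)))"
  let ?T = "\<lambda>k. (7 * k + 2) + (t k + ((3 * f k + 1) + ((\<Sum>i<K. 2 * length (s k i) + 1) + 1)))"
  have "computes ?P (\<lambda>x e. f (e 0)) (\<lambda>x e. ?T (e 0))"
    unfolding computes_def
  proof (intro allI impI)
    fix \<rho> r m \<sigma> x e assume p: "pre \<rho> r m \<sigma> x e"
    let ?k = "e 0"
    let ?s1 = "\<sigma>(m + 1 := un ?k @ \<sigma> (m + 1))"
    let ?s2 = "above m \<sigma> (s ?k)"
    let ?s3 = "?s2(m + 1 := [], r := un (f ?k) @ ?s2 r)"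
    let ?s4 = "\<lambda>q. if m \<le> q \<and> q < m + K then [] else ?s3 q"
    have r: "r < m" "\<sigma> r = []" using p by (auto simp: pre_def)
    have 1: "run (copy (\<rho> 0) (m + 1) m) \<sigma> (7 * ?k + 2) ?s1"
      by (rule run_copy) (use p in \<open>auto simp: pre_def less_imp_neq less_SucI\<close>)
    have "?s1 = above m \<sigma> (init [] ?k)"
      using p by (auto simp: fun_eq_iff pre_def above_def init_def)
    then have 2: "run (shift m c) ?s1 (t ?k) ?s2"
      using exec_shift[OF c(1)[of ?k]] unfolding run_def by auto
    have 3: "run (mv (m + 1) r) ?s2 (3 * f ?k + 1) ?s3"
      by (rule run_mv) (use r c(2)[of ?k] in \<open>auto simp: above_def\<close>)
    have 4: "run (clears K m) ?s3 ((\<Sum>i<K. 2 * length (?s3 (m + i)) + 1) + 1) ?s4"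
      by (rule run_clears)
    have 5: "(\<Sum>i<K. 2 * length (?s3 (m + i)) + 1) \<le> (\<Sum>i<K. 2 * length (s ?k i) + 1)"
      by (rule sum_mono) (use r in \<open>auto simp: above_def\<close>)
    have "s ?k q = []" if "K \<le> q" for q
    proof -
      have "s ?k q = init [] ?k q"
        by (rule exec_not_written[OF c(1)]) (use that K in \<open>auto simp: not_less[symmetric]\<close>)
      then show ?thesis using that K by (simp add: init_def)
    qed
    then have 6: "?s4 = \<sigma>(r := un (f ?k))"
      using r p K by (auto simp: fun_eq_iff above_def pre_def)
    show "run (?P \<rho> r m) \<sigma> (?T ?k) (\<sigma>(r := un (f ?k)))"
      using run_Seq[OF 1 run_Seq[OF 2 run_Seq[OF 3 4]]] unfolding 6
      by (rule run_mono) (use 5 in linarith)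
  qed
  then show ?thesis unfolding cf_def by blast
qed

lemma computable_cf:
  assumes "cf (\<lambda>x e. h (e 0))"
  shows "computable h"
proof -
  obtain C T where C: "computes C (\<lambda>x e. h (e 0)) T" using assms unfolding cf_def by blast
  let ?P = "Seq (C (\<lambda>_. 1) 2 3) (Seq (clear 1) (mv 2 1))"
  have "\<exists>t \<sigma>. exec ?P (init [] k) t \<sigma> \<and> \<sigma> 1 = un (h k)" for k
  proof -
    let ?s1 = "(init [] k)(2 := un (h k))"
    let ?s2 = "?s1(1 := [])"
    let ?s3 = "?s2(2 := [], 1 := un (h k) @ ?s2 1)"
    have 1: "run (C (\<lambda>_. 1) 2 3) (init [] k) (T [] (\<lambda>_. k)) ?s1"
      by (rule computesD[OF C]) (auto simp: pre_def init_def)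
    have 2: "run (mv 2 1) ?s2 (3 * h k + 1) ?s3" by (rule run_mv) auto
    obtain t where "exec ?P (init [] k) t ?s3"
      using run_Seq[OF 1 run_Seq[OF run_clear 2]] unfolding run_def by blast
    moreover have "?s3 1 = un (h k)" by simp
    ultimately show ?thesis by blast
  qed
  then show ?thesis unfolding computable_def by blast
qed

section \<open>Programs on a word that grows while it is being read\<close>

lemma pbd_word:
  assumes T: "pbd T" and w: "pbd (\<lambda>x e. length (w x e))" and \<theta>: "\<And>i. pbd (\<lambda>x e. \<theta> x e i)"
  shows "pbd (\<lambda>x e. T (w x e) (\<theta> x e))"
proof -
  obtain n d where *: "\<And>x e. T x e \<le> sz n x e ^ d" using T unfolding pbd_def by blast
  have "pbd (\<lambda>x e. sz n (w x e) (\<theta> x e) ^ d)"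
    unfolding sz_def by (intro pbd_power pbd_add pbd_length pbd_const pbd_sum_const \<theta> w)
  then show ?thesis by (rule pbd_le) (rule *)
qed

text \<open>\<open>b ^ k\<close> is not polynomial in k, but the time is polynomial in k and the
  value itself. Hence \<open>T\<close> is evaluated in an environment that contains this
  value.\<close>

lemma power_program:
  assumes b: "0 < b"
  shows "\<exists>C T. pbd T \<and> (\<forall>\<rho> r m \<sigma> x k. pre \<rho> r m \<sigma> x (\<lambda>_. k) \<longrightarrow>
    run (C \<rho> r m) \<sigma> (T x (case_nat k (case_nat (b ^ k) (\<lambda>_. 0)))) (\<sigma>(r := un (b ^ k))))"
proof -
  have "pf (\<lambda>x e. e 0 * b)" "pf (\<lambda>x e. 1)" by (intro pf_mult pf_var pf_const)+
  then obtain H TH G TG where H: "computes H (\<lambda>x e. e 0 * b) TH" "pbd TH"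
    and G: "computes G (\<lambda>x e. 1) TG" "pbd TG" unfolding pf_def by blast
  obtain n d where nd: "\<And>x e. TH x e \<le> sz n x e ^ d" using H(2) unfolding pbd_def by blast
  define T where "T = (\<lambda>x e. (7 * e 0 + 2) + TG x (\<lambda>_. e 0)
      + e 0 * ((length x + n * (e 0 + e (Suc 0)) + 2) ^ d + 5 * e (Suc 0) + 5)
      + 2 * e 0 + 3 * e (Suc 0) + 3)"
  have pT: "pbd T" unfolding T_def
    by (intro pbd_intros pbd_env[OF G(2)])
  have "run (citer (\<lambda>\<rho> r m. copy (\<rho> 0) r m) G H \<rho> r m) \<sigma>
      (T x (case_nat k (case_nat (b ^ k) (\<lambda>_. 0)))) (\<sigma>(r := un (b ^ k)))"
    if p: "pre \<rho> r m \<sigma> x (\<lambda>_. k)" for \<rho> r m \<sigma> x k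
  proof -
    have mono: "b ^ i \<le> b ^ k" if "i \<le> k" for i using b that by (simp add: power_increasing)
    have "TH x (case_nat (b ^ i) (case_nat i (\<lambda>_. k))) + 2 * b ^ i + 3 * b ^ Suc i + 5
       \<le> (length x + n * (k + b ^ k) + 2) ^ d + 5 * b ^ k + 5" if i: "i < k" for i
    proof -
      have "case_nat (b ^ i) (case_nat i (\<lambda>_. k)) j \<le> k + b ^ k" for j
        using mono[of i] i by (auto split: nat.split)
      then have "(\<Sum>j<n. case_nat (b ^ i) (case_nat i (\<lambda>_. k)) j) \<le> (\<Sum>j<n. k + b ^ k)"
        by (intro sum_mono) auto
      then have "sz n x (case_nat (b ^ i) (case_nat i (\<lambda>_. k))) \<le> length x + n * (k + b ^ k) + 2"
        by (simp add: sz_def)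
      then have "TH x (case_nat (b ^ i) (case_nat i (\<lambda>_. k))) \<le> (length x + n * (k + b ^ k) + 2) ^ d"
        by (intro order_trans[OF nd] power_mono) auto
      then show ?thesis using mono[of i] mono[of "Suc i"] i by linarith
    qed
    then have "(\<Sum>i<k. TH x (case_nat (b ^ i) (case_nat i (\<lambda>_. k))) + 2 * b ^ i + 3 * b ^ Suc i + 5)
       \<le> (\<Sum>i<k. (length x + n * (k + b ^ k) + 2) ^ d + 5 * b ^ k + 5)"
      by (intro sum_mono) auto
    then have s: "(\<Sum>i<k. TH x (case_nat (b ^ i) (case_nat i (\<lambda>_. k))) + 2 * b ^ i + 3 * b ^ Suc i + 5)
       \<le> k * ((length x + n * (k + b ^ k) + 2) ^ d + 5 * b ^ k + 5)" by simp
    have R: "rec_nat (Suc 0) (\<lambda>i a. a * b) i = b ^ i" for i by (rule rec_nat_power)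
    show ?thesis
      using computesD[OF computes_iter[OF computes_var[of 0] G(1) H(1)] p]
      unfolding One_nat_def nat.case R
      by (elim run_mono) (use s in \<open>simp add: T_def\<close>)
  qed
  then show ?thesis using pT by blast
qed

text \<open>New bits are prepended, so that a push appends to the table of the bits computed so far and the input
  remains readable as the end of the word.\<close>

primrec word_rec :: "(bool list \<Rightarrow> env \<Rightarrow> bool) \<Rightarrow> env \<Rightarrow> bool list \<Rightarrow> nat \<Rightarrow> bool list" where
  "word_rec b e x 0 = x"
| "word_rec b e x (Suc l) = b (word_rec b e x l) (case_nat l e) # word_rec b e x l"

lemma length_word_rec [simp]: "length (word_rec b e x l) = length x + l"
  by (induction l) auto

text \<open>With a bit number prepended, variables 0 to 3 are the number of bits computed so far,
  the parameter, \<open>B ^ k\<close> and the length of the original input. The last is stored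
  because the word grows.\<close>

definition kenv :: "nat \<Rightarrow> nat \<Rightarrow> nat \<Rightarrow> env" where
  "kenv k M p = case_nat k (case_nat M (case_nat p (\<lambda>_. 0)))"

text \<open>The stacks between 2 and \<open>R\<close> may hold debris of an earlier program, as the
  reduction starts from the output of another one. The result is a prefix of the final word because
  the bits computed last stand in front.\<close>

definition transforms where
  "transforms b L out kk B T R prog \<longleftrightarrow> (\<forall>\<sigma> x k M y. \<sigma> 0 = x \<and> \<sigma> 1 = un k \<and> (\<forall>i\<ge>R. \<sigma> i = []) \<and>
      M = B ^ k \<and> y = word_rec b (kenv k M (length x)) x (L x (case_nat 0 (kenv k M (length x)))) \<longrightarrow>
      (\<exists>\<sigma>'. run prog \<sigma> (T x (case_nat k (case_nat M (\<lambda>_. 0)))) \<sigma>' \<and>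
       \<sigma>' 0 = take (out y (case_nat (L x (case_nat 0 (kenv k M (length x)))) (kenv k M (length x)))) y \<and>
       \<sigma>' 1 = un (kk y (case_nat (L x (case_nat 0 (kenv k M (length x)))) (kenv k M (length x))))))"

lemma word_program:
  assumes b: "pb b" and L: "pf L" and out: "pf out" and kk: "pf kk" and B: "0 < B"
  shows "\<exists>T. pbd T \<and> (\<forall>R\<ge>2. \<exists>prog. transforms b L out kk B T R prog)"
proof -
  obtain Cb Tb CL TL Co To Ck Tk where c: "computes Cb (\<lambda>x e. of_bool (b x e)) Tb" "computes CL L TL"
      "computes Co out To" "computes Ck kk Tk" and
    t: "pbd Tb" "pbd TL" "pbd To" "pbd Tk" and v: "pbd L" "pbd out" "pbd kk"
    using assms unfolding pf_def by blast
  obtain Cp Tp where Tp: "pbd Tp" and Cp: "\<And>\<rho> r m \<sigma> x k. pre \<rho> r m \<sigma> x (\<lambda>_. k) \<Longrightarrow>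
      run (Cp \<rho> r m) \<sigma> (Tp x (case_nat k (case_nat (B ^ k) (\<lambda>_. 0)))) (\<sigma>(r := un (B ^ k)))"
    using power_program[OF B] by blast
  obtain n d where nd: "\<And>x e. Tb x e \<le> sz n x e ^ d" using t(1) unfolding pbd_def by blast
  define ke where "ke = (\<lambda>x e. kenv (e 0) (e (Suc 0)) (length (x :: bool list)))"
  define LL where "LL = (\<lambda>x e. L x (case_nat 0 (ke x e)))"
  define WW where "WW = (\<lambda>x e. word_rec b (ke x e) x (LL x e))"
  define EE where "EE = (\<lambda>x e. case_nat (LL x e) (ke x e))"
  have ke: "pbd (\<lambda>x e. ke x e i)" for i
    unfolding ke_def kenv_def by (intro pbd_intros)
  have LL: "pbd LL" unfolding LL_def by (intro pbd_env[OF v(1)] pbd_intros ke)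
  have EE: "pbd (\<lambda>x e. EE x e i)" for i unfolding EE_def by (intro pbd_intros ke LL)
  have WW: "pbd (\<lambda>x e. length (WW x e))" unfolding WW_def length_word_rec by (intro pbd_intros LL)
  \<comment> \<open>Every stage works on a word of length at most \<open>length x + L\<close> with
    variables at most \<open>L + k + M + length x\<close>; \<open>Z\<close> bounds the time of
    \<open>Cb\<close> on such an input.\<close>
  define Z where "Z = (\<lambda>x e. (length (x :: bool list) + LL x e + n * (LL x e + e 0 + e (Suc 0) + length x) + 2) ^ d)"
  have Z: "pbd Z" unfolding Z_def by (intro pbd_intros LL)
  define T where "T = (\<lambda>x e. Tp x e + ((9 * length x + 2) + (TL x (case_nat 0 (ke x e)) +
     ((Suc (LL x e * (Z x e + 7))) + (To (WW x e) (EE x e) + (Tk (WW x e) (EE x e) +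
     ((6 * out (WW x e) (EE x e) + 1) + ((2 * length (WW x e) + 1) + ((4 * out (WW x e) (EE x e) + 1) +
     ((2 * e 0 + 1) + (3 * kk (WW x e) (EE x e) + 1)))))))))))"
  have pT: "pbd T" unfolding T_def
    by (intro pbd_add pbd_mult pbd_const pbd_Suc Tp Z LL pbd_length WW pbd_env[OF t(2)] pbd_case_nat ke
        pbd_word[OF t(3) WW EE] pbd_word[OF t(4) WW EE] pbd_word[OF v(2) WW EE] pbd_word[OF v(3) WW EE] pbd_var)
  have "\<exists>prog. transforms b L out kk B T R prog"
    if R: "2 \<le> R" for R
  proof -
    \<comment> \<open>Variable 0 is the bit number on stack R + 2, variable 1 the parameter, still
      on stack 1, and 2 and 3 are \<open>M\<close> and the input length on R and R + 1. Stack R + 3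
      stays empty and stands for all further variables, whose value is 0.\<close>
    define \<rho> where "\<rho> = case_nat (R + 2) (case_nat 1 (case_nat R (case_nat (R + 1) (\<lambda>_::nat. R + 3))))"
    have \<rho>: "0 < \<rho> i \<and> \<rho> i \<le> R + 3" for i using R by (auto simp: \<rho>_def split: nat.split)
    let ?body = "Seq (Pop (R + 4)) (Seq (Cb \<rho> (R + 5) (R + 6))
       (Seq (If (Nonempty (R + 5)) (Seq (Pop (R + 5)) (Push 0 True)) (Push 0 False)) (Push (R + 2) True)))"
    let ?prog = "Seq (Cp (\<lambda>_. 1) R (R + 1)) (Seq (Seq (mvc 0 (R + 4) (R + 1)) (mvall (R + 4) 0))
       (Seq (CL \<rho> (R + 4) (R + 5)) (Seq (While (Nonempty (R + 4)) ?body)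
       (Seq (Co \<rho> (R + 4) (R + 6)) (Seq (Ck \<rho> (R + 5) (R + 6))
       (Seq (mvn (R + 4) 0 (R + 6)) (Seq (clear 0) (Seq (mvall (R + 6) 0)
       (Seq (clear 1) (mv (R + 5) 1))))))))))"
    have "\<exists>\<sigma>'. run ?prog \<sigma> (T x (case_nat k (case_nat M (\<lambda>_. 0)))) \<sigma>' \<and>
       \<sigma>' 0 = take (out y (case_nat (L x (case_nat 0 (kenv k M (length x)))) (kenv k M (length x)))) y \<and>
       \<sigma>' 1 = un (kk y (case_nat (L x (case_nat 0 (kenv k M (length x)))) (kenv k M (length x))))"
      if s: "\<sigma> 0 = x" "\<sigma> 1 = un k" "\<forall>i\<ge>R. \<sigma> i = []" and M: "M = B ^ k"
        and y: "y = word_rec b (kenv k M (length x)) x (L x (case_nat 0 (kenv k M (length x))))"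
      for \<sigma> x k M y
    proof -
      let ?e = "case_nat k (case_nat M (\<lambda>_. 0))"
      let ?ke = "kenv k M (length x)"
      let ?L = "L x (case_nat 0 ?ke)"
      let ?E = "case_nat ?L ?ke"
      have E: "ke x ?e = ?ke" "LL x ?e = ?L" "WW x ?e = y" "EE x ?e = ?E"
        by (auto simp: ke_def LL_def WW_def EE_def y)
      define S where "S = (\<lambda>l w. \<sigma>(0 := w, R := un M, R + 1 := un (length x), R + 2 := un l))"
      have S_pre: "pre \<rho> r m ((S l w)(R + 4 := u, R + 5 := u')) w (case_nat l ?ke)"
        if "r = R + 4 \<and> u = [] \<or> r = R + 5 \<and> u' = []" "u' = [] \<or> R + 5 < m" "r < m" "R + 4 < m" for l w r m u u'
        unfolding pre_def
      proof (intro conjI allI impI)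
        let ?s = "(S l w)(R + 4 := u, R + 5 := u')"
        have r: "r = R + 4 \<or> r = R + 5" using that(1) by auto
        show "0 < r" "r < m" using r that(3) by auto
        show "?s 0 = w" using R by (simp add: S_def)
        show "?s r = []" using that(1) by auto
        show "?s i = []" if "m \<le> i" for i
        proof (cases "i = R + 5")
          case True
          then show ?thesis using \<open>u' = [] \<or> R + 5 < m\<close> that by simp
        next
          case False
          then have "R + 5 < i" using \<open>R + 4 < m\<close> that by simp
          then show ?thesis using s by (simp add: S_def)
        qed
        fix i
        show "\<rho> i \<noteq> 0" using \<rho>[of i] by simp
        show "\<rho> i < m" using \<rho>[of i] that(4) by linarith
        show "\<rho> i \<noteq> r" using \<rho>[of i] r by linarith
        have "?s (\<rho> i) = S l w (\<rho> i)" using \<rho>[of i] by simp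
        also have "\<dots> = un (case_nat l ?ke i)"
        proof -
          consider "i = 0" | "i = 1" | "i = 2" | "i = 3" | "4 \<le> i" by linarith
          then show ?thesis
            using s R by cases (auto simp: S_def \<rho>_def kenv_def numeral_2_eq_2 numeral_3_eq_3
                eval_nat_numeral split: nat.split)
        qed
        finally show "?s (\<rho> i) = un (case_nat l ?ke i)" .
      qed
      have S_triv: "(S l w)(R + 4 := [], R + 5 := []) = S l w" for l w
        using s by (auto simp: S_def fun_eq_iff)
      have 1: "run (Cp (\<lambda>_. 1) R (R + 1)) \<sigma> (Tp x ?e) (\<sigma>(R := un M))"
        unfolding M by (rule Cp) (use s R in \<open>auto simp: pre_def\<close>)
      have "run (Seq (mvc 0 (R + 4) (R + 1)) (mvall (R + 4) 0)) (\<sigma>(R := un M)) (9 * length x + 2)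
          ((\<sigma>(R := un M))(R + 1 := un (length x)))"
        by (rule computesD[OF computes_length, where \<rho> = "\<lambda>_. R + 3" and e = "\<lambda>_. 0"])
          (use s R in \<open>auto simp: pre_def\<close>)
      moreover have "(\<sigma>(R := un M))(R + 1 := un (length x)) = S 0 x"
        using s R by (auto simp: S_def fun_eq_iff)
      ultimately have 2: "run (Seq (mvc 0 (R + 4) (R + 1)) (mvall (R + 4) 0)) (\<sigma>(R := un M)) (9 * length x + 2) (S 0 x)"
        by simp
      let ?s3 = "(S 0 x)(R + 4 := un ?L)"
      have 3: "run (CL \<rho> (R + 4) (R + 5)) (S 0 x) (TL x (case_nat 0 ?ke)) ?s3"
        using S_pre[of "R + 4" "[]" "[]" "R + 5" 0 x] unfolding S_triv by (intro computesD[OF c(2)]) auto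
      let ?W = "word_rec b ?ke x"
      let ?st = "\<lambda>i. (S i (?W i))(R + 4 := un (?L - i))"
      let ?t = "\<lambda>i. 1 + (Tb (?W i) (case_nat i ?ke) + (Suc 2 + 1))"
      have w1: "run (While (Nonempty (R + 4)) ?body) (?st 0) (Suc (\<Sum>i<?L. Suc (?t i))) (?st ?L)"
      proof (rule run_While)
        fix i assume i: "i < ?L"
        show "holds (Nonempty (R + 4)) (?st i)" using i by simp
        let ?b = "b (?W i) (case_nat i ?ke)"
        let ?s1 = "(?st i)(R + 4 := tl (?st i (R + 4)))"
        have s1: "?s1 = (S i (?W i))(R + 4 := un (?L - Suc i), R + 5 := [])"
          using i s R by (auto simp: tl_replicate fun_eq_iff S_def)
        let ?s2 = "?s1(R + 5 := un (of_bool ?b))"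
        let ?s3 = "?s1(0 := ?W (Suc i))"
        let ?s4 = "?s3(R + 2 := True # ?s3 (R + 2))"
        have 2: "run (Cb \<rho> (R + 5) (R + 6)) ?s1 (Tb (?W i) (case_nat i ?ke)) ?s2"
          by (rule computesD[OF c(1)]) (unfold s1, rule S_pre, auto)
        have 3: "run (If (Nonempty (R + 5)) (Seq (Pop (R + 5)) (Push 0 True)) (Push 0 False)) ?s2 (Suc 2) ?s3"
        proof (rule run_If)
          assume h: "holds (Nonempty (R + 5)) ?s2"
          let ?s21 = "?s2(R + 5 := tl (?s2 (R + 5)))"
          have "run (Seq (Pop (R + 5)) (Push 0 True)) ?s2 (1 + 1) (?s21(0 := True # ?s21 0))"
            by (rule run_Seq[OF run_Pop run_Push])
          moreover have "?s21(0 := True # ?s21 0) = ?s3"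
            unfolding s1 using h s R by (auto simp: fun_eq_iff S_def tl_replicate split: if_splits)
          ultimately show "run (Seq (Pop (R + 5)) (Push 0 True)) ?s2 2 ?s3" by (simp only: one_add_one)
        next
          assume h: "\<not> holds (Nonempty (R + 5)) ?s2"
          have "run (Push 0 False) ?s2 1 (?s2(0 := False # ?s2 0))" by (rule run_Push)
          moreover have "?s2(0 := False # ?s2 0) = ?s3"
            unfolding s1 using h s R by (auto simp: fun_eq_iff S_def split: if_splits)
          ultimately have "run (Push 0 False) ?s2 1 ?s3" by (simp only:)
          then show "run (Push 0 False) ?s2 2 ?s3" by (rule run_mono) simp
        qed
        have 4: "?s4 = ?st (Suc i)"
          unfolding s1 using s R by (auto simp: fun_eq_iff S_def)
        show "run ?body (?st i) (?t i) (?st (Suc i))"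
          using run_Seq[OF run_Pop run_Seq[OF 2 run_Seq[OF 3 run_Push[of "R + 2" True]]]] unfolding 4 .
      qed simp
      have w2: "?st 0 = ?s3" by simp
      have w3: "?st ?L = S ?L y"
        using s by (auto simp: fun_eq_iff S_def y)
      have w4: "Suc (\<Sum>i<?L. Suc (?t i)) \<le> Suc (LL x ?e * (Z x ?e + 7))"
      proof -
        have "Suc (?t i) \<le> Z x ?e + 7" if i: "i < ?L" for i
        proof -
          have "case_nat i ?ke j \<le> ?L + k + M + length x" for j
            using i by (auto simp: kenv_def split: nat.split)
          then have "(\<Sum>j<n. case_nat i ?ke j) \<le> (\<Sum>j<n. ?L + k + M + length x)"
            by (intro sum_mono) auto
          then have "sz n (?W i) (case_nat i ?ke) \<le> length x + ?L + n * (?L + k + M + length x) + 2"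
            using i by (simp add: sz_def)
          then have "sz n (?W i) (case_nat i ?ke) ^ d \<le> Z x ?e"
            unfolding Z_def E by (intro power_mono) auto
          then show ?thesis using nd[of "?W i" "case_nat i ?ke"] by simp
        qed
        then have "(\<Sum>i<?L. Suc (?t i)) \<le> (\<Sum>i<?L. Z x ?e + 7)" by (intro sum_mono) auto
        then show ?thesis by (simp add: E)
      qed
      have 4: "run (While (Nonempty (R + 4)) ?body) ?s3 (Suc (LL x ?e * (Z x ?e + 7))) (S ?L y)"
        using run_mono[OF w1 w4] unfolding w2 w3 .
      let ?out = "out y ?E" let ?kk = "kk y ?E"
      let ?s5 = "(S ?L y)(R + 4 := un ?out)"
      have 5: "run (Co \<rho> (R + 4) (R + 6)) (S ?L y) (To y ?E) ?s5"
        using S_pre[of "R + 4" "[]" "[]" "R + 6" ?L y] unfolding S_triv by (intro computesD[OF c(3)]) auto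
      let ?s6 = "?s5(R + 5 := un ?kk)"
      have "?s5 = (S ?L y)(R + 4 := un ?out, R + 5 := [])" using s by (auto simp: S_def fun_eq_iff)
      then have 6: "run (Ck \<rho> (R + 5) (R + 6)) ?s5 (Tk y ?E) ?s6"
        using S_pre[of "R + 5" "un ?out" "[]" "R + 6" ?L y] by (intro computesD[OF c(4)]) auto
      let ?s7 = "?s6(R + 4 := [], 0 := drop ?out (?s6 0), R + 6 := rev (take ?out (?s6 0)) @ ?s6 (R + 6))"
      have 7: "run (mvn (R + 4) 0 (R + 6)) ?s6 (6 * ?out + 1) ?s7"
        by (rule run_mvn) auto
      let ?s8 = "?s7(0 := [])"
      have 8: "run (clear 0) ?s7 (2 * length y + 1) ?s8"
        by (rule run_mono[OF run_clear]) (use R in \<open>auto simp: S_def\<close>)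
      let ?s9 = "?s8(R + 6 := [], 0 := rev (?s8 (R + 6)) @ ?s8 0)"
      have s8: "?s8 (R + 6) = rev (take ?out y)" using s R by (auto simp: S_def)
      have 9: "run (mvall (R + 6) 0) ?s8 (4 * ?out + 1) ?s9"
        by (rule run_mono[OF run_mvall]) (simp, unfold s8, simp)
      let ?s10 = "?s9(1 := [])"
      have 10: "run (clear 1) ?s9 (2 * k + 1) ?s10"
        by (rule run_mono[OF run_clear]) (use s R in \<open>simp add: S_def\<close>)
      let ?s11 = "?s10(R + 5 := [], 1 := un ?kk @ ?s10 1)"
      have 11: "run (mv (R + 5) 1) ?s10 (3 * ?kk + 1) ?s11"
        by (rule run_mv) auto
      have "?s11 0 = take ?out y" "?s11 1 = un ?kk"
        using s R by (auto simp: S_def)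
      moreover have "run ?prog \<sigma> (T x ?e) ?s11"
        unfolding T_def E using run_Seq[OF 1 run_Seq[OF 2 run_Seq[OF 3 run_Seq[OF 4 run_Seq[OF 5 run_Seq[OF 6
          run_Seq[OF 7 run_Seq[OF 8 run_Seq[OF 9 run_Seq[OF 10 11]]]]]]]]]]
        by (simp only: E nat.case)
      ultimately show ?thesis by blast
    qed
    then show ?thesis unfolding transforms_def by blast
  qed
  then show ?thesis using pT by blast
qed

text \<open>The number \<open>B ^ k\<close> is the only source of superpolynomial growth: computed once, it makes everything else
  polynomial in the word length, \<open>k\<close> and \<open>B ^ k\<close>.\<close>

theorem fpt_word_reduction:
  assumes P: "P \<le>\<^sub>f\<^sub>p\<^sub>t Q0"
    and b: "pb b" and L: "pf L" and out: "pf out" and kk: "pf kk" and B: "0 < B"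
    and h: "cf (\<lambda>x e. h (e 0))" "mono h"
    and Q: "\<And>x k e l y. e = kenv k (B ^ k) (length x) \<Longrightarrow> l = L x (case_nat 0 e) \<Longrightarrow> y = word_rec b e x l \<Longrightarrow>
      ((x, k) \<in> Q0 \<longleftrightarrow> (take (out y (case_nat l e)) y, kk y (case_nat l e)) \<in> Q) \<and> kk y (case_nat l e) \<le> h k"
  shows "P \<le>\<^sub>f\<^sub>p\<^sub>t Q"
proof -
  obtain p1 f g c where f: "computable f" and g: "computable g" and
    p1: "\<And>x k. \<exists>t \<sigma> x' k'. exec p1 (init x k) t \<sigma> \<and> t \<le> f k * (length x + 1) ^ c \<and>
        \<sigma> 0 = x' \<and> \<sigma> 1 = un k' \<and> k' \<le> g k \<and> ((x, k) \<in> P \<longleftrightarrow> (x', k') \<in> Q0)"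
    using P unfolding fpt_reducible_def by blast
  obtain R where R: "\<And>r. r \<in> written p1 \<Longrightarrow> r < R" "2 \<le> R"
  proof -
    obtain K0 where "\<forall>r\<in>written p1. r < K0" using finite_written[of p1] finite_nat_set_iff_bounded by blast
    then show ?thesis by (intro that[of "max K0 2"]) auto
  qed
  obtain T where T: "pbd T" and TR: "\<forall>R\<ge>2. \<exists>prog. transforms b L out kk B T R prog"
    using word_program[OF b L out kk B] by blast
  obtain p2 where p2: "transforms b L out kk B T R p2" using TR R(2) by blast
  obtain n d where nd: "\<And>x e. T x e \<le> sz n x e ^ d" using T unfolding pbd_def by blast
  \<comment> \<open>The word left by \<open>p1\<close> has length at most
    \<open>length x + f k * (length x + 1) ^ c\<close>. So the size seen by \<open>p2\<close> is at
    most the base of \<open>?U\<close> times \<open>(length x + 1) ^ Suc c\<close>, and its time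
    raises this to the power d.\<close>
  let ?U = "\<lambda>k. (f k + g k + B ^ g k + 3) ^ d"
  show ?thesis
    unfolding fpt_reducible_def
  proof (rule exI[of _ "Seq p1 p2"], rule exI[of _ "\<lambda>k. f k + ?U k"], rule exI[of _ "\<lambda>k. h (g k)"],
      rule exI[of _ "c + Suc c * d"], intro conjI allI)
    show "computable (\<lambda>k. f k + ?U k)"
      by (rule computable_cf)
        (intro cf_add cf_power_const cf_power cf_const cf_computable[OF f] cf_computable[OF g])
    show "computable (\<lambda>k. h (g k))"
      by (rule computable_cf, rule cf_comp1[OF h(1)], rule cf_computable[OF g])
    fix x k
    obtain t \<sigma> k' where t: "exec p1 (init x k) t \<sigma>" "t \<le> f k * (length x + 1) ^ c"
      "\<sigma> 1 = un k'" "k' \<le> g k" "(x, k) \<in> P \<longleftrightarrow> (\<sigma> 0, k') \<in> Q0"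
      using p1[of x k] by blast
    have e: "\<forall>i\<ge>R. \<sigma> i = []"
    proof (intro allI impI)
      fix i assume i: "R \<le> i"
      have "\<sigma> i = init x k i"
        by (rule exec_not_written[OF t(1)]) (use R(1)[of i] i in auto)
      then show "\<sigma> i = []" using i R(2) by (simp add: init_def)
    qed
    let ?x = "\<sigma> 0"
    let ?e = "kenv k' (B ^ k') (length ?x)"
    let ?l = "L ?x (case_nat 0 ?e)"
    let ?y = "word_rec b ?e ?x ?l"
    obtain \<sigma>' where s': "run p2 \<sigma> (T ?x (case_nat k' (case_nat (B ^ k') (\<lambda>_. 0)))) \<sigma>'"
       "\<sigma>' 0 = take (out ?y (case_nat ?l ?e)) ?y" "\<sigma>' 1 = un (kk ?y (case_nat ?l ?e))"
      using p2[unfolded transforms_def, rule_format, of \<sigma> ?x k' "B ^ k'" ?y] t(3) e by auto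
    obtain t' where t': "t' \<le> T ?x (case_nat k' (case_nat (B ^ k') (\<lambda>_. 0)))" "exec p2 \<sigma> t' \<sigma>'"
      using s'(1) unfolding run_def by blast
    have Q': "(?x, k') \<in> Q0 \<longleftrightarrow> (\<sigma>' 0, kk ?y (case_nat ?l ?e)) \<in> Q" "kk ?y (case_nat ?l ?e) \<le> h k'"
      using Q[OF refl refl refl, of ?x k'] s'(2) by auto
    have "t + t' \<le> (f k + ?U k) * (length x + 1) ^ (c + Suc c * d)"
    proof -
      let ?A = "length x + 1"
      have Bk: "B ^ k' \<le> B ^ g k" using t(4) B by (simp add: power_increasing)
      have "(\<Sum>i<n. case_nat k' (case_nat (B ^ k') (\<lambda>_. 0)) i) \<le> k' + B ^ k'"
      proof -
        have "(\<Sum>i<n. case_nat k' (case_nat (B ^ k') (\<lambda>_. 0)) i)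
            \<le> (\<Sum>i<Suc (Suc n). case_nat k' (case_nat (B ^ k') (\<lambda>_. 0)) i)"
          by (intro sum_mono2) auto
        also have "\<dots> = k' + B ^ k'" by (simp add: sum.lessThan_Suc_shift del: sum.lessThan_Suc)
        finally show ?thesis .
      qed
      moreover have "length ?x \<le> length x + t"
        using exec_length[OF t(1), of 0] by (simp add: init_def)
      ultimately have "sz n ?x (case_nat k' (case_nat (B ^ k') (\<lambda>_. 0))) \<le> length x + f k * ?A ^ c + g k + B ^ g k + 2"
        using t(2,4) Bk by (simp add: sz_def)
      also have "\<dots> \<le> (f k + g k + B ^ g k + 3) * ?A ^ Suc c"
      proof -
        have a: "1 \<le> ?A ^ Suc c" "?A ^ c \<le> ?A ^ Suc c" by (rule one_le_power power_increasing; simp)+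
        have b: "length x \<le> ?A ^ Suc c" using power_increasing[of 1 "Suc c" ?A] by simp
        have "f k * ?A ^ c \<le> f k * ?A ^ Suc c" using a(2) by (rule mult_left_mono) simp
        moreover have "g k + B ^ g k + 2 \<le> (g k + B ^ g k + 2) * ?A ^ Suc c"
          using mult_left_mono[OF a(1), of "g k + B ^ g k + 2"] by simp
        ultimately have "length x + f k * ?A ^ c + g k + B ^ g k + 2 \<le> ?A ^ Suc c + f k * ?A ^ Suc c + (g k + B ^ g k + 2) * ?A ^ Suc c"
          using b by linarith
        also have "\<dots> = (f k + g k + B ^ g k + 3) * ?A ^ Suc c" by (simp only: algebra_simps)
        finally show ?thesis .
      qed
      finally have "sz n ?x (case_nat k' (case_nat (B ^ k') (\<lambda>_. 0))) ^ d \<le> ((f k + g k + B ^ g k + 3) * ?A ^ Suc c) ^ d"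
        by (rule power_mono) simp
      then have "t' \<le> ?U k * ?A ^ (Suc c * d)"
        using t'(1) nd[of ?x "case_nat k' (case_nat (B ^ k') (\<lambda>_. 0))"]
        unfolding power_mult_distrib power_mult[symmetric] by linarith
      also have "\<dots> \<le> ?U k * ?A ^ (c + Suc c * d)"
        by (intro mult_left_mono power_increasing) auto
      finally have "t' \<le> ?U k * ?A ^ (c + Suc c * d)" .
      moreover have "t \<le> f k * ?A ^ (c + Suc c * d)"
        by (rule order_trans[OF t(2)], intro mult_left_mono power_increasing) auto
      ultimately show ?thesis unfolding add_mult_distrib by linarith
    qed
    moreover have "kk ?y (case_nat ?l ?e) \<le> h (g k)"
      using Q'(2) monoD[OF h(2) t(4)] by linarith
    ultimately have "exec (Seq p1 p2) (init x k) (t + t') \<sigma>' \<and>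
      t + t' \<le> (f k + ?U k) * (length x + 1) ^ (c + Suc c * d) \<and>
       \<sigma>' 0 = \<sigma>' 0 \<and> \<sigma>' 1 = un (kk ?y (case_nat ?l ?e)) \<and> kk ?y (case_nat ?l ?e) \<le> h (g k) \<and>
       ((x, k) \<in> P \<longleftrightarrow> (\<sigma>' 0, kk ?y (case_nat ?l ?e)) \<in> Q)"
      using exec_Seq[OF t(1) t'(2)] s'(3) t(5) Q'(1) by blast
    then show "\<exists>t \<sigma> x' k'. exec (Seq p1 p2) (init x k) t \<sigma> \<and>
      t \<le> (f k + ?U k) * (length x + 1) ^ (c + Suc c * d) \<and>
       \<sigma> 0 = x' \<and> \<sigma> 1 = un k' \<and> k' \<le> h (g k) \<and> ((x, k) \<in> P \<longleftrightarrow> (x', k') \<in> Q)"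
      by blast
  qed
qed

section \<open>Tuples as digit expansions\<close>

lemma digit_Suc: "digit b (Suc i) v = digit b i (v div b)"
  by (simp add: digit_def div_mult2_eq)

lemma digit_less: "0 < b \<Longrightarrow> digit b i v < b"
  by (simp add: digit_def)

lemma div_mod_unique: "r < b \<Longrightarrow> (a * b + r) mod b = r \<and> (a * b + r) div b = (a::nat)"
  by simp

lemma digits_exist:
  assumes "\<And>i. i < D \<Longrightarrow> f i < b"
  shows "\<exists>v < b ^ D. \<forall>i<D. digit b i v = f i"
  using assms
proof (induction D arbitrary: f)
  case (Suc D)
  obtain v where v: "v < b ^ D" "\<forall>i<D. digit b i v = f (Suc i)"
    using Suc.IH[of "\<lambda>i. f (Suc i)"] Suc.prems by auto
  have f0: "f 0 < b" using Suc.prems by simp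
  have "f 0 + b * v < b + b * v" using f0 by simp
  also have "\<dots> = b * Suc v" by simp
  also have "\<dots> \<le> b * b ^ D" using v(1) by (intro mult_le_mono2) simp
  finally have "f 0 + b * v < b ^ Suc D" by simp
  moreover have "digit b i (f 0 + b * v) = f i" if "i < Suc D" for i
    using that v(2) f0 by (cases i) (auto simp: digit_Suc, simp add: digit_def)
  ultimately show ?case by blast
qed simp

lemma digits_unique:
  assumes "v < b ^ D" "v' < b ^ D" "\<And>i. i < D \<Longrightarrow> digit b i v = digit b i v'"
  shows "v = v'"
  using assms
proof (induction D arbitrary: v v')
  case (Suc D)
  have "0 < b" using Suc.prems(1) by (cases b) auto
  have "v div b = v' div b"
  proof (rule Suc.IH)
    show "v div b < b ^ D" "v' div b < b ^ D"
      using Suc.prems(1,2) by (auto simp: less_mult_imp_div_less mult.commute)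
    show "digit b i (v div b) = digit b i (v' div b)" if "i < D" for i
      using Suc.prems(3)[of "Suc i"] that by (simp add: digit_Suc)
  qed
  moreover have "v mod b = v' mod b"
    using Suc.prems(3)[of 0] by (simp add: digit_def)
  ultimately show ?case by (metis div_mult_mod_eq)
qed simp

section \<open>Clauses and binary constraints\<close>

text \<open>The children of w are D * w + 1, ..., D * w + D. Truncated subtraction makes the root 0
  its own parent, so \<open>0 < anc D w i\<close> says that ancestor i is not the root, and
  \<open>(anc D w i - 1) mod D\<close> is the number of the edge above it.\<close>

definition anc :: "nat \<Rightarrow> nat \<Rightarrow> nat \<Rightarrow> nat" where
  "anc D w i = rec_nat w (\<lambda>_ s. (s - 1) div D) i"

lemma rec_nat_shift: "rec_nat (f w) (\<lambda>_. f) i = rec_nat w (\<lambda>_. f) (Suc i)"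
  by (induction i) auto

lemma anc_0: "anc D w 0 = w" by (simp add: anc_def)

lemma anc_Suc: "anc D w (Suc i) = anc D ((w - 1) div D) i"
  using rec_nat_shift[of "\<lambda>s. (s - 1) div D" w i] by (simp add: anc_def)

text \<open>Numbers decrease on the way to the root. So i < w exhausts the path, and a table filled
  in the order of node numbers has its ancestors ready.\<close>

lemma anc_le: "anc D w i \<le> w - i"
proof (induction i arbitrary: w)
  case (Suc i)
  have "anc D w (Suc i) \<le> (w - 1) div D - i" unfolding anc_Suc by (rule Suc.IH)
  also have "\<dots> \<le> w - Suc i" using div_le_dividend[of "w - 1" D] by linarith
  finally show ?case .
qed (simp add: anc_0)

text \<open>Clause \<open>c\<close> says that some of the atoms \<open>t c j\<close>, \<open>j < d\<close>, has a truth value other than \<open>\<alpha> c j\<close>.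
  So \<open>t c j\<close> occurs negatively if \<open>\<alpha> c j\<close> and positively otherwise. The digits of \<open>v\<close> in base \<open>N + 1\<close>
  are the elements of a set of size at most \<open>D\<close>, where \<open>N\<close> stands for no element. Tree nodes are numbered
  as in a \<open>D\<close>-ary heap, and \<open>Tab v w c\<close> says that \<open>c\<close> is the clause on which node \<open>w\<close> branches.\<close>

definition member ::
    "nat \<Rightarrow> nat \<Rightarrow> nat \<Rightarrow> (nat \<Rightarrow> bool) \<Rightarrow> (nat \<Rightarrow> nat \<Rightarrow> bool) \<Rightarrow> (nat \<Rightarrow> nat \<Rightarrow> nat) \<Rightarrow> nat \<Rightarrow> nat \<Rightarrow> bool" where
  "member N d D bad \<alpha> t v c \<longleftrightarrow> bad c \<and> (\<forall>j<d. \<alpha> c j \<longrightarrow> (\<exists>i<D. digit (N + 1) i v = t c j))"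

text \<open>Some positive atom of \<open>c\<close> is already among the elements on the path to w;
  \<open>hit_iff\<close> makes this precise. The quantifiers are bounded so that the predicate is
  covered by the closure properties of polynomial time.\<close>

definition hit ::
    "nat \<Rightarrow> nat \<Rightarrow> nat \<Rightarrow> (nat \<Rightarrow> nat \<Rightarrow> bool) \<Rightarrow> (nat \<Rightarrow> nat \<Rightarrow> nat) \<Rightarrow> (nat \<Rightarrow> nat \<Rightarrow> nat \<Rightarrow> bool) \<Rightarrow>
     nat \<Rightarrow> nat \<Rightarrow> nat \<Rightarrow> bool" where
  "hit d D C \<alpha> t Tab v w c \<longleftrightarrow> (\<exists>i<w. 0 < anc D w i \<and>
     (\<exists>c'<C. Tab v ((anc D w i - 1) div D) c' \<and> (anc D w i - 1) mod D < d \<and>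
       \<not> \<alpha> c' ((anc D w i - 1) mod D) \<and>
       (\<exists>j<d. \<not> \<alpha> c j \<and> t c j = t c' ((anc D w i - 1) mod D))))"

definition eligible where
  "eligible N d D C bad \<alpha> t Tab v w c \<longleftrightarrow> member N d D bad \<alpha> t v c \<and> \<not> hit d D C \<alpha> t Tab v w c"

text \<open>Taking the least eligible clause makes the tree deterministic: each node branches on at
  most one clause.\<close>

definition branching where
  "branching N d D C bad \<alpha> t Tab v w c \<longleftrightarrow> eligible N d D C bad \<alpha> t Tab v w c \<and>
     (\<forall>c'<c. \<not> eligible N d D C bad \<alpha> t Tab v w c')"

definition num_groups :: "nat \<Rightarrow> nat \<Rightarrow> nat \<Rightarrow> nat" where
  "num_groups k D M = (k + 1) + (k + 1) ^ D * M"

definition num_values :: "nat \<Rightarrow> nat \<Rightarrow> nat \<Rightarrow> nat" where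
  "num_values N k D = (N + 1) ^ D * (k + 1) * (N + 1)"

text \<open>Variables \<open>0, \<dots>, k\<close> hold the increasing enumeration of the solution, with sentinel \<open>N\<close> at position \<open>k\<close>.
  Variable \<open>k + 1 + (I \<cdot> M + w)\<close> has a value \<open>(v \<cdot> (k + 1) + pos) \<cdot> (N + 1) + val\<close>: it claims that the
  digits of \<open>v\<close> are the elements at the positions given by the digits of \<open>I\<close> and that the element \<open>val\<close> at
  position \<open>pos\<close> satisfies the clause on which node \<open>w\<close> of the tree of \<open>v\<close> branches.\<close>

definition compatible ::
    "nat \<Rightarrow> nat \<Rightarrow> nat \<Rightarrow> nat \<Rightarrow> nat \<Rightarrow> nat \<Rightarrow> (nat \<Rightarrow> nat \<Rightarrow> bool) \<Rightarrow> (nat \<Rightarrow> nat \<Rightarrow> nat) \<Rightarrow>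
     (nat \<Rightarrow> nat \<Rightarrow> nat \<Rightarrow> bool) \<Rightarrow> nat \<Rightarrow> nat \<Rightarrow> nat \<Rightarrow> nat \<Rightarrow> bool" where
  "compatible N k d D C M \<alpha> t Tab g q g' q' \<longleftrightarrow>
     (g \<le> k \<and> g' \<le> k \<longrightarrow> q \<le> N \<and> (g < g' \<longrightarrow> q < q') \<and> (g = k \<longrightarrow> q = N)) \<and>
     (k < g \<longrightarrow> (\<forall>c<C. Tab (q div (N + 1) div (k + 1)) ((g - (k + 1)) mod M) c \<longrightarrow>
        q mod (N + 1) < N \<and> (\<exists>j<d. \<not> \<alpha> c j \<and> t c j = q mod (N + 1)))) \<and>
     (k < g \<and> g' \<le> k \<longrightarrow>
        (\<forall>i<D. digit (k + 1) i ((g - (k + 1)) div M) = g' \<longrightarrow> digit (N + 1) i (q div (N + 1) div (k + 1)) = q') \<and>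
        (q div (N + 1) mod (k + 1) = g' \<longrightarrow> q mod (N + 1) = q'))"

lemma compatible_positions:
  "compatible N k d D C M \<alpha> t Tab g q g' q' \<Longrightarrow> g \<le> k \<Longrightarrow> g' \<le> k \<Longrightarrow>
     q \<le> N \<and> (g < g' \<longrightarrow> q < q') \<and> (g = k \<longrightarrow> q = N)"
  unfolding compatible_def by (elim conjE) (rule mp, assumption, blast)

lemma compatible_branch:
  "compatible N k d D C M \<alpha> t Tab g q g' q' \<Longrightarrow> k < g \<Longrightarrow>
     \<forall>c<C. Tab (q div (N + 1) div (k + 1)) ((g - (k + 1)) mod M) c \<longrightarrow>
        q mod (N + 1) < N \<and> (\<exists>j<d. \<not> \<alpha> c j \<and> t c j = q mod (N + 1))"
  unfolding compatible_def by (elim conjE) (erule mp)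

lemma compatible_claims:
  "compatible N k d D C M \<alpha> t Tab g q g' q' \<Longrightarrow> k < g \<Longrightarrow> g' \<le> k \<Longrightarrow>
     (\<forall>i<D. digit (k + 1) i ((g - (k + 1)) div M) = g' \<longrightarrow> digit (N + 1) i (q div (N + 1) div (k + 1)) = q') \<and>
     (q div (N + 1) mod (k + 1) = g' \<longrightarrow> q mod (N + 1) = q')"
  unfolding compatible_def by (elim conjE) (rule mp, assumption, blast)

section \<open>The elements collected on a path of the search tree\<close>

definition path_set where
  "path_set d D C \<alpha> t Tab v w = {t c ((anc D w i - 1) mod D) |i c. 0 < anc D w i \<and> c < C \<and>
     Tab v ((anc D w i - 1) div D) c \<and> (anc D w i - 1) mod D < d \<and> \<not> \<alpha> c ((anc D w i - 1) mod D)}"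

lemma hit_iff:
  "hit d D C \<alpha> t Tab v w c \<longleftrightarrow> (\<exists>j<d. \<not> \<alpha> c j \<and> t c j \<in> path_set d D C \<alpha> t Tab v w)"
proof -
  have "i < w" if "0 < anc D w i" for i using anc_le[of D w i] that by linarith
  then show ?thesis unfolding hit_def path_set_def by blast
qed

lemma path_set_0: "path_set d D C \<alpha> t Tab v 0 = {}"
  using anc_le[of D 0] by (auto simp: path_set_def)

text \<open>Ancestor 0 of the child is the child itself, and the edge above it contributes atom j of
  the clause at w; its further ancestors are those of w, shifted by one.\<close>

lemma path_set_child:
  assumes "j < d" "d \<le> D"
  shows "path_set d D C \<alpha> t Tab v (D * w + 1 + j) =
    {t c j |c. c < C \<and> Tab v w c \<and> \<not> \<alpha> c j} \<union> path_set d D C \<alpha> t Tab v w" (is "?L = ?A \<union> ?B")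
proof -
  let ?w = "D * w + 1 + j"
  have a: "anc D ?w 0 = ?w" "\<And>i. anc D ?w (Suc i) = anc D w i"
    using assms by (auto simp: anc_0 anc_Suc)
  have b: "(?w - 1) div D = w" "(?w - 1) mod D = j" using assms by auto
  show ?thesis
  proof (intro set_eqI iffI)
    fix x assume "x \<in> ?L"
    then obtain i c where *: "x = t c ((anc D ?w i - 1) mod D)" "0 < anc D ?w i" "c < C"
       "Tab v ((anc D ?w i - 1) div D) c" "(anc D ?w i - 1) mod D < d" "\<not> \<alpha> c ((anc D ?w i - 1) mod D)"
      unfolding path_set_def by blast
    show "x \<in> ?A \<union> ?B"
    proof (cases i)
      case 0
      then show ?thesis using * unfolding 0 a(1) b by blast
    next
      case (Suc i')
      then show ?thesis using * unfolding Suc a(2) path_set_def by blast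
    qed
  next
    fix x assume "x \<in> ?A \<union> ?B"
    then show "x \<in> ?L"
    proof
      assume "x \<in> ?A"
      then obtain c where c: "x = t c j" "c < C" "Tab v w c" "\<not> \<alpha> c j" by blast
      show ?thesis
        unfolding path_set_def using c assms b a(1)
        by (intro CollectI exI[of _ 0] exI[of _ c]) auto
    next
      assume "x \<in> ?B"
      then obtain i c where *: "x = t c ((anc D w i - 1) mod D)" "0 < anc D w i" "c < C"
         "Tab v ((anc D w i - 1) div D) c" "(anc D w i - 1) mod D < d" "\<not> \<alpha> c ((anc D w i - 1) mod D)"
        unfolding path_set_def by blast
      show ?thesis
        unfolding path_set_def using *
        by (intro CollectI exI[of _ "Suc i"] exI[of _ c]) (simp only: a simp_thms)
    qed
  qed
qed

text \<open>The assumption on \<open>Tab\<close> is a recursion: its right-hand side consults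
  \<open>Tab\<close> only at proper ancestors of w. A node at depth l has a number below
  \<open>(D + 1) ^ l\<close>, so \<open>M\<close> covers all nodes down to depth k.\<close>

locale clause_system =
  fixes N k d D C M :: nat and bad :: "nat \<Rightarrow> bool" and \<alpha> :: "nat \<Rightarrow> nat \<Rightarrow> bool"
    and t :: "nat \<Rightarrow> nat \<Rightarrow> nat" and Tab :: "nat \<Rightarrow> nat \<Rightarrow> nat \<Rightarrow> bool"
  assumes dD: "d \<le> D" and D: "0 < D" and M: "(D + 1) ^ k \<le> M"
    and t: "\<And>c j. c < C \<Longrightarrow> j < d \<Longrightarrow> t c j < N"
    and Tab: "\<And>v w c. v < (N + 1) ^ D \<Longrightarrow> w < M \<Longrightarrow> c < C \<Longrightarrow>
      Tab v w c \<longleftrightarrow> branching N d D C bad \<alpha> t Tab v w c"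
begin

definition solves :: "nat set \<Rightarrow> bool" where
  "solves S \<longleftrightarrow> S \<subseteq> {..<N} \<and> card S = k \<and> (\<forall>c<C. bad c \<longrightarrow> (\<exists>j<d. (t c j \<in> S) \<noteq> \<alpha> c j))"

definition consistent :: "(nat \<Rightarrow> nat) \<Rightarrow> bool" where
  "consistent sol \<longleftrightarrow> (\<forall>g<num_groups k D M. sol g < num_values N k D) \<and>
     (\<forall>g<num_groups k D M. \<forall>g'<num_groups k D M.
       compatible N k d D C M \<alpha> t Tab g (sol g) g' (sol g'))"

abbreviation "T \<equiv> path_set d D C \<alpha> t Tab"
abbreviation "elig \<equiv> eligible N d D C bad \<alpha> t Tab"

lemma Tab_unique:
  assumes "v < (N + 1) ^ D" "w < M" "c < C" "c' < C" "Tab v w c" "Tab v w c'"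
  shows "c = c'"
proof -
  have "branching N d D C bad \<alpha> t Tab v w c" "branching N d D C bad \<alpha> t Tab v w c'"
    using assms Tab by blast+
  then show ?thesis unfolding branching_def by (meson linorder_neqE_nat)
qed

text \<open>A clause in the tree of v has all negative atoms among the elements named by v, hence in
  S. So S can satisfy it only through a positive atom, and the position of that atom in S is the
  witness.\<close>

lemma solves_imp_consistent:
  assumes "solves S"
  shows "\<exists>sol. consistent sol"
proof -
  have S: "S \<subseteq> {..<N}" "card S = k" and sat: "\<And>c. c < C \<Longrightarrow> bad c \<Longrightarrow> \<exists>j<d. (t c j \<in> S) \<noteq> \<alpha> c j"
    using assms unfolding solves_def by blast+
  have fin: "finite S" using S(1) finite_subset by blast
  define xs where "xs = sorted_list_of_set S"
  have xs: "length xs = k" "set xs = S" "sorted_wrt (<) xs"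
    using fin S(2) by (auto simp: xs_def)
  \<comment> \<open>The sentinel N at position k lets a tuple of positions describe fewer than D
    elements.\<close>
  define s where "s = (\<lambda>i. if i < k then xs ! i else N)"
  have s_in: "s i \<in> S" if "i < k" for i using that xs by (auto simp: s_def)
  have sk: "s k = N" by (simp add: s_def)
  have s_le: "s i \<le> N" for i using s_in[of i] S(1) by (cases "i < k") (auto simp: s_def)
  have s_mono: "s i < s j" if "i < j" "j \<le> k" for i j
  proof (cases "j < k")
    case True
    then show ?thesis using sorted_wrt_nth_less[OF xs(3), of i j] that xs(1) by (simp add: s_def)
  next
    case False
    then have "j = k" "i < k" using that by auto
    then show ?thesis using s_in[of i] S(1) sk by auto
  qed
  have s_surj: "\<exists>i<k. s i = a" if a: "a \<in> S" for a
  proof -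
    obtain i where "i < k" "xs ! i = a" using a xs(1,2) by (metis in_set_conv_nth)
    then show ?thesis by (intro exI[of _ i]) (simp add: s_def)
  qed
  have ex: "\<exists>q < num_values N k D. \<forall>g'\<le>k. compatible N k d D C M \<alpha> t Tab g q g' (s g')"
    if g: "k < g" "g < num_groups k D M" for g
  proof -
    let ?I = "(g - (k + 1)) div M" and ?w = "(g - (k + 1)) mod M"
    have "g - (k + 1) < (k + 1) ^ D * M" using g by (simp add: num_groups_def)
    then have w: "?w < M" by (cases "M = 0") auto
    obtain v where v: "v < (N + 1) ^ D" "\<forall>i<D. digit (N + 1) i v = s (digit (k + 1) i ?I)"
      using digits_exist[of D "\<lambda>i. s (digit (k + 1) i ?I)" "N + 1"] s_le by (auto simp: less_Suc_eq_le)
    have "\<exists>pos val. pos \<le> k \<and> val = s pos \<and>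
       (\<forall>c<C. Tab v ?w c \<longrightarrow> val < N \<and> (\<exists>j<d. \<not> \<alpha> c j \<and> t c j = val))"
    proof (cases "\<exists>c<C. Tab v ?w c")
      \<comment> \<open>Without a branching clause nothing is to be witnessed, and the sentinel is a
        value that agrees with its position.\<close>
      case False
      then show ?thesis by (intro exI[of _ k] exI[of _ N]) (auto simp: sk)
    next
      case True
      then obtain c where c: "c < C" "Tab v ?w c" by blast
      then have m: "member N d D bad \<alpha> t v c"
        using Tab v(1) w unfolding branching_def eligible_def by blast
      \<comment> \<open>Atoms lie below N, so a digit equal to an atom comes from a position below
        k, that is, from S.\<close>
      have neg: "t c j \<in> S" if j: "j < d" "\<alpha> c j" for j
      proof -
        obtain i where i: "i < D" "digit (N + 1) i v = t c j" using m j unfolding member_def by blast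
        then have "s (digit (k + 1) i ?I) = t c j" using v(2) by simp
        moreover have "digit (k + 1) i ?I \<le> k" using digit_less[of "k + 1" i ?I] by simp
        ultimately show ?thesis
          using t[OF c(1) j(1)] s_in[of "digit (k + 1) i ?I"] sk
          by (cases "digit (k + 1) i ?I = k") auto
      qed
      obtain j where j: "j < d" "(t c j \<in> S) \<noteq> \<alpha> c j"
        using sat[OF c(1)] m unfolding member_def by blast
      then have j': "\<not> \<alpha> c j" "t c j \<in> S" using neg[of j] by auto
      obtain pos where pos: "pos < k" "s pos = t c j" using s_surj[OF j'(2)] by blast
      have "\<forall>c'<C. Tab v ?w c' \<longrightarrow> c' = c" using Tab_unique[OF v(1) w] c by blast
      then show ?thesis
        using pos j(1) j' t[OF c(1) j(1)] by (intro exI[of _ pos] exI[of _ "t c j"]) auto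
    qed
    then obtain pos val where pv: "pos \<le> k" "val = s pos"
       "\<forall>c<C. Tab v ?w c \<longrightarrow> val < N \<and> (\<exists>j<d. \<not> \<alpha> c j \<and> t c j = val)" by blast
    let ?q = "(v * (k + 1) + pos) * (N + 1) + val"
    have val: "val < N + 1" using s_le[of pos] pv by simp
    have q: "?q mod (N + 1) = val" "?q div (N + 1) = v * (k + 1) + pos"
      using div_mod_unique[OF val] by blast+
    have pos: "pos < k + 1" using pv(1) by simp
    have q': "?q div (N + 1) mod (k + 1) = pos" "?q div (N + 1) div (k + 1) = v"
      unfolding q(2) using div_mod_unique[OF pos] by blast+
    have "?q < num_values N k D"
    proof -
      have "v * (k + 1) + pos < Suc v * (k + 1)" using pv(1) by simp
      also have "\<dots> \<le> (N + 1) ^ D * (k + 1)" using v(1) by (intro mult_le_mono1) simp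
      finally have "Suc (v * (k + 1) + pos) * (N + 1) \<le> (N + 1) ^ D * (k + 1) * (N + 1)"
        by (intro mult_le_mono1) simp
      then show ?thesis using val by (simp add: num_values_def)
    qed
    moreover have "compatible N k d D C M \<alpha> t Tab g ?q g' (s g')" if "g' \<le> k" for g'
      unfolding compatible_def q(1) q' using g(1) that v(2) pv by auto
    ultimately show ?thesis by blast
  qed
  then obtain f where f: "\<And>g. k < g \<Longrightarrow> g < num_groups k D M \<Longrightarrow> f g < num_values N k D \<and>
      (\<forall>g'\<le>k. compatible N k d D C M \<alpha> t Tab g (f g) g' (s g'))" by metis
  let ?sol = "\<lambda>g. if g \<le> k then s g else f g"
  have "N < num_values N k D"
  proof -
    have "1 * 1 * (N + 1) \<le> num_values N k D"
      unfolding num_values_def by (intro mult_le_mono) auto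
    then show ?thesis by simp
  qed
  then have "?sol g < num_values N k D" if "g < num_groups k D M" for g
    using f[of g] s_le[of g] that by (auto intro: le_less_trans)
  moreover have "compatible N k d D C M \<alpha> t Tab g (?sol g) g' (?sol g')"
    if "g < num_groups k D M" "g' < num_groups k D M" for g g'
  proof (cases "g \<le> k")
    case True
    then have ng: "\<not> k < g" by simp
    show ?thesis
      unfolding compatible_def if_P[OF True] using ng s_le[of g] s_mono[of g g'] sk
      by (intro conjI impI) (simp_all only: if_True simp_thms)
  next
    case False
    then have fg: "compatible N k d D C M \<alpha> t Tab g (f g) g'' (s g'')" if "g'' \<le> k" for g''
      using f[of g] that \<open>g < num_groups k D M\<close> by auto
    show ?thesis
    proof (cases "g' \<le> k")
      case True
      then show ?thesis using fg[of g'] False by (simp only: if_True if_False)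
    next
      case g': False
      show ?thesis
        using fg[OF order_refl, unfolded compatible_def, THEN conjunct2, THEN conjunct1] False g'
        unfolding compatible_def by (simp only: if_False not_le) simp
    qed
  qed
  ultimately have "consistent ?sol" unfolding consistent_def by (intro conjI allI impI)
  then show ?thesis by blast
qed

text \<open>A violated clause has its negative atoms in S, so some tuple of positions names them,
  and none of its positive atoms is in S. Hence it is not hit along any path inside S, and every
  node on such a path branches. The witnesses then continue the path until it holds k + 1 elements
  of the k-element set S.\<close>

lemma consistent_imp_solves:
  assumes "consistent sol"
  shows "\<exists>S. solves S"
proof -
  let ?G = "num_groups k D M"
  have vals: "\<And>g. g < ?G \<Longrightarrow> sol g < num_values N k D"
    and comp: "\<And>g g'. g < ?G \<Longrightarrow> g' < ?G \<Longrightarrow> compatible N k d D C M \<alpha> t Tab g (sol g) g' (sol g')"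
    using assms unfolding consistent_def by blast+
  have kG: "i < ?G" if "i \<le> k" for i using that by (simp add: num_groups_def)
  have sk: "sol k = N" using compatible_positions[OF comp[OF kG kG, of k k]] by simp
  have s_mono: "sol i < sol j" if "i < j" "j \<le> k" for i j
    using compatible_positions[OF comp[OF kG kG, of i j]] that by simp
  define S where "S = sol ` {..<k}"
  have "inj_on sol {..<k}"
  proof (rule inj_onI)
    fix i j assume "i \<in> {..<k}" "j \<in> {..<k}" "sol i = sol j"
    then show "i = j" using s_mono[of i j] s_mono[of j i] by (cases i j rule: linorder_cases) auto
  qed
  then have cS: "card S = k" by (simp add: S_def card_image)
  have SN: "S \<subseteq> {..<N}" unfolding S_def using s_mono[of _ k] sk by auto
  have finS: "finite S" by (rule finite_subset[OF SN]) simp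
  have "\<exists>j<d. (t c j \<in> S) \<noteq> \<alpha> c j" if c: "c < C" "bad c" for c
  proof (rule ccontr)
    assume "\<not> ?thesis"
    then have eq: "\<And>j. j < d \<Longrightarrow> (t c j \<in> S) = \<alpha> c j" by blast
    \<comment> \<open>The digits that carry no negative atom are filled with the sentinel, which the
      position k provides.\<close>
    define vf where "vf = (\<lambda>i. if i < d \<and> \<alpha> c i then t c i else N)"
    have "\<exists>p\<le>k. sol p = vf i" for i
    proof (cases "i < d \<and> \<alpha> c i")
      case True
      then have "t c i \<in> S" using eq by blast
      then obtain q where "q < k" "sol q = t c i" unfolding S_def by force
      then show ?thesis using True by (intro exI[of _ q]) (simp add: vf_def)
    next
      case False
      then show ?thesis using sk by (intro exI[of _ k]) (auto simp: vf_def)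
    qed
    then obtain p where p: "\<And>i. p i \<le> k" "\<And>i. sol (p i) = vf i" by metis
    obtain I where I: "I < (k + 1) ^ D" "\<forall>i<D. digit (k + 1) i I = p i"
      using digits_exist[of D p "k + 1"] p(1) by (auto simp: less_Suc_eq_le)
    have vfN: "vf i < N + 1" for i using t[OF c(1), of i] by (auto simp: vf_def)
    obtain v where v: "v < (N + 1) ^ D" "\<forall>i<D. digit (N + 1) i v = vf i"
      using digits_exist[of D vf "N + 1"] vfN by blast
    have mem: "member N d D bad \<alpha> t v c"
      unfolding member_def
    proof (intro conjI allI impI)
      fix j assume j: "j < d" "\<alpha> c j"
      then show "\<exists>i<D. digit (N + 1) i v = t c j"
        using v(2) dD by (intro exI[of _ j]) (simp add: vf_def)
    qed (fact c(2))
    \<comment> \<open>Child j of w satisfies D * w + 1 + j + 1 <= D * (w + 1) + 1, which preserves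
      the bound on w + 1. The table is consulted only for l <= k, where the bound gives w <
      M.\<close>
    have "\<exists>w. w + 1 \<le> (D + 1) ^ l \<and> T v w \<subseteq> S \<and> card (T v w) = l" if "l \<le> k + 1" for l
      using that
    proof (induction l)
      case 0
      show ?case by (intro exI[of _ 0]) (simp add: path_set_0)
    next
      case (Suc l)
      then obtain w where w: "w + 1 \<le> (D + 1) ^ l" "T v w \<subseteq> S" "card (T v w) = l" by auto
      have "(D + 1) ^ l \<le> (D + 1) ^ k" using Suc.prems by (intro power_increasing) auto
      then have wM: "w < M" using w(1) M by linarith
      have "\<not> hit d D C \<alpha> t Tab v w c"
        unfolding hit_iff using w(2) eq by blast
      then have ec: "elig v w c" unfolding eligible_def using mem by blast
      \<comment> \<open>The node may branch on a smaller clause than \<open>c\<close>; that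
        \<open>c\<close> is eligible only ensures that it branches at all.\<close>
      define c0 where "c0 = (LEAST c. elig v w c)"
      have c0: "elig v w c0" "c0 \<le> c" "\<And>c'. c' < c0 \<Longrightarrow> \<not> elig v w c'"
        unfolding c0_def using ec by (auto intro: LeastI Least_le dest: not_less_Least)
      have c0C: "c0 < C" using c0(2) c(1) by simp
      have tab: "Tab v w c0" using Tab[OF v(1) wM c0C] c0 unfolding branching_def by blast
      let ?g = "k + 1 + (I * M + w)"
      have "I * M + w < (k + 1) ^ D * M"
      proof -
        have "I * M + w < Suc I * M" using wM by simp
        also have "\<dots> \<le> (k + 1) ^ D * M" using I(1) by (intro mult_le_mono1) simp
        finally show ?thesis .
      qed
      then have gG: "?g < ?G" by (simp add: num_groups_def)
      have g: "(?g - (k + 1)) div M = I" "(?g - (k + 1)) mod M = w" using wM by auto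
      let ?q = "sol ?g"
      let ?v = "?q div (N + 1) div (k + 1)" and ?pos = "?q div (N + 1) mod (k + 1)" and ?val = "?q mod (N + 1)"
      have c1: "(\<forall>i<D. digit (k + 1) i I = g' \<longrightarrow> digit (N + 1) i ?v = sol g') \<and> (?pos = g' \<longrightarrow> ?val = sol g')"
        if "g' \<le> k" for g'
        using compatible_claims[OF comp[OF gG kG[OF that]], unfolded g] that by simp
      \<comment> \<open>Each of the D claimed digits is compared with the variable of its position,
        so the value can name no other set.\<close>
      have "?v = v"
      proof (rule digits_unique)
        show "?v < (N + 1) ^ D"
          using vals[OF gG] by (simp add: num_values_def less_mult_imp_div_less mult.assoc)
        show "v < (N + 1) ^ D" by fact
        show "digit (N + 1) i ?v = digit (N + 1) i v" if "i < D" for i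
          using c1[OF p(1)[of i]] that I(2) v(2) p(2) by simp
      qed
      moreover have "\<forall>c<C. Tab ?v w c \<longrightarrow> ?val < N \<and> (\<exists>j<d. \<not> \<alpha> c j \<and> t c j = ?val)"
        using compatible_branch[OF comp[OF gG gG], unfolded g] by simp
      ultimately obtain j where j: "?val < N" "j < d" "\<not> \<alpha> c0 j" "t c0 j = ?val"
        using tab c0C by auto
      have "?pos < k + 1" by (rule mod_less_divisor) simp
      then have "?pos \<le> k" by simp
      then have "?val = sol ?pos" using c1 by blast
      \<comment> \<open>The requirement that the witness be below N excludes the sentinel, so the
        witness is a genuine element of S.\<close>
      then have "?pos \<noteq> k" using j(1) sk by auto
      then have "?pos \<in> {..<k}" using le_neq_implies_less[OF \<open>?pos \<le> k\<close>] by blast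
      then have "sol ?pos \<in> S" unfolding S_def by (rule imageI)
      then have valS: "?val \<in> S" using \<open>?val = sol ?pos\<close> by (simp only:)
      have valT: "?val \<notin> T v w"
        using c0(1) j unfolding eligible_def hit_iff by metis
      have "{t c j |c. c < C \<and> Tab v w c \<and> \<not> \<alpha> c j} = {t c0 j}" (is "?A = _")
      proof (intro equalityI subsetI)
        fix x assume "x \<in> ?A"
        then obtain c where "x = t c j" "c < C" "Tab v w c" by blast
        then show "x \<in> {t c0 j}" using Tab_unique[OF v(1) wM _ c0C _ tab] by simp
      next
        fix x assume "x \<in> {t c0 j}"
        then show "x \<in> ?A" using tab c0C j(3) by blast
      qed
      then have "T v (D * w + 1 + j) = insert ?val (T v w)"
        unfolding path_set_child[OF j(2) dD] j(4) by simp
      moreover have "finite (T v w)" by (rule finite_subset[OF w(2) finS])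
      moreover have "D * w + 1 + j + 1 \<le> (D + 1) ^ Suc l"
      proof -
        have "D * w + 1 + j + 1 \<le> D * (w + 1) + 1" using j(2) dD by simp
        also have "\<dots> \<le> D * (D + 1) ^ l + (D + 1) ^ l" using w(1) by (intro add_mono mult_le_mono2) auto
        finally show ?thesis by simp
      qed
      ultimately show ?case
        using w valS valT by (intro exI[of _ "D * w + 1 + j"]) auto
    qed
    then obtain w where "T v w \<subseteq> S" "card (T v w) = k + 1" by blast
    then show False using cS card_mono[OF finS, of "T v w"] by simp
  qed
  then show ?thesis unfolding solves_def using SN cS by blast
qed

theorem solves_iff_consistent: "(\<exists>S. solves S) \<longleftrightarrow> (\<exists>sol. consistent sol)"
  using solves_imp_consistent consistent_imp_solves by blast

end

section \<open>Decoding\<close>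

text \<open>The first coordinate is the least significant one, as it varies fastest in
  \<open>List.n_lists\<close>. So \<open>num n t\<close> is the index of t in that list.\<close>

fun num :: "nat \<Rightarrow> nat list \<Rightarrow> nat" where
  "num n [] = 0"
| "num n (a # t) = a + n * num n t"

lemma num_less: "set t \<subseteq> {..<n} \<Longrightarrow> num n t < n ^ length t"
proof (induction t)
  case (Cons a t)
  then have "num n t < n ^ length t" "a < n" by auto
  then have "a + n * num n t < n * Suc (num n t)" by simp
  also have "\<dots> \<le> n * n ^ length t" using \<open>num n t < n ^ length t\<close> by (intro mult_le_mono2) simp
  finally show ?case by simp
qed simp

lemma digit_num: "set t \<subseteq> {..<n} \<Longrightarrow> i < length t \<Longrightarrow> digit n i (num n t) = t ! i"
proof (induction t arbitrary: i)
  case (Cons a t)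
  then show ?case by (cases i) (auto simp: digit_Suc, simp add: digit_def)
qed simp

lemma num_inj:
  assumes "set t \<subseteq> {..<n}" "set t' \<subseteq> {..<n}" "length t = length t'" "num n t = num n t'"
  shows "t = t'"
  by (rule nth_equalityI) (use assms digit_num in metis)+

lemma nth_concat_const:
  assumes "\<And>xs. xs \<in> set xss \<Longrightarrow> length xs = n" "q < length xss" "a < n"
  shows "concat xss ! (a + n * q) = xss ! q ! a"
  using assms
proof (induction xss arbitrary: q)
  case (Cons xs xss)
  have l: "length xs = n" using Cons.prems(1) by simp
  show ?case
  proof (cases q)
    case 0
    then show ?thesis using Cons.prems l by (simp add: nth_append)
  next
    case (Suc q')
    then show ?thesis using Cons.IH[of q'] Cons.prems l by (simp add: nth_append)
  qed
qed simp

lemma nth_n_lists: "set t \<subseteq> {..<n} \<Longrightarrow> List.n_lists (length t) [0..<n] ! num n t = t"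
proof (induction t)
  case (Cons a t)
  have "num n t < length (List.n_lists (length t) [0..<n])"
    using num_less[of t n] Cons.prems by (simp add: length_n_lists)
  then have "concat (map (\<lambda>ys. map (\<lambda>y. y # ys) [0..<n]) (List.n_lists (length t) [0..<n])) ! (a + n * num n t)
      = map (\<lambda>ys. map (\<lambda>y. y # ys) [0..<n]) (List.n_lists (length t) [0..<n]) ! num n t ! a"
    using Cons.prems by (intro nth_concat_const) (auto simp only: set_map length_map imageE, auto)
  then show ?case
    using Cons \<open>num n t < _\<close> by simp
qed simp

lemma nth_concat_sum:
  "i < length xss \<Longrightarrow> j < length (xss ! i) \<Longrightarrow>
     concat xss ! ((\<Sum>l<i. length (xss ! l)) + j) = xss ! i ! j"
proof (induction xss arbitrary: i)
  case (Cons xs xss)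
  then show ?case
    by (cases i) (auto simp: nth_append sum.lessThan_Suc_shift add.assoc simp del: sum.lessThan_Suc)
qed simp

lemma index_concat_sum:
  "p < length (concat xss) \<Longrightarrow>
     \<exists>i j. i < length xss \<and> j < length (xss ! i) \<and> p = (\<Sum>l<i. length (xss ! l)) + j"
proof (induction xss arbitrary: p)
  case (Cons xs xss)
  show ?case
  proof (cases "p < length xs")
    case True
    then show ?thesis by (intro exI[of _ 0] exI[of _ p]) simp
  next
    case False
    then have "p - length xs < length (concat xss)" using Cons.prems by simp
    from Cons.IH[OF this] obtain i j
      where "i < length xss" "j < length (xss ! i)" "p - length xs = (\<Sum>l<i. length (xss ! l)) + j"
      by blast
    then show ?thesis
      using False by (intro exI[of _ "Suc i"] exI[of _ j])
        (simp add: sum.lessThan_Suc_shift del: sum.lessThan_Suc)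
  qed
qed simp

text \<open>The first n + 1 bits are the unary size and the separator. At
  \<open>i = length \<tau>\<close> the value is the length of the whole code.\<close>

definition offset :: "vocabulary \<Rightarrow> nat \<Rightarrow> nat \<Rightarrow> nat" where
  "offset \<tau> n i = n + 1 + (\<Sum>l<i. n ^ (\<tau> ! l))"

definition lead :: "bool list \<Rightarrow> nat" where
  "lead x = length (takeWhile id x)"

definition decode :: "vocabulary \<Rightarrow> bool list \<Rightarrow> struct" where
  "decode \<tau> x = Struct (lead x) (map (\<lambda>i. {t. length t = \<tau> ! i \<and> set t \<subseteq> {..<lead x} \<and>
     x ! (offset \<tau> (lead x) i + num (lead x) t)}) [0..<length \<tau>])"

text \<open>The length alone decides: it exceeds \<open>lead x\<close>, so the separator is present,
  and any bits after it describe relations.\<close>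

definition is_code :: "vocabulary \<Rightarrow> bool list \<Rightarrow> bool" where
  "is_code \<tau> x \<longleftrightarrow> 0 < lead x \<and> length x = offset \<tau> (lead x) (length \<tau>)"

definition blocks :: "vocabulary \<Rightarrow> nat \<Rightarrow> nat list set list \<Rightarrow> bool list list" where
  "blocks \<tau> n Rs = map (\<lambda>i. map (\<lambda>t. t \<in> Rs ! i) (List.n_lists (\<tau> ! i) [0..<n])) [0..<length \<tau>]"

lemma length_blocks: "length (blocks \<tau> n Rs) = length \<tau>"
  and length_block: "i < length \<tau> \<Longrightarrow> length (blocks \<tau> n Rs ! i) = n ^ (\<tau> ! i)"
  by (simp_all add: blocks_def length_n_lists)

lemma sum_block_lengths: "i \<le> length \<tau> \<Longrightarrow> (\<Sum>l<i. length (blocks \<tau> n Rs ! l)) = (\<Sum>l<i. n ^ (\<tau> ! l))"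
  by (rule sum.cong) (auto simp: length_block)

lemma length_concat_blocks: "length (concat (blocks \<tau> n Rs)) = (\<Sum>l<length \<tau>. n ^ (\<tau> ! l))"
proof -
  have "length (concat (blocks \<tau> n Rs)) = (\<Sum>l<length (blocks \<tau> n Rs). length (blocks \<tau> n Rs ! l))"
    by (simp add: length_concat sum_list_sum_nth atLeast0LessThan)
  then show ?thesis by (simp add: length_blocks sum_block_lengths)
qed

lemma encode_blocks:
  assumes "length (rels A) = length \<tau>"
  shows "encode \<tau> A = replicate (usize A) True @ False # concat (blocks \<tau> (usize A) (rels A))"
proof -
  have "map2 (\<lambda>r R. map (\<lambda>t. t \<in> R) (List.n_lists r [0..<usize A])) \<tau> (rels A) = blocks \<tau> (usize A) (rels A)"
    by (rule nth_equalityI) (use assms in \<open>auto simp: blocks_def\<close>)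
  then show ?thesis by (simp add: encode_def)
qed

lemma nth_concat_blocks:
  assumes "i < length \<tau>" "length t = \<tau> ! i" "set t \<subseteq> {..<n}"
  shows "concat (blocks \<tau> n Rs) ! ((\<Sum>l<i. n ^ (\<tau> ! l)) + num n t) \<longleftrightarrow> t \<in> Rs ! i"
proof -
  have j: "num n t < n ^ (\<tau> ! i)" using num_less[OF assms(3)] assms(2) by simp
  have "concat (blocks \<tau> n Rs) ! ((\<Sum>l<i. length (blocks \<tau> n Rs ! l)) + num n t) = blocks \<tau> n Rs ! i ! num n t"
    by (rule nth_concat_sum) (use assms j in \<open>simp_all add: length_blocks length_block\<close>)
  also have "\<dots> \<longleftrightarrow> t \<in> Rs ! i"
    using assms(1) j nth_n_lists[OF assms(3)] unfolding assms(2)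
    by (simp add: blocks_def length_n_lists)
  finally show ?thesis using assms(1) by (simp add: sum_block_lengths)
qed

lemma lead_encode: "length (rels A) = length \<tau> \<Longrightarrow> lead (encode \<tau> A) = usize A"
  by (simp add: encode_blocks lead_def takeWhile_append)

lemma is_code_encode:
  assumes "is_structure \<tau> A"
  shows "is_code \<tau> (encode \<tau> A)"
proof -
  have l: "length (rels A) = length \<tau>" "0 < usize A" using assms by (auto simp: is_structure_def)
  then show ?thesis
    unfolding is_code_def lead_encode[OF l(1)] offset_def
    by (simp add: encode_blocks length_concat_blocks del: length_concat)
qed

lemma decode_encode:
  assumes A: "is_structure \<tau> A"
  shows "decode \<tau> (encode \<tau> A) = A"
proof (rule struct.expand, intro conjI)
  have l: "length (rels A) = length \<tau>" using A by (simp add: is_structure_def)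
  let ?n = "usize A"
  show "usize (decode \<tau> (encode \<tau> A)) = ?n" by (simp add: decode_def lead_encode[OF l])
  show "rels (decode \<tau> (encode \<tau> A)) = rels A"
  proof (rule nth_equalityI)
    show "length (rels (decode \<tau> (encode \<tau> A))) = length (rels A)" by (simp add: decode_def l)
    fix i assume "i < length (rels (decode \<tau> (encode \<tau> A)))"
    then have i: "i < length \<tau>" by (simp add: decode_def)
    have R: "rels A ! i \<subseteq> {t. length t = \<tau> ! i \<and> set t \<subseteq> {..<?n}}"
      using A i by (auto simp: is_structure_def tuples_def universe_def)
    have "encode \<tau> A ! (offset \<tau> ?n i + num ?n t) \<longleftrightarrow> t \<in> rels A ! i"
      if "length t = \<tau> ! i" "set t \<subseteq> {..<?n}" for t
    proof -
      have "encode \<tau> A ! (offset \<tau> ?n i + num ?n t) =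
          concat (blocks \<tau> ?n (rels A)) ! ((\<Sum>l<i. ?n ^ (\<tau> ! l)) + num ?n t)"
        unfolding encode_blocks[OF l] offset_def by (simp add: nth_append)
      then show ?thesis using nth_concat_blocks[OF i that] by simp
    qed
    then show "rels (decode \<tau> (encode \<tau> A)) ! i = rels A ! i"
      using R i by (auto simp: decode_def lead_encode[OF l])
  qed
qed

lemma is_structure_decode: "is_code \<tau> x \<Longrightarrow> is_structure \<tau> (decode \<tau> x)"
  by (auto simp: is_structure_def decode_def is_code_def tuples_def universe_def)

lemma encode_decode:
  assumes x: "is_code \<tau> x"
  shows "encode \<tau> (decode \<tau> x) = x"
proof -
  let ?n = "lead x" let ?A = "decode \<tau> x"
  have l: "length (rels ?A) = length \<tau>" and u: "usize ?A = ?n" by (simp_all add: decode_def)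
  have len: "length x = ?n + 1 + length (concat (blocks \<tau> ?n (rels ?A)))"
    using x unfolding is_code_def offset_def length_concat_blocks by simp
  have "replicate ?n True @ False # concat (blocks \<tau> ?n (rels ?A)) = x"
  proof (rule nth_equalityI)
    show "length (replicate ?n True @ False # concat (blocks \<tau> ?n (rels ?A))) = length x"
      using len by simp
    fix p assume "p < length (replicate ?n True @ False # concat (blocks \<tau> ?n (rels ?A)))"
    then have p: "p < length x" using len by simp
    consider "p < ?n" | "p = ?n" | "?n < p" by linarith
    then show "(replicate ?n True @ False # concat (blocks \<tau> ?n (rels ?A))) ! p = x ! p"
    proof cases
      case 1
      then have "takeWhile id x ! p = x ! p" by (simp add: lead_def takeWhile_nth)
      moreover have "takeWhile id x ! p"
        using 1 set_takeWhileD[of "takeWhile id x ! p" id x] by (simp add: lead_def)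
      ultimately show ?thesis using 1 by (simp add: nth_append)
    next
      case 2
      then have "\<not> x ! p" using p nth_length_takeWhile[of id x] by (simp add: lead_def)
      then show ?thesis using 2 by (simp add: nth_append)
    next
      case 3
      then have "p - ?n - 1 < length (concat (blocks \<tau> ?n (rels ?A)))" using p len by linarith
      then obtain i j where ij: "i < length \<tau>" "j < ?n ^ (\<tau> ! i)" "p - ?n - 1 = (\<Sum>l<i. ?n ^ (\<tau> ! l)) + j"
        using index_concat_sum[of "p - ?n - 1" "blocks \<tau> ?n (rels ?A)"]
        by (auto simp: length_blocks length_block sum_block_lengths)
      obtain t where t: "length t = \<tau> ! i" "set t \<subseteq> {..<?n}" "num ?n t = j"
      proof -
        let ?t = "List.n_lists (\<tau> ! i) [0..<?n] ! j"
        let ?t' = "map (\<lambda>l. digit ?n l j) [0..<\<tau> ! i]"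
        have n0: "0 < ?n" using x by (simp add: is_code_def)
        have s: "set ?t' \<subseteq> {..<?n}" using digit_less[OF n0] by auto
        have "num ?n ?t' = j"
          by (rule digits_unique[of _ ?n "\<tau> ! i"]) (use num_less[OF s] ij(2) digit_num[OF s] in auto)
        then show ?thesis using s by (intro that[of ?t']) auto
      qed
      have pp: "p = offset \<tau> ?n i + num ?n t" using ij(3) 3 t(3) by (simp add: offset_def)
      have "(replicate ?n True @ False # concat (blocks \<tau> ?n (rels ?A))) ! p =
          concat (blocks \<tau> ?n (rels ?A)) ! ((\<Sum>l<i. ?n ^ (\<tau> ! l)) + num ?n t)"
        using 3 ij(3) t(3) by (simp add: nth_append)
      also have "\<dots> \<longleftrightarrow> t \<in> rels ?A ! i" by (rule nth_concat_blocks[OF ij(1) t(1,2)])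
      also have "\<dots> \<longleftrightarrow> x ! p" using ij(1) t by (simp add: decode_def pp)
      finally show ?thesis .
    qed
  qed
  then show ?thesis unfolding encode_blocks[OF l] u .
qed

lemma encode_problem_iff:
  assumes "\<And>A k. (A, k) \<in> P \<Longrightarrow> is_structure \<tau> A"
  shows "(x, k) \<in> encode_problem \<tau> P \<longleftrightarrow> is_code \<tau> x \<and> (decode \<tau> x, k) \<in> P"
proof
  assume "(x, k) \<in> encode_problem \<tau> P"
  then obtain A where "(A, k) \<in> P" "x = encode \<tau> A" by (auto simp: encode_problem_def)
  then show "is_code \<tau> x \<and> (decode \<tau> x, k) \<in> P"
    using assms is_code_encode decode_encode by simp
next
  assume "is_code \<tau> x \<and> (decode \<tau> x, k) \<in> P"
  then have "(encode \<tau> (decode \<tau> x), k) \<in> encode_problem \<tau> P" by (force simp: encode_problem_def)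
  then show "(x, k) \<in> encode_problem \<tau> P" using encode_decode \<open>is_code \<tau> x \<and> _\<close> by simp
qed

section \<open>Padding of quantifier prefixes\<close>

lemma finite_free_vars: "finite (free_vars \<phi>)"
  by (induction \<phi>) auto

lemma sat_cong_free: "(\<And>y. y \<in> free_vars \<phi> \<Longrightarrow> v y = w y) \<Longrightarrow> sat A S v \<phi> = sat A S w \<phi>"
proof (induction \<phi> arbitrary: v w)
  case (Rel i xs)
  then have "map v xs = map w xs" by simp
  then show ?case by (simp only: sat.simps)
next
  case (SO xs)
  then have "map v xs = map w xs" by simp
  then show ?case by (simp only: sat.simps)
next
  case (Conj \<phi> \<psi>)
  have "sat A S v \<phi> = sat A S w \<phi>" "sat A S v \<psi> = sat A S w \<psi>"
    by (rule Conj.IH; rule Conj.prems; simp)+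
  then show ?case by (simp only: sat.simps)
next
  case (Disj \<phi> \<psi>)
  have "sat A S v \<phi> = sat A S w \<phi>" "sat A S v \<psi> = sat A S w \<psi>"
    by (rule Disj.IH; rule Disj.prems; simp)+
  then show ?case by (simp only: sat.simps)
next
  case (Neg \<phi>)
  have "sat A S v \<phi> = sat A S w \<phi>" by (rule Neg.IH; rule Neg.prems; simp)
  then show ?case by (simp only: sat.simps)
next
  case (Forall x \<phi>)
  have "sat A S (v(x := u)) \<phi> = sat A S (w(x := u)) \<phi>" for u
    by (rule Forall.IH) (use Forall.prems in auto)
  then show ?case by simp
next
  case (Exists x \<phi>)
  have "sat A S (v(x := u)) \<phi> = sat A S (w(x := u)) \<phi>" for u
    by (rule Exists.IH) (use Exists.prems in auto)
  then show ?case by simp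
qed simp_all

definition pads :: "vocabulary \<Rightarrow> nat \<Rightarrow> fm \<Rightarrow> pattern \<Rightarrow> fm \<Rightarrow> bool" where
  "pads \<tau> s \<phi> q \<phi>' \<longleftrightarrow> prenex q \<phi>' \<and> wf_fm \<tau> s \<phi>' \<and> free_vars \<phi>' = free_vars \<phi> \<and>
     (\<forall>A S v. 0 < usize A \<longrightarrow> sat A S v \<phi>' = sat A S v \<phi>)"

text \<open>A quantifier over a fresh variable is vacuous because the universe is nonempty.\<close>

lemma pads_dummy:
  assumes "pads \<tau> s \<phi> q \<phi>'"
  shows "\<exists>\<phi>''. pads \<tau> s \<phi> (b # q) \<phi>''"
proof -
  obtain d where d: "d \<notin> free_vars \<phi>'"
    using finite_free_vars ex_new_if_finite[OF infinite_UNIV_nat] by blast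
  have s: "sat A S (v(d := u)) \<phi>' = sat A S v \<phi>'" for A S v u
    by (rule sat_cong_free) (use d in auto)
  have u: "0 \<in> universe A" if "0 < usize A" for A using that by (simp add: universe_def)
  have "sat A S v (Forall d \<phi>') = sat A S v \<phi>'" "sat A S v (Exists d \<phi>') = sat A S v \<phi>'"
    if "0 < usize A" for A S v using u[OF that] by (auto simp: s)
  then have "pads \<tau> s \<phi> (b # q) (case b of Qa \<Rightarrow> Forall d \<phi>' | Qe \<Rightarrow> Exists d \<phi>')"
    using assms d by (cases b) (simp_all add: pads_def del: sat.simps)
  then show ?thesis by blast
qed

lemma prenex_Cons:
  assumes "prenex (b # p) \<phi>"
  obtains x \<phi>0 where "prenex p \<phi>0" "\<phi> = (case b of Qa \<Rightarrow> Forall x \<phi>0 | Qe \<Rightarrow> Exists x \<phi>0)"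
  using assms by (cases b; cases \<phi>) auto

lemma pads_exists:
  "subseq p q \<Longrightarrow> prenex p \<phi> \<Longrightarrow> wf_fm \<tau> s \<phi> \<Longrightarrow> \<exists>\<phi>'. pads \<tau> s \<phi> q \<phi>'"
proof (induction p q arbitrary: \<phi> rule: list_emb.induct)
  case (list_emb_Nil q)
  show ?case
  proof (induction q)
    case Nil
    then show ?case using list_emb_Nil by (auto simp: pads_def)
  next
    case (Cons b q)
    then show ?case using pads_dummy by blast
  qed
next
  case (list_emb_Cons p q b)
  then show ?case using pads_dummy by blast
next
  case (list_emb_Cons2 b b' p q)
  obtain x \<phi>0 where x: "prenex p \<phi>0" "\<phi> = (case b of Qa \<Rightarrow> Forall x \<phi>0 | Qe \<Rightarrow> Exists x \<phi>0)"
    using prenex_Cons[OF list_emb_Cons2.prems(1)] .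
  have "wf_fm \<tau> s \<phi>0" using x(2) list_emb_Cons2.prems(2) by (cases b) auto
  then obtain \<phi>' where \<phi>': "pads \<tau> s \<phi>0 q \<phi>'" using list_emb_Cons2.IH[OF x(1)] by blast
  have "pads \<tau> s \<phi> (b' # q) (case b of Qa \<Rightarrow> Forall x \<phi>' | Qe \<Rightarrow> Exists x \<phi>')"
    using \<phi>' x list_emb_Cons2.hyps by (cases b) (auto simp: pads_def)
  then show ?case by blast
qed

lemma p_models_pad:
  assumes "subseq p q" "\<phi> \<in> prenex_fms \<tau> s p"
  shows "\<exists>\<phi>' \<in> prenex_fms \<tau> s q. p_models cmp \<tau> \<phi>' = p_models cmp \<tau> \<phi>"
proof -
  obtain \<phi>' where \<phi>': "pads \<tau> s \<phi> q \<phi>'"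
    using pads_exists[OF assms(1), of \<phi> \<tau> s] assms(2) unfolding prenex_fms_def by blast
  then have "\<phi>' \<in> prenex_fms \<tau> s q" using assms(2) by (auto simp: pads_def prenex_fms_def)
  moreover have "p_models cmp \<tau> \<phi>' = p_models cmp \<tau> \<phi>"
    using \<phi>' by (auto simp: p_models_def models_def pads_def is_structure_def)
  ultimately show ?thesis by blast
qed

text \<open>Reduces membership in para-AC0 to the prefixes e...ea and hardness to the prefixes aa
  and ae.\<close>

lemma p_FD_mono:
  assumes "subseq p q"
  shows "p_FD cmp p \<subseteq> p_FD cmp q"
    and "p_FD_undirected cmp p \<subseteq> p_FD_undirected cmp q"
    and "p_FD_basic cmp p \<subseteq> p_FD_basic cmp q"
proof -
  have *: "\<exists>\<phi>'. \<phi>' \<in> prenex_fms \<tau> 1 q \<and> p_models cmp \<tau> \<phi>' = p_models cmp \<tau> \<phi>"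
    if "\<phi> \<in> prenex_fms \<tau> 1 p" for \<tau> \<phi> using p_models_pad[OF assms that] by blast
  show "p_FD cmp p \<subseteq> p_FD cmp q"
    unfolding p_FD_def by clarify (metis *)
  show "p_FD_undirected cmp p \<subseteq> p_FD_undirected cmp q"
  proof
    fix Q assume "Q \<in> p_FD_undirected cmp p"
    then obtain \<phi> where Q: "Q = encode_problem graph_voc {(G, k) \<in> p_models cmp graph_voc \<phi>. undirected G}"
      and \<phi>: "\<phi> \<in> prenex_fms graph_voc 1 p" unfolding p_FD_undirected_def by (elim CollectE exE conjE)
    obtain \<phi>' where \<phi>': "\<phi>' \<in> prenex_fms graph_voc 1 q" "p_models cmp graph_voc \<phi>' = p_models cmp graph_voc \<phi>"
      using *[OF \<phi>] by (elim exE conjE)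
    show "Q \<in> p_FD_undirected cmp q"
      unfolding p_FD_undirected_def by (intro CollectI exI[of _ \<phi>'] conjI \<phi>'(1)) (simp only: \<phi>'(2) Q)
  qed
  show "p_FD_basic cmp p \<subseteq> p_FD_basic cmp q"
  proof
    fix Q assume "Q \<in> p_FD_basic cmp p"
    then obtain \<phi> where Q: "Q = encode_problem graph_voc {(G, k) \<in> p_models cmp graph_voc \<phi>. basic G}"
      and \<phi>: "\<phi> \<in> prenex_fms graph_voc 1 p" unfolding p_FD_basic_def by (elim CollectE exE conjE)
    obtain \<phi>' where \<phi>': "\<phi>' \<in> prenex_fms graph_voc 1 q" "p_models cmp graph_voc \<phi>' = p_models cmp graph_voc \<phi>"
      using *[OF \<phi>] by (elim exE conjE)
    show "Q \<in> p_FD_basic cmp q"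
      unfolding p_FD_basic_def by (intro CollectI exI[of _ \<phi>'] conjI \<phi>'(1)) (simp only: \<phi>'(2) Q)
  qed
qed

section \<open>Graphs\<close>

definition graph :: "nat \<Rightarrow> (nat \<Rightarrow> nat \<Rightarrow> bool) \<Rightarrow> struct" where
  "graph n adj = Struct n [{[u, v] |u v. u < n \<and> v < n \<and> adj u v}]"

lemma edge_graph: "[u, v] \<in> edges (graph n adj) \<longleftrightarrow> u < n \<and> v < n \<and> adj u v"
  by (simp add: graph_def)

lemma is_structure_graph: "0 < n \<Longrightarrow> is_structure graph_voc (graph n adj)"
  by (auto simp: is_structure_def graph_voc_def graph_def tuples_def universe_def)

lemma basic_graph:
  assumes "0 < n" "\<And>u v. adj u v \<Longrightarrow> adj v u" "\<And>u. \<not> adj u u"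
  shows "basic (graph n adj)"
  unfolding basic_def undirected_def edge_graph using assms is_structure_graph by auto

text \<open>Gives each bit of the code as an explicit predicate of its index, the form in which a
  reduction that emits single bits can use it.\<close>

lemma encode_graph:
  "encode graph_voc (graph n adj) = replicate n True @ False # map (\<lambda>i. adj (i mod n) (i div n)) [0..<n * n]"
proof -
  have l: "length (rels (graph n adj)) = length graph_voc" by (simp add: graph_def graph_voc_def)
  have "concat (blocks graph_voc n (rels (graph n adj))) = map (\<lambda>i. adj (i mod n) (i div n)) [0..<n * n]"
  proof (rule nth_equalityI)
    show "length (concat (blocks graph_voc n (rels (graph n adj)))) = length (map (\<lambda>i. adj (i mod n) (i div n)) [0..<n * n])"
      unfolding length_concat_blocks by (simp add: graph_voc_def power2_eq_square)
    fix i assume "i < length (concat (blocks graph_voc n (rels (graph n adj))))"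
    then have i: "i < n * n" unfolding length_concat_blocks by (simp add: graph_voc_def power2_eq_square)
    then have n: "0 < n" by (cases n) auto
    have m: "i mod n < n" "i div n < n" using i n by (auto simp: less_mult_imp_div_less)
    have "concat (blocks graph_voc n (rels (graph n adj))) ! ((\<Sum>l<0. n ^ (graph_voc ! l)) + num n [i mod n, i div n])
       \<longleftrightarrow> [i mod n, i div n] \<in> rels (graph n adj) ! 0"
      by (rule nth_concat_blocks) (use m in \<open>auto simp: graph_voc_def\<close>)
    then show "concat (blocks graph_voc n (rels (graph n adj))) ! i = map (\<lambda>i. adj (i mod n) (i div n)) [0..<n * n] ! i"
      using i m by (simp add: edge_graph)
  qed
  then show ?thesis using encode_blocks[OF l] by (simp add: graph_def)
qed

lemma encode_problem_graph_iff:
  assumes "0 < n"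
  shows "(encode graph_voc (graph n adj), k) \<in> encode_problem graph_voc {(A, k). is_structure graph_voc A \<and> P A k}
     \<longleftrightarrow> P (graph n adj) k"
proof -
  have "(encode graph_voc (graph n adj), k) \<in> encode_problem graph_voc {(A, k). is_structure graph_voc A \<and> P A k}
    \<longleftrightarrow> is_code graph_voc (encode graph_voc (graph n adj)) \<and>
      (decode graph_voc (encode graph_voc (graph n adj)), k) \<in> {(A, k). is_structure graph_voc A \<and> P A k}"
    by (rule encode_problem_iff) auto
  then show ?thesis
    using is_code_encode[OF is_structure_graph[OF assms]] decode_encode[OF is_structure_graph[OF assms]]
      is_structure_graph[OF assms] by simp
qed

definition indep_fm :: fm where
  "indep_fm = Forall 0 (Forall 1 (Neg (Conj (Conj (SO [0]) (SO [1])) (Rel 0 [0, 1]))))"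

text \<open>Without loops a vertex does not dominate itself. So the construction also has to
  dominate the chosen vertices, which is a second task of the forced vertex.\<close>

definition dom_fm :: fm where
  "dom_fm = Forall 0 (Exists 1 (Conj (SO [1]) (Rel 0 [0, 1])))"

lemma indep_fm_prenex: "indep_fm \<in> prenex_fms graph_voc 1 [Qa, Qa]"
  by (auto simp: indep_fm_def prenex_fms_def graph_voc_def)

lemma dom_fm_prenex: "dom_fm \<in> prenex_fms graph_voc 1 [Qa, Qe]"
  by (auto simp: dom_fm_def prenex_fms_def graph_voc_def)

lemma models_indep:
  "models (graph n adj) ((\<lambda>c. [c]) ` X) indep_fm \<longleftrightarrow>
     (\<forall>u<n. \<forall>v<n. u \<in> X \<longrightarrow> v \<in> X \<longrightarrow> \<not> adj u v)"
  by (auto simp: models_def indep_fm_def universe_def graph_def)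

lemma singleton_in_image: "[v] \<in> (\<lambda>c. [c]) ` X \<longleftrightarrow> v \<in> X"
  by auto

lemma models_dom:
  "models (graph n adj) ((\<lambda>c. [c]) ` X) dom_fm \<longleftrightarrow> (\<forall>u<n. \<exists>v<n. v \<in> X \<and> adj u v)"
  by (simp add: models_def dom_fm_def universe_def graph_def singleton_in_image) blast

section \<open>Binary constraint systems as graph problems\<close>

definition solution :: "nat \<Rightarrow> nat \<Rightarrow> (nat \<Rightarrow> nat \<Rightarrow> nat \<Rightarrow> nat \<Rightarrow> bool) \<Rightarrow> (nat \<Rightarrow> nat) \<Rightarrow> bool" where
  "solution G q ok s \<longleftrightarrow> (\<forall>g<G. s g < q) \<and> (\<forall>g<G. \<forall>g'<G. ok g (s g) g' (s g'))"

definition okv :: "nat \<Rightarrow> (nat \<Rightarrow> nat \<Rightarrow> nat \<Rightarrow> nat \<Rightarrow> bool) \<Rightarrow> nat \<Rightarrow> nat \<Rightarrow> bool" where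
  "okv q ok u v \<longleftrightarrow> ok (u div q) (u mod q) (v div q) (v mod q)"

text \<open>Loops are forbidden, so a pair that violates a constraint with itself conflicts with all
  other vertices instead. With at least two variables this excludes it from every independent set of
  full size.\<close>

definition conflict :: "nat \<Rightarrow> (nat \<Rightarrow> nat \<Rightarrow> nat \<Rightarrow> nat \<Rightarrow> bool) \<Rightarrow> nat \<Rightarrow> nat \<Rightarrow> bool" where
  "conflict q ok u v \<longleftrightarrow> u \<noteq> v \<and> (u div q = v div q \<or> \<not> okv q ok u v \<or> \<not> okv q ok v u \<or>
     \<not> okv q ok u u \<or> \<not> okv q ok v v)"

lemma vertex_less: "g < G \<Longrightarrow> a < q \<Longrightarrow> g * q + a < G * (q::nat)"
proof -
  assume "g < G" "a < q"
  then have "g * q + a < Suc g * q" by simp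
  also have "\<dots> \<le> G * q" using \<open>g < G\<close> by (intro mult_le_mono1) simp
  finally show ?thesis .
qed

lemma vertex_div_mod: "a < q \<Longrightarrow> (g * q + a) div q = (g::nat) \<and> (g * q + a) mod q = a"
  by simp

text \<open>The values of one variable form a clique, so G independent vertices consist of exactly
  one value for each of the G variables.\<close>

lemma indep_set_iff_solution:
  assumes G: "2 \<le> G"
  shows "(\<exists>X\<subseteq>{..<G * q}. card X = G \<and> (\<forall>u\<in>X. \<forall>v\<in>X. \<not> conflict q ok u v)) \<longleftrightarrow> (\<exists>s. solution G q ok s)"
proof
  assume "\<exists>s. solution G q ok s"
  then obtain s where s: "\<And>g. g < G \<Longrightarrow> s g < q"
    "\<And>g g'. g < G \<Longrightarrow> g' < G \<Longrightarrow> ok g (s g) g' (s g')" unfolding solution_def by metis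
  let ?f = "\<lambda>g. g * q + s g"
  have f: "?f g div q = g" "?f g mod q = s g" if "g < G" for g
    using vertex_div_mod[OF s(1)[OF that]] by blast+
  have "inj_on ?f {..<G}" by (rule inj_onI) (metis f(1) lessThan_iff)
  then have "card (?f ` {..<G}) = G" by (simp add: card_image)
  moreover have "?f ` {..<G} \<subseteq> {..<G * q}" using vertex_less s(1) by auto
  moreover have "\<not> conflict q ok u v" if "u \<in> ?f ` {..<G}" "v \<in> ?f ` {..<G}" for u v
  proof -
    obtain g g' where g: "g < G" "g' < G" "u = ?f g" "v = ?f g'" using \<open>u \<in> _\<close> \<open>v \<in> _\<close> by blast
    then show ?thesis unfolding conflict_def okv_def g(3,4) f[OF g(1)] f[OF g(2)] using s(2) by auto
  qed
  ultimately show "\<exists>X\<subseteq>{..<G * q}. card X = G \<and> (\<forall>u\<in>X. \<forall>v\<in>X. \<not> conflict q ok u v)"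
    by (intro exI[of _ "?f ` {..<G}"]) simp
next
  assume "\<exists>X\<subseteq>{..<G * q}. card X = G \<and> (\<forall>u\<in>X. \<forall>v\<in>X. \<not> conflict q ok u v)"
  then obtain X where X: "X \<subseteq> {..<G * q}" "card X = G" "\<And>u v. u \<in> X \<Longrightarrow> v \<in> X \<Longrightarrow> \<not> conflict q ok u v"
    by blast
  have inj: "inj_on (\<lambda>u. u div q) X"
    by (rule inj_onI) (use X(3) in \<open>auto simp: conflict_def\<close>)
  have "(\<lambda>u. u div q) ` X \<subseteq> {..<G}"
    using X(1) by (auto simp: less_mult_imp_div_less)
  moreover have "card ((\<lambda>u. u div q) ` X) = G" using inj X(2) by (simp add: card_image)
  ultimately have surj: "(\<lambda>u. u div q) ` X = {..<G}" by (simp add: card_subset_eq)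
  have "\<forall>g. \<exists>u. g < G \<longrightarrow> u \<in> X \<and> u div q = g"
  proof
    fix g
    show "\<exists>u. g < G \<longrightarrow> u \<in> X \<and> u div q = g"
    proof (cases "g < G")
      case True
      then have "g \<in> (\<lambda>u. u div q) ` X" using surj by simp
      then show ?thesis by auto
    qed simp
  qed
  then obtain h where h: "\<And>g. g < G \<Longrightarrow> h g \<in> X \<and> h g div q = g" by metis
  have q: "0 < q" using X(1) h[of 0] G by (cases q) auto
  have "solution G q ok (\<lambda>g. h g mod q)"
    unfolding solution_def
  proof (intro conjI allI impI)
    show "h g mod q < q" for g using q by simp
    fix g g' assume g: "g < G" "g' < G"
    have okk: "okv q ok (h a) (h b)" if ab: "a < G" "b < G" "a \<noteq> b" for a b
    proof -
      have "h a \<noteq> h b" using h[OF ab(1)] h[OF ab(2)] ab(3) by metis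
      then show ?thesis using X(3)[of "h a" "h b"] h[OF ab(1)] h[OF ab(2)] by (simp add: conflict_def)
    qed
    have "okv q ok (h g) (h g)"
    proof -
      obtain b where b: "b < G" "b \<noteq> g" using G by (metis One_nat_def Suc_1 Suc_le_lessD less_trans zero_less_one zero_neq_one)
      then have "h g \<noteq> h b" using h[OF g(1)] h[OF b(1)] by metis
      then show ?thesis using X(3)[of "h g" "h b"] h[OF g(1)] h[OF b(1)] by (simp add: conflict_def)
    qed
    then show "ok g (h g mod q) g' (h g' mod q)"
      using okk[OF g] h[OF g(1)] h[OF g(2)] by (cases "g = g'") (auto simp: okv_def)
  qed
  then show "\<exists>s. solution G q ok s" by blast
qed

text \<open>The vertices of the second graph are the pairs \<open>g \<cdot> q + a\<close> below \<open>R = G \<cdot> q\<close>, a vertex \<open>R\<close> that the pendant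
  vertex \<open>R + 1\<close> forces into every total dominating set, a guard \<open>R + 2 + g\<close> for each variable, and a
  vertex \<open>R + 2 + G + u \<cdot> R + v\<close> for all \<open>u, v < R\<close> that forbids choosing both if they conflict.\<close>

definition dominates :: "nat \<Rightarrow> nat \<Rightarrow> (nat \<Rightarrow> nat \<Rightarrow> nat \<Rightarrow> nat \<Rightarrow> bool) \<Rightarrow> nat \<Rightarrow> nat \<Rightarrow> bool" where
  "dominates G q ok a b \<longleftrightarrow> a = G * q \<and> b = G * q + 1 \<or>
     b < G * q \<and> (a = G * q \<or>
      (G * q + 2 \<le> a \<and> a < G * q + 2 + G \<and> b div q = a - (G * q + 2)) \<or>
      (G * q + 2 + G \<le> a \<and>
        (let u = (a - (G * q + 2 + G)) div (G * q); v = (a - (G * q + 2 + G)) mod (G * q) in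
          (u div q \<noteq> v div q \<or> u = v) \<and> \<not> okv q ok u v \<longrightarrow>
            b \<noteq> u \<and> b \<noteq> v \<and> (b div q = u div q \<or> b div q = v div q))))"

definition dom_size :: "nat \<Rightarrow> nat \<Rightarrow> nat" where
  "dom_size G q = G * q + 2 + G + G * q * (G * q)"

definition dom_adj where
  "dom_adj G q ok a b \<longleftrightarrow> dominates G q ok a b \<or> dominates G q ok b a"

lemma dominates_less: "dominates G q ok a b \<Longrightarrow> G * q \<le> a \<and> b \<noteq> a"
  by (auto simp: dominates_def)

text \<open>The pendant vertex forces R, and each guard forces a vertex of its variable; this
  exhausts the budget G + 1. The vertex of a violated pair is adjacent only to the other values of
  the two variables, so it is dominated unless both are chosen. A pair u = v expresses a constraint
  of a variable with itself, while distinct values of one variable must not count as a violated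
  pair: choosing one of them is legitimate.\<close>

lemma total_dom_iff_solution:
  assumes G: "0 < G" and q: "0 < q"
  shows "(\<exists>X\<subseteq>{..<dom_size G q}. card X = G + 1 \<and> (\<forall>u<dom_size G q. \<exists>v\<in>X. dom_adj G q ok u v)) \<longleftrightarrow>
     (\<exists>s. solution G q ok s)"
proof
  let ?R = "G * q"
  have R: "0 < ?R" using G q by simp
  assume "\<exists>s. solution G q ok s"
  then obtain s where s: "\<And>g. g < G \<Longrightarrow> s g < q"
    "\<And>g g'. g < G \<Longrightarrow> g' < G \<Longrightarrow> ok g (s g) g' (s g')" unfolding solution_def by metis
  let ?f = "\<lambda>g. g * q + s g"
  have f: "?f g div q = g" "?f g mod q = s g" if "g < G" for g
    using vertex_div_mod[OF s(1)[OF that]] by blast+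
  have fR: "?f g < ?R" if "g < G" for g using vertex_less[OF that s(1)[OF that]] .
  let ?X = "insert ?R (?f ` {..<G})"
  have "inj_on ?f {..<G}" by (rule inj_onI) (metis f(1) lessThan_iff)
  then have "card (?f ` {..<G}) = G" by (simp add: card_image)
  moreover have "?R \<notin> ?f ` {..<G}" using fR by fastforce
  ultimately have "card ?X = G + 1" by simp
  moreover have "?X \<subseteq> {..<dom_size G q}"
  proof -
    have "?R < dom_size G q" by (simp add: dom_size_def)
    moreover from this have "?f g < dom_size G q" if "g < G" for g
      using fR[OF that] by (rule less_trans[rotated])
    ultimately show ?thesis by auto
  qed
  moreover have "\<exists>v\<in>?X. dom_adj G q ok a v" if a: "a < dom_size G q" for a
  proof -
    consider "a < ?R" | "a = ?R" | "a = ?R + 1" | "?R + 2 \<le> a" "a < ?R + 2 + G" | "?R + 2 + G \<le> a"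
      by linarith
    then show ?thesis
    proof cases
      case 1
      then show ?thesis by (intro bexI[of _ ?R]) (auto simp: dom_adj_def dominates_def)
    next
      case 2
      then show ?thesis using fR[OF G] G
        by (intro bexI[of _ "?f 0"]) (simp add: dom_adj_def dominates_def, blast)
    next
      case 3
      then show ?thesis by (intro bexI[of _ ?R]) (auto simp: dom_adj_def dominates_def)
    next
      case 4
      let ?g = "a - (?R + 2)"
      have g: "?g < G" using 4 by simp
      have "dominates G q ok a (?f ?g)"
        unfolding dominates_def using f[OF g] fR[OF g] 4 by blast
      then show ?thesis using g by (intro bexI[of _ "?f ?g"]) (simp add: dom_adj_def, blast)
    next
      case 5
      let ?i = "a - (?R + 2 + G)" let ?u = "?i div ?R" let ?v = "?i mod ?R"
      have "?i < ?R * ?R" using a 5 unfolding dom_size_def by linarith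
      then have uv: "?u < ?R" "?v < ?R" using R by (simp_all add: less_mult_imp_div_less)
      then have g: "?u div q < G" "?v div q < G" by (simp_all add: less_mult_imp_div_less)
      show ?thesis
      proof (cases "(?u div q \<noteq> ?v div q \<or> ?u = ?v) \<and> \<not> okv q ok ?u ?v")
        case False
        then have "dominates G q ok a (?f 0)"
          unfolding dominates_def Let_def using fR[OF G] 5 by blast
        then show ?thesis using G by (intro bexI[of _ "?f 0"]) (simp add: dom_adj_def, blast)
      next
        case True
        have "?u \<noteq> ?f (?u div q) \<or> ?v \<noteq> ?f (?v div q)"
        proof (rule ccontr)
          assume "\<not> ?thesis"
          then have "?u mod q = s (?u div q)" "?v mod q = s (?v div q)"
            using f(2)[OF g(1)] f(2)[OF g(2)] by metis+
          then show False using True s(2)[OF g] unfolding okv_def by simp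
        qed
        \<comment> \<open>The vertex chosen for w differs from both u and v: it differs from one by
          choice, and equality with the other would put u and v at the same variable, where they
          coincide.\<close>
        then obtain w where w: "w = ?u div q \<and> ?u \<noteq> ?f w \<or> w = ?v div q \<and> ?v \<noteq> ?f w" by blast
        then have wG: "w < G" using g by auto
        have "?f w \<noteq> ?u \<and> ?f w \<noteq> ?v"
          using w True f(1)[OF wG] by metis
        then have "dominates G q ok a (?f w)"
          unfolding dominates_def Let_def using fR[OF wG] f(1)[OF wG] 5 w by blast
        then show ?thesis using wG by (intro bexI[of _ "?f w"]) (simp add: dom_adj_def, blast)
      qed
    qed
  qed
  ultimately show "\<exists>X\<subseteq>{..<dom_size G q}. card X = G + 1 \<and> (\<forall>u<dom_size G q. \<exists>v\<in>X. dom_adj G q ok u v)"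
    by (intro exI[of _ ?X]) simp
next
  let ?R = "G * q"
  have R: "0 < ?R" using G q by simp
  assume "\<exists>X\<subseteq>{..<dom_size G q}. card X = G + 1 \<and> (\<forall>u<dom_size G q. \<exists>v\<in>X. dom_adj G q ok u v)"
  then obtain X where X: "X \<subseteq> {..<dom_size G q}" "card X = G + 1"
    "\<And>u. u < dom_size G q \<Longrightarrow> \<exists>v\<in>X. dom_adj G q ok u v" by blast
  have fin: "finite X" using X(1) finite_subset by blast
  have "?R + 1 < dom_size G q" by (simp add: dom_size_def)
  then obtain z where z: "z \<in> X" "dom_adj G q ok (?R + 1) z" using X(3) by blast
  have "z = ?R" using z(2) unfolding dom_adj_def dominates_def by auto
  then have RX: "?R \<in> X" using z by simp
  have "\<forall>g. \<exists>y. g < G \<longrightarrow> y \<in> X \<and> y < ?R \<and> y div q = g"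
  proof
    fix g
    show "\<exists>y. g < G \<longrightarrow> y \<in> X \<and> y < ?R \<and> y div q = g"
    proof (cases "g < G")
      case True
      then have "?R + 2 + g < dom_size G q" by (simp add: dom_size_def)
      then obtain y where y: "y \<in> X" "dom_adj G q ok (?R + 2 + g) y" using X(3) by blast
      have "y < ?R \<and> y div q = g" using y(2) True unfolding dom_adj_def dominates_def by auto
      then show ?thesis using y(1) by blast
    qed simp
  qed
  then obtain h where h: "\<And>g. g < G \<Longrightarrow> h g \<in> X \<and> h g < ?R \<and> h g div q = g" by metis
  have "inj_on h {..<G}" by (rule inj_onI) (metis h lessThan_iff)
  then have "card (h ` {..<G}) = G" by (simp add: card_image)
  moreover have "?R \<notin> h ` {..<G}" using h by fastforce
  ultimately have "card (insert ?R (h ` {..<G})) = G + 1" by simp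
  moreover have "insert ?R (h ` {..<G}) \<subseteq> X" using h RX by auto
  ultimately have Xeq: "X = insert ?R (h ` {..<G})" using X(2) fin card_subset_eq by metis
  have "solution G q ok (\<lambda>g. h g mod q)"
    unfolding solution_def
  proof (intro conjI allI impI)
    show "h g mod q < q" for g using q by simp
    fix g g' assume g: "g < G" "g' < G"
    let ?u = "h g" let ?v = "h g'"
    have uv: "?u < ?R" "?v < ?R" using h g by auto
    let ?a = "?R + 2 + G + (?u * ?R + ?v)"
    have "?a < dom_size G q" using vertex_less[OF uv] by (simp add: dom_size_def)
    then obtain y where y: "y \<in> X" "dom_adj G q ok ?a y" using X(3) by blast
    have a: "(?a - (?R + 2 + G)) div ?R = ?u" "(?a - (?R + 2 + G)) mod ?R = ?v"
      using vertex_div_mod[OF uv(2), of ?u] by simp_all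
    have "dominates G q ok ?a y"
    proof -
      have "\<not> dominates G q ok y ?a" using R unfolding dominates_def by auto
      then show ?thesis using y(2) by (simp add: dom_adj_def)
    qed
    then have y': "y < ?R" "(?u div q \<noteq> ?v div q \<or> ?u = ?v) \<and> \<not> okv q ok ?u ?v \<longrightarrow>
            y \<noteq> ?u \<and> y \<noteq> ?v \<and> (y div q = ?u div q \<or> y div q = ?v div q)"
      unfolding dominates_def Let_def a by auto
    obtain w where w: "w < G" "y = h w" using y(1) y'(1) Xeq by auto
    have "?u div q \<noteq> ?v div q \<or> ?u = ?v" using h[OF g(1)] h[OF g(2)] by auto
    moreover have "\<not> (y \<noteq> ?u \<and> y \<noteq> ?v \<and> (y div q = ?u div q \<or> y div q = ?v div q))"
      using w h[OF w(1)] h[OF g(1)] h[OF g(2)] by auto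
    ultimately have "okv q ok ?u ?v" using y'(2) by blast
    then show "ok g (h g mod q) g' (h g' mod q)"
      using h[OF g(1)] h[OF g(2)] by (simp add: okv_def)
  qed
  then show "\<exists>s. solution G q ok s" by blast
qed

section \<open>Reading the input from the working word\<close>

lemma nth_word_rec_input: "i < length x \<Longrightarrow> word_rec b e x l ! (l + i) = x ! i"
  by (induction l) auto

lemma nth_word_rec: "j < l \<Longrightarrow> word_rec b e x l ! (l - 1 - j) = b (word_rec b e x j) (case_nat j e)"
proof (induction l)
  case (Suc l)
  show ?case
  proof (cases "j = l")
    case False
    then have "Suc l - 1 - j = Suc (l - 1 - j)" using Suc.prems by simp
    then show ?thesis using Suc False by simp
  next
    case True
    show ?thesis unfolding True by (simp only: word_rec.simps diff_Suc_1 diff_self_eq_0 nth_Cons_0)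
  qed
qed simp

definition xbit :: "bool list \<Rightarrow> nat \<Rightarrow> nat \<Rightarrow> bool" where
  "xbit y l i \<longleftrightarrow> l + i < length y \<and> y ! (l + i)"

lemma xbit_word_rec: "xbit (word_rec b e x l) l i \<longleftrightarrow> i < length x \<and> x ! i"
  using nth_word_rec_input[of i x b e l] by (auto simp: xbit_def)

lemma pb_xbit: "pf l \<Longrightarrow> pf i \<Longrightarrow> pb (\<lambda>y e. xbit y (l y e) (i y e))"
  unfolding xbit_def by (intro pf_bit pf_add)

text \<open>The unary size as a count of all-true prefixes, a form to which the closure rules
  apply.\<close>

definition nlead :: "bool list \<Rightarrow> nat \<Rightarrow> nat \<Rightarrow> nat" where
  "nlead y l p = (\<Sum>i<p. of_bool (\<forall>j<Suc i. xbit y l j))"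

lemma pf_nlead: assumes "pf l" "pf p" shows "pf (\<lambda>y e. nlead y (l y e) (p y e))"
proof (rule pf_comp2[OF _ assms])
  show "pf (\<lambda>y e. nlead y (e 0) (e 1))"
    unfolding nlead_def by (intro pf_intros pb_xbit)
qed

lemma nlead_word_rec: "nlead (word_rec b e x l) l (length x) = lead x"
proof -
  have "(\<forall>j<Suc i. xbit (word_rec b e x l) l j) \<longleftrightarrow> i < lead x" if "i < length x" for i
  proof
    assume a: "\<forall>j<Suc i. xbit (word_rec b e x l) l j"
    show "i < lead x"
    proof (rule ccontr)
      assume "\<not> i < lead x"
      then have l: "lead x < Suc i" by simp
      then have "lead x < length x" using that by simp
      then have "\<not> x ! lead x" using nth_length_takeWhile[of id x] by (simp add: lead_def)
      then show False using a l by (simp add: xbit_word_rec)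
    qed
  next
    assume i: "i < lead x"
    have "x ! j" if "j < Suc i" for j
    proof -
      have j: "j < length (takeWhile id x)" using that i by (simp add: lead_def)
      then have "takeWhile id x ! j \<in> set (takeWhile id x)" by (rule nth_mem)
      then have "takeWhile id x ! j" by (auto dest: set_takeWhileD)
      then show ?thesis using takeWhile_nth[OF j] by simp
    qed
    then show "\<forall>j<Suc i. xbit (word_rec b e x l) l j"
      using that by (auto simp: xbit_word_rec)
  qed
  then have "nlead (word_rec b e x l) l (length x) = (\<Sum>i<length x. of_bool (i < lead x))"
    unfolding nlead_def by (intro sum.cong) auto
  also have "\<dots> = card ({..<length x} \<inter> {i. i < lead x})" by (simp add: sum_of_bool_eq)
  also have "{..<length x} \<inter> {i. i < lead x} = {..<lead x}"
    using length_takeWhile_le[of id x] by (auto simp: lead_def)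
  finally show ?thesis by simp
qed

section \<open>Universal first-order sentences as clause systems\<close>

primrec so_atoms :: "fm \<Rightarrow> nat list list" where
  "so_atoms Fls = []"
| "so_atoms (Rel i xs) = []"
| "so_atoms (SO xs) = [xs]"
| "so_atoms (Equal x y) = []"
| "so_atoms (Neg \<phi>) = so_atoms \<phi>"
| "so_atoms (Conj \<phi> \<psi>) = so_atoms \<phi> @ so_atoms \<psi>"
| "so_atoms (Disj \<phi> \<psi>) = so_atoms \<phi> @ so_atoms \<psi>"
| "so_atoms (Forall x \<phi>) = []"
| "so_atoms (Exists x \<phi>) = []"

text \<open>Evaluation of a quantifier-free formula under a truth assignment \<open>\<beta>\<close> to its atoms \<open>SO xs\<close>, which need not
  come from a relation: two atoms may denote the same tuple under \<open>v\<close> and yet get different values.\<close>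

primrec ev :: "vocabulary \<Rightarrow> nat \<Rightarrow> (nat \<Rightarrow> bool) \<Rightarrow> (nat \<Rightarrow> nat) \<Rightarrow> (nat list \<Rightarrow> bool) \<Rightarrow> fm \<Rightarrow> bool" where
  "ev \<tau> n X v \<beta> Fls \<longleftrightarrow> False"
| "ev \<tau> n X v \<beta> (Rel i xs) \<longleftrightarrow> X (offset \<tau> n i + num n (map v xs))"
| "ev \<tau> n X v \<beta> (SO xs) \<longleftrightarrow> \<beta> xs"
| "ev \<tau> n X v \<beta> (Equal x y) \<longleftrightarrow> v x = v y"
| "ev \<tau> n X v \<beta> (Neg \<phi>) \<longleftrightarrow> \<not> ev \<tau> n X v \<beta> \<phi>"
| "ev \<tau> n X v \<beta> (Conj \<phi> \<psi>) \<longleftrightarrow> ev \<tau> n X v \<beta> \<phi> \<and> ev \<tau> n X v \<beta> \<psi>"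
| "ev \<tau> n X v \<beta> (Disj \<phi> \<psi>) \<longleftrightarrow> ev \<tau> n X v \<beta> \<phi> \<or> ev \<tau> n X v \<beta> \<psi>"
| "ev \<tau> n X v \<beta> (Forall x \<phi>) \<longleftrightarrow> False"
| "ev \<tau> n X v \<beta> (Exists x \<phi>) \<longleftrightarrow> False"

lemma ev_cong: "(\<And>xs. xs \<in> set (so_atoms \<psi>) \<Longrightarrow> \<beta> xs = \<beta>' xs) \<Longrightarrow> ev \<tau> n X v \<beta> \<psi> = ev \<tau> n X v \<beta>' \<psi>"
  by (induction \<psi>) auto

lemma offset_less:
  assumes "i < length \<tau>" "j < n ^ (\<tau> ! i)"
  shows "offset \<tau> n i + j < offset \<tau> n (length \<tau>)"
proof -
  have "(\<Sum>l<i. n ^ (\<tau> ! l)) + n ^ (\<tau> ! i) = (\<Sum>l<Suc i. n ^ (\<tau> ! l))" by simp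
  also have "\<dots> \<le> (\<Sum>l<length \<tau>. n ^ (\<tau> ! l))" using assms(1) by (intro sum_mono2) auto
  finally show ?thesis using assms(2) by (simp add: offset_def)
qed

lemma sat_iff_ev:
  assumes x: "is_code \<tau> x" and v: "\<And>z. v z < lead x"
    and \<beta>: "\<And>xs. length xs = s \<Longrightarrow> \<beta> xs \<longleftrightarrow> map v xs \<in> S"
  shows "quantifier_free \<psi> \<Longrightarrow> wf_fm \<tau> s \<psi> \<Longrightarrow>
    sat (decode \<tau> x) S v \<psi> = ev \<tau> (lead x) (\<lambda>i. i < length x \<and> x ! i) v \<beta> \<psi>"
proof (induction \<psi>)
  case (Rel i xs)
  have s: "set (map v xs) \<subseteq> {..<lead x}" using v by auto
  have "offset \<tau> (lead x) i + num (lead x) (map v xs) < length x"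
    using offset_less[of i \<tau> "num (lead x) (map v xs)" "lead x"] num_less[OF s] Rel x by (simp add: is_code_def)
  then show ?case using Rel s by (simp add: decode_def)
qed (simp_all add: \<beta>)

text \<open>The i-th variable of the list receives digit i of \<open>a\<close>, so one bounded
  quantifier over \<open>a\<close> replaces a whole quantifier block. A repeated variable ends with
  its last value, as the innermost quantifier requires.\<close>

primrec asg :: "nat \<Rightarrow> nat \<Rightarrow> nat \<Rightarrow> nat list \<Rightarrow> (nat \<Rightarrow> nat) \<Rightarrow> nat \<Rightarrow> nat" where
  "asg n a i [] v = v"
| "asg n a i (x # xs) v = asg n a (Suc i) xs (v(x := digit n i a))"

lemma asg_Suc: "asg n a (Suc i) xs v = asg n (a div n) i xs v"
  by (induction xs arbitrary: i v) (simp_all add: digit_Suc)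

lemma asg_less: "0 < n \<Longrightarrow> (\<And>z. v z < n) \<Longrightarrow> asg n a i xs v z < n"
  by (induction xs arbitrary: i v) (simp_all add: digit_less)

lemma all_less_mult: "0 < n \<Longrightarrow> (\<forall>a<n * (k::nat). P (a mod n) (a div n)) \<longleftrightarrow> (\<forall>u<n. \<forall>a<k. P u a)"
proof (intro iffI allI impI)
  fix u a assume n: "0 < n" and *: "\<forall>a<n * k. P (a mod n) (a div n)" and "u < n" "a < k"
  then have "a * n + u < n * k" using vertex_less[of a k u n] by (simp add: mult.commute)
  with * have "P ((a * n + u) mod n) ((a * n + u) div n)" by blast
  then show "P u a" using \<open>u < n\<close> by simp
qed (auto simp: less_mult_imp_div_less mult.commute)

lemma sat_foldr_Forall:
  assumes "0 < usize A"
  shows "sat A S v (foldr Forall vs \<psi>) \<longleftrightarrow> (\<forall>a < usize A ^ length vs. sat A S (asg (usize A) a 0 vs v) \<psi>)"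
proof (induction vs arbitrary: v)
  case (Cons z vs)
  let ?n = "usize A"
  have "sat A S v (foldr Forall (z # vs) \<psi>) \<longleftrightarrow>
      (\<forall>u<?n. \<forall>a<?n ^ length vs. sat A S (asg ?n a 0 vs (v(z := u))) \<psi>)"
    by (simp only: foldr.simps o_apply sat.simps Cons.IH universe_def Ball_def lessThan_iff)
  also have "\<dots> \<longleftrightarrow> (\<forall>a<?n * ?n ^ length vs. sat A S (asg ?n (a div ?n) 0 vs (v(z := a mod ?n))) \<psi>)"
    using all_less_mult[OF assms, of _ "\<lambda>u a. sat A S (asg ?n a 0 vs (v(z := u))) \<psi>"] by simp
  finally show ?case by (simp add: asg_Suc) (simp add: digit_def)
qed simp

text \<open>Recursion over the fixed list of atoms turns the selection by a computed index into a
  finite case distinction.\<close>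

fun tnum :: "nat \<Rightarrow> (nat \<Rightarrow> nat) \<Rightarrow> nat list list \<Rightarrow> nat \<Rightarrow> nat" where
  "tnum n v [] j = 0"
| "tnum n v (xs # ats) j = (if j = 0 then num n (map v xs) else tnum n v ats (j - 1))"

lemma tnum_nth: "j < length ats \<Longrightarrow> tnum n v ats j = num n (map v (ats ! j))"
  by (induction ats arbitrary: j) (auto simp: nth_Cons')

fun idx :: "'a \<Rightarrow> 'a list \<Rightarrow> nat" where
  "idx x [] = 0"
| "idx x (y # ys) = (if x = y then 0 else Suc (idx x ys))"

lemma idx_nth: "x \<in> set ys \<Longrightarrow> idx x ys < length ys \<and> ys ! idx x ys = x"
  by (induction ys) auto

lemma digit_add_high: "j < d \<Longrightarrow> 0 < b \<Longrightarrow> digit b j (a * b ^ d + r) = digit b j r"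
proof -
  assume j: "j < d" and b: "0 < b"
  then have "b ^ d = b ^ j * (b * b ^ (d - Suc j))"
    by (metis Suc_diff_Suc add_diff_inverse_nat less_imp_not_less power_Suc power_add)
  then have "(a * b ^ d + r) div b ^ j = (r + b ^ j * (b * (a * b ^ (d - Suc j)))) div b ^ j"
    by (simp add: algebra_simps)
  also have "\<dots> = r div b ^ j + b * (a * b ^ (d - Suc j))"
    using b by (simp add: div_mult_self2)
  finally show ?thesis by (simp add: digit_def)
qed

lemma pf_anc: assumes "pf w" "pf i" shows "pf (\<lambda>y e. anc D (w y e) (i y e))"
proof -
  have "pf (\<lambda>y e. rec_nat (w y e) (\<lambda>i a. (a - 1) div D) (i y e))"
  proof (rule pf_iter[where V = w])
    show "pf (\<lambda>y e. (e 0 - 1) div D)" by (intro pf_intros)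
    show "rec_nat (w y e) (\<lambda>i a. (a - 1) div D) j \<le> w y e" for y e j
      using anc_le[of D "w y e" j] by (simp add: anc_def)
    show "pbd w" using assms by (simp add: pf_def)
  qed (use assms in auto)
  then show ?thesis unfolding anc_def .
qed

lemma pf_offset: "pf n \<Longrightarrow> pf (\<lambda>y e. offset \<tau> (n y e) i)"
proof -
  assume n: "pf n"
  have "pf (\<lambda>y e. \<Sum>l<i. n y e ^ (\<tau> ! l))"
    by (induction i) (simp_all add: pf_add pf_const pf_power n)
  then show ?thesis unfolding offset_def by (intro pf_add n pf_const)
qed

lemma pf_asg:
  assumes "pf n" "pf a"
  shows "(\<And>z. pf (\<lambda>y e. v y e z)) \<Longrightarrow> pf (\<lambda>y e. asg (n y e) (a y e) i xs (v y e) z)"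
proof (induction xs arbitrary: i v)
  case (Cons x xs)
  have "pf (\<lambda>y e. ((v y e)(x := digit (n y e) i (a y e))) z)" for z
    by (cases "z = x") (auto intro!: Cons.prems pf_digit assms pf_const)
  then show ?case unfolding asg.simps by (rule Cons.IH)
qed simp

lemma pf_num: "pf n \<Longrightarrow> (\<And>z. pf (\<lambda>y e. v y e z)) \<Longrightarrow> pf (\<lambda>y e. num (n y e) (map (v y e) xs))"
  by (induction xs) (simp_all add: pf_const pf_add pf_mult)

lemma pf_tnum:
  assumes n: "pf n" and v: "\<And>z. pf (\<lambda>y e. v y e z)"
  shows "pf j \<Longrightarrow> pf (\<lambda>y e. tnum (n y e) (v y e) ats (j y e))"
proof (induction ats arbitrary: j)
  case (Cons xs ats)
  have "pf (\<lambda>y e. tnum (n y e) (v y e) ats (j y e - 1))"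
    by (rule Cons.IH) (intro pf_diff Cons.prems pf_const)
  then show ?case unfolding tnum.simps
    by (intro pf_if pb_eq pf_num n v pf_const Cons.prems)
qed (simp add: pf_const)

lemma pb_ev:
  assumes "pf n" "pf l" "\<And>z. pf (\<lambda>y e. v y e z)" "\<And>xs. pb (\<lambda>y e. \<beta> y e xs)"
  shows "pb (\<lambda>y e. ev \<tau> (n y e) (xbit y (l y e)) (v y e) (\<beta> y e) \<psi>)"
  by (induction \<psi>) (simp_all only: ev.simps,
     (intro pb_const pb_xbit pf_add pf_offset pf_num pb_eq pb_not pb_conj pb_disj assms; assumption)+)

section \<open>The canonical clauses of a universal sentence\<close>

locale universal_sentence =
  fixes \<tau> :: vocabulary and s :: nat and vs :: "nat list" and \<psi> :: fm
  assumes qf: "quantifier_free \<psi>" and wf: "wf_fm \<tau> s \<psi>"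
begin

abbreviation "ats \<equiv> so_atoms \<psi>"
abbreviation "d \<equiv> length ats"
text \<open>The successor keeps the arity of the tree positive for a matrix without atoms.\<close>

abbreviation "D \<equiv> Suc d"

text \<open>A clause number is a * 2 ^ d + r: \<open>a\<close> codes the values of the quantified
  variables, and the binary digits of r are the truth values of the atoms that the clause
  forbids.\<close>

definition cval :: "nat \<Rightarrow> nat \<Rightarrow> nat \<Rightarrow> nat" where
  "cval n c = asg n (c div 2 ^ d) 0 vs (\<lambda>_. 0)"

definition atom :: "nat \<Rightarrow> nat \<Rightarrow> nat \<Rightarrow> nat" where
  "atom n c j = tnum n (cval n c) ats j"

definition sign :: "nat \<Rightarrow> nat \<Rightarrow> bool" where
  "sign c j \<longleftrightarrow> digit 2 j c = 1"

definition bad :: "nat \<Rightarrow> (nat \<Rightarrow> bool) \<Rightarrow> nat \<Rightarrow> bool" where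
  "bad n X c \<longleftrightarrow> \<not> ev \<tau> n X (cval n c) (\<lambda>xs. sign c (idx xs ats)) \<psi>"

definition num_clauses :: "nat \<Rightarrow> nat" where
  "num_clauses n = n ^ length vs * 2 ^ d"

lemma wf_atoms: "wf_fm \<tau> s \<phi> \<Longrightarrow> xs \<in> set (so_atoms \<phi>) \<Longrightarrow> length xs = s"
  by (induction \<phi>) auto

lemma cval_less: "0 < n \<Longrightarrow> cval n c z < n"
  unfolding cval_def by (rule asg_less) auto

lemma atom_less:
  assumes "0 < n" "j < d"
  shows "atom n c j < n ^ s"
proof -
  have "length (ats ! j) = s" using wf_atoms[OF wf] assms(2) by simp
  then show ?thesis
    using num_less[of "map (cval n c) (ats ! j)" n] cval_less[OF assms(1)] assms(2)
    by (auto simp: atom_def tnum_nth)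
qed

text \<open>The \<open>bad\<close> clauses form the canonical conjunctive normal form: one for each
  falsifying truth assignment. An assignment that treats two atoms for the same tuple differently
  yields a clause that every S satisfies.\<close>

lemma clauses_iff:
  assumes n: "0 < n"
  shows "(\<forall>a<n ^ length vs. ev \<tau> n X (asg n a 0 vs (\<lambda>_. 0)) (\<lambda>xs. num n (map (asg n a 0 vs (\<lambda>_. 0)) xs) \<in> S) \<psi>)
    \<longleftrightarrow> (\<forall>c<num_clauses n. bad n X c \<longrightarrow> (\<exists>j<d. (atom n c j \<in> S) \<noteq> sign c j))" (is "?L \<longleftrightarrow> ?R")
proof -
  have agree: "ev \<tau> n X (cval n c) (\<lambda>xs. num n (map (cval n c) xs) \<in> S) \<psi> =
      ev \<tau> n X (cval n c) (\<lambda>xs. sign c (idx xs ats)) \<psi>"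
    if "\<And>j. j < d \<Longrightarrow> (atom n c j \<in> S) = sign c j" for c
  proof (rule ev_cong)
    fix xs assume "xs \<in> set ats"
    then have "idx xs ats < d" "ats ! idx xs ats = xs" using idx_nth[of xs ats] by auto
    then show "(num n (map (cval n c) xs) \<in> S) = sign c (idx xs ats)"
      using that[of "idx xs ats"] by (simp add: atom_def tnum_nth)
  qed
  show ?thesis
  proof (intro iffI allI impI)
    fix c assume L: ?L and c: "c < num_clauses n" "bad n X c"
    have "c div 2 ^ d < n ^ length vs" using c(1) by (simp add: num_clauses_def less_mult_imp_div_less)
    then have "ev \<tau> n X (cval n c) (\<lambda>xs. num n (map (cval n c) xs) \<in> S) \<psi>"
      using L unfolding cval_def by blast
    then show "\<exists>j<d. (atom n c j \<in> S) \<noteq> sign c j" using agree[of c] c(2) unfolding bad_def by metis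
  next
    fix a assume R: ?R and a: "a < n ^ length vs"
    let ?v = "asg n a 0 vs (\<lambda>_. 0)"
    obtain r where r: "r < 2 ^ d" "\<forall>j<d. digit 2 j r = of_bool (num n (map ?v (ats ! j)) \<in> S)"
    proof -
      have "of_bool (num n (map ?v (ats ! j)) \<in> S) < (2 :: nat)" for j by simp
      from digits_exist[of d "\<lambda>j. of_bool (num n (map ?v (ats ! j)) \<in> S)" 2, OF this] show ?thesis by (elim exE conjE) (rule that)
    qed
    let ?c = "a * 2 ^ d + r"
    have v: "cval n ?c = ?v" using r(1) by (simp add: cval_def)
    have "(atom n ?c j \<in> S) = sign ?c j" if "j < d" for j
      using that r(2) digit_add_high[OF that, of 2 a r] by (simp add: sign_def atom_def tnum_nth v)
    moreover have "?c < num_clauses n" unfolding num_clauses_def by (rule vertex_less[OF a r(1)])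
    ultimately have "\<not> bad n X ?c" using R by blast
    then show "ev \<tau> n X ?v (\<lambda>xs. num n (map ?v xs) \<in> S) \<psi>"
      using agree[of ?c] \<open>\<And>j. j < d \<Longrightarrow> (atom n ?c j \<in> S) = sign ?c j\<close> unfolding bad_def v by blast
  qed
qed

lemma weighted_models_iff:
  assumes x: "is_code \<tau> x"
  shows "(\<exists>S \<subseteq> tuples (decode \<tau> x) s. card S = k \<and> models (decode \<tau> x) S (foldr Forall vs \<psi>)) \<longleftrightarrow>
    (\<exists>S \<subseteq> {..<lead x ^ s}. card S = k \<and> (\<forall>c<num_clauses (lead x).
       bad (lead x) (\<lambda>i. i < length x \<and> x ! i) c \<longrightarrow> (\<exists>j<d. (atom (lead x) c j \<in> S) \<noteq> sign c j)))"
proof -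
  let ?n = "lead x" let ?A = "decode \<tau> x" let ?X = "\<lambda>i. i < length x \<and> x ! i"
  have n: "0 < ?n" using x by (simp add: is_code_def)
  have u: "usize ?A = ?n" by (simp add: decode_def)
  have inj: "inj_on (num ?n) (tuples ?A s)"
    by (rule inj_onI, rule num_inj) (auto simp: tuples_def universe_def u)
  have img: "num ?n ` tuples ?A s = {..<?n ^ s}"
  proof
    show "num ?n ` tuples ?A s \<subseteq> {..<?n ^ s}" using num_less by (auto simp: tuples_def universe_def u)
    have "card (num ?n ` tuples ?A s) = ?n ^ s"
    proof -
      have "tuples ?A s = {t. set t \<subseteq> {..<?n} \<and> length t = s}" by (auto simp: tuples_def universe_def u)
      then show ?thesis using inj by (simp add: card_image card_lists_length_eq)
    qed
    then show "{..<?n ^ s} \<subseteq> num ?n ` tuples ?A s"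
      using \<open>num ?n ` tuples ?A s \<subseteq> {..<?n ^ s}\<close> by (metis card_lessThan card_subset_eq finite_lessThan order_refl)
  qed
  have m: "models ?A S (foldr Forall vs \<psi>) \<longleftrightarrow> (\<forall>c<num_clauses ?n. bad ?n ?X c \<longrightarrow>
      (\<exists>j<d. (atom ?n c j \<in> num ?n ` S) \<noteq> sign c j))" if S: "S \<subseteq> tuples ?A s" for S
  proof -
    have "sat ?A S (asg ?n a 0 vs (\<lambda>_. 0)) \<psi> = ev \<tau> ?n ?X (asg ?n a 0 vs (\<lambda>_. 0))
       (\<lambda>xs. num ?n (map (asg ?n a 0 vs (\<lambda>_. 0)) xs) \<in> num ?n ` S) \<psi>" for a
    proof (rule sat_iff_ev[OF x _ _ qf wf])
      show v: "asg ?n a 0 vs (\<lambda>_. 0) z < ?n" for z using n by (rule asg_less) (use n in auto)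
      fix xs :: "nat list" assume "length xs = s"
      then have "map (asg ?n a 0 vs (\<lambda>_. 0)) xs \<in> tuples ?A s"
        using v by (auto simp: tuples_def universe_def u)
      then show "num ?n (map (asg ?n a 0 vs (\<lambda>_. 0)) xs) \<in> num ?n ` S \<longleftrightarrow> map (asg ?n a 0 vs (\<lambda>_. 0)) xs \<in> S"
        by (rule inj_on_image_mem_iff[OF inj _ S])
    qed
    then show ?thesis
      unfolding models_def using sat_foldr_Forall[of ?A S "\<lambda>_. 0" vs \<psi>] clauses_iff[OF n, of ?X "num ?n ` S"] n
      by (simp add: u)
  qed
  show ?thesis
  proof
    assume "\<exists>S \<subseteq> tuples ?A s. card S = k \<and> models ?A S (foldr Forall vs \<psi>)"
    then obtain S where S: "S \<subseteq> tuples ?A s" "card S = k" "models ?A S (foldr Forall vs \<psi>)" by blast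
    have "card (num ?n ` S) = k" using S(2) card_image[OF inj_on_subset[OF inj S(1)]] by simp
    moreover have "num ?n ` S \<subseteq> {..<?n ^ s}" using S(1) img by blast
    ultimately show "\<exists>S \<subseteq> {..<?n ^ s}. card S = k \<and> (\<forall>c<num_clauses ?n. bad ?n ?X c \<longrightarrow>
      (\<exists>j<d. (atom ?n c j \<in> S) \<noteq> sign c j))"
      using m[OF S(1)] S(3) by (intro exI[of _ "num ?n ` S"] conjI) blast+
  next
    assume "\<exists>S \<subseteq> {..<?n ^ s}. card S = k \<and> (\<forall>c<num_clauses ?n. bad ?n ?X c \<longrightarrow>
      (\<exists>j<d. (atom ?n c j \<in> S) \<noteq> sign c j))"
    then obtain S where S: "S \<subseteq> {..<?n ^ s}" "card S = k" "\<forall>c<num_clauses ?n. bad ?n ?X c \<longrightarrow>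
      (\<exists>j<d. (atom ?n c j \<in> S) \<noteq> sign c j)" by blast
    obtain S' where S': "S' \<subseteq> tuples ?A s" "S = num ?n ` S'"
      using S(1) unfolding img[symmetric] by (elim subset_imageE)
    have "card S' = k" using S(2) card_image[OF inj_on_subset[OF inj S'(1)]] S'(2) by simp
    moreover have "models ?A S' (foldr Forall vs \<psi>)" using m[OF S'(1)] S(3) unfolding S'(2) by blast
    ultimately show "\<exists>S \<subseteq> tuples ?A s. card S = k \<and> models ?A S (foldr Forall vs \<psi>)"
      using S'(1) by (intro exI[of _ S'] conjI)
  qed
qed

end

section \<open>The reduction\<close>

text \<open>Justifies filling the table node by node: a partial table that is correct below w
  determines the branching at w.\<close>

lemma branching_cong:
  assumes "0 < D" "\<And>w' c'. w' < w \<Longrightarrow> c' < C \<Longrightarrow> Tab v w' c' = Tab' v w' c'"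
  shows "branching N d D C bad \<alpha> t Tab v w c = branching N d D C bad \<alpha> t Tab' v w c"
proof -
  have "hit d D C \<alpha> t Tab v w c = hit d D C \<alpha> t Tab' v w c" for c
  proof -
    have "(anc D w i - 1) div D < w" if "0 < anc D w i" for i
      using anc_le[of D w i] div_le_dividend[of "anc D w i - 1" D] that by linarith
    then have "Tab v ((anc D w i - 1) div D) c' = Tab' v ((anc D w i - 1) div D) c'"
      if "0 < anc D w i" "c' < C" for i c' using assms(2) that by blast
    then show ?thesis unfolding hit_def by (intro ex_cong1 conj_cong refl) auto
  qed
  then show ?thesis unfolding branching_def eligible_def by (simp only:)
qed

text \<open>Allows the closure proof of a large predicate to be done once with variables as
  arguments; computed arguments are substituted afterwards.\<close>

lemma pf_comp4:
  assumes h: "pf (\<lambda>x e. h x (\<lambda>i. e (i + 4)) (e 0) (e 1) (e 2) (e 3))"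
    and f: "pf f1" "pf f2" "pf f3" "pf f4"
  shows "pf (\<lambda>x e. h x e (f1 x e) (f2 x e) (f3 x e) (f4 x e))"
proof -
  have 4: "pf (\<lambda>x e. h x (\<lambda>i. e (i + 4)) (e 3) (e 2) (e 1) (e 0))"
    using pf_rename[OF h, of "\<lambda>i. if i < 4 then 3 - i else i"] by simp
  have "pf (\<lambda>x e. f4 x (\<lambda>i. e (i + 3)))" by (rule pf_rename[OF f(4)])
  from pf_let[OF this 4] have 3: "pf (\<lambda>x e. h x (\<lambda>i. e (i + 3)) (e 2) (e 1) (e 0) (f4 x (\<lambda>i. e (i + 3))))"
    by (simp add: eval_nat_numeral)
  have "pf (\<lambda>x e. f3 x (\<lambda>i. e (i + 2)))" by (rule pf_rename[OF f(3)])
  from pf_let[OF this 3] have 2: "pf (\<lambda>x e. h x (\<lambda>i. e (i + 2)) (e 1) (e 0) (f3 x (\<lambda>i. e (i + 2))) (f4 x (\<lambda>i. e (i + 2))))"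
    by (simp add: eval_nat_numeral)
  have "pf (\<lambda>x e. f2 x (\<lambda>i. e (i + 1)))" by (rule pf_rename[OF f(2)])
  from pf_let[OF this 2] have 1: "pf (\<lambda>x e. h x (\<lambda>i. e (i + 1)) (e 0) (f2 x (\<lambda>i. e (i + 1))) (f3 x (\<lambda>i. e (i + 1))) (f4 x (\<lambda>i. e (i + 1))))"
    by (simp add: eval_nat_numeral)
  from pf_let[OF f(1) 1] show ?thesis by simp
qed

text \<open>Output bit i is the one computed at step L - 1 - i, since every new bit goes to the
  front.\<close>

lemma take_word_rec:
  "m \<le> L \<Longrightarrow> take m (word_rec b e x L) = map (\<lambda>i. b (word_rec b e x (L - 1 - i)) (case_nat (L - 1 - i) e)) [0..<m]"
proof (rule nth_equalityI)
  fix i assume m: "m \<le> L" and "i < length (take m (word_rec b e x L))"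
  then have i: "i < m" "i < L" by auto
  have j: "L - 1 - (L - 1 - i) = i" using i by simp
  have "word_rec b e x L ! (L - 1 - (L - 1 - i)) = b (word_rec b e x (L - 1 - i)) (case_nat (L - 1 - i) e)"
    by (rule nth_word_rec) (use i in simp)
  then show "take m (word_rec b e x L) ! i = map (\<lambda>i. b (word_rec b e x (L - 1 - i)) (case_nat (L - 1 - i) e)) [0..<m] ! i"
    unfolding j using i by simp
qed simp

context universal_sentence
begin

definition tab_size :: "nat \<Rightarrow> nat \<Rightarrow> nat" where
  "tab_size n M = M * ((n ^ s + 1) ^ D * num_clauses n)"

text \<open>The node is the most significant component, so all entries of an ancestor, which has a
  smaller number, precede those of w.\<close>

definition tab_index :: "nat \<Rightarrow> nat \<Rightarrow> nat \<Rightarrow> nat \<Rightarrow> nat" where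
  "tab_index n v w c = (w * (n ^ s + 1) ^ D + v) * num_clauses n + c"

definition look :: "bool list \<Rightarrow> nat \<Rightarrow> nat \<Rightarrow> nat \<Rightarrow> nat \<Rightarrow> nat \<Rightarrow> bool" where
  "look y l n v w c \<longleftrightarrow> tab_index n v w c < l \<and>
     (l - 1 - tab_index n v w c < length y \<and> y ! (l - 1 - tab_index n v w c))"

definition branch where
  "branch y l p v w c \<longleftrightarrow> branching (nlead y l p ^ s) d D (num_clauses (nlead y l p))
     (bad (nlead y l p) (xbit y l)) sign (atom (nlead y l p)) (look y l (nlead y l p)) v w c"

definition tab_bit where
  "tab_bit y l p \<longleftrightarrow> branch y l p
     (l div num_clauses (nlead y l p) mod (nlead y l p ^ s + 1) ^ D)
     (l div num_clauses (nlead y l p) div (nlead y l p ^ s + 1) ^ D)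
     (l mod num_clauses (nlead y l p))"

text \<open>Every constraint includes the test that the input is a code. A word that codes no
  structure thus yields an unsolvable system of the same shape.\<close>

definition okc where
  "okc y l k M p g q g' q' \<longleftrightarrow> (0 < nlead y l p \<and> p = offset \<tau> (nlead y l p) (length \<tau>)) \<and>
     compatible (nlead y l p ^ s) k d D (num_clauses (nlead y l p)) M sign (atom (nlead y l p))
       (look y l (nlead y l p)) g q g' q'"

lemma pf_atom: "pf n \<Longrightarrow> pf c \<Longrightarrow> pf j \<Longrightarrow> pf (\<lambda>y e. atom (n y e) (c y e) (j y e))"
  unfolding atom_def cval_def by (intro pf_tnum pf_asg pf_div pf_const)

lemma pb_sign: "pf c \<Longrightarrow> pf j \<Longrightarrow> pb (\<lambda>y e. sign (c y e) (j y e))"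
  unfolding sign_def by (intro pb_eq pf_digit pf_const)

lemma pb_bad: "pf n \<Longrightarrow> pf l \<Longrightarrow> pf c \<Longrightarrow> pb (\<lambda>y e. bad (n y e) (xbit y (l y e)) (c y e))"
  unfolding bad_def cval_def by (intro pb_not pb_ev pf_asg pb_sign pf_div pf_const)

lemma pf_num_clauses: "pf n \<Longrightarrow> pf (\<lambda>y e. num_clauses (n y e))"
  unfolding num_clauses_def by (intro pf_mult pf_power pf_const)

lemma pf_tab_size: "pf n \<Longrightarrow> pf M \<Longrightarrow> pf (\<lambda>y e. tab_size (n y e) (M y e))"
  unfolding tab_size_def by (intro pf_mult pf_add pf_power pf_const pf_num_clauses)

lemma pf_tab_index:
  "pf n \<Longrightarrow> pf v \<Longrightarrow> pf w \<Longrightarrow> pf c \<Longrightarrow> pf (\<lambda>y e. tab_index (n y e) (v y e) (w y e) (c y e))"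
  unfolding tab_index_def by (intro pf_mult pf_add pf_power pf_const pf_num_clauses)

lemma pb_look:
  "pf l \<Longrightarrow> pf n \<Longrightarrow> pf v \<Longrightarrow> pf w \<Longrightarrow> pf c \<Longrightarrow> pb (\<lambda>y e. look y (l y e) (n y e) (v y e) (w y e) (c y e))"
  unfolding look_def by (intro pb_conj pf_bit pb_less pf_diff pf_tab_index pf_const)

lemmas pf_sentence_intros = pf_atom pb_sign pb_bad pf_num_clauses pb_look pf_anc pf_nlead

lemma pb_branch:
  assumes "pf v" "pf w" "pf c"
  shows "pb (\<lambda>y e. branch y (e 0) (e 3) (v y e) (w y e) (c y e))"
proof (rule pf_comp4[where h = "\<lambda>y e v w c _. of_bool (branch y (e 0) (e 3) v w c)" and ?f4.0 = "\<lambda>_ _. 0", OF _ assms pf_const])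
  show "pb (\<lambda>y e. branch y (e (0 + 4)) (e (3 + 4)) (e 0) (e 1) (e 2))"
    unfolding branch_def branching_def eligible_def member_def hit_def
    by (intro pf_intros pf_sentence_intros)
qed

lemma pb_tab_bit: "pb (\<lambda>y e. tab_bit y (e 0) (e 3))"
  unfolding tab_bit_def by (intro pb_branch pf_intros pf_sentence_intros)

lemma pb_okc:
  assumes "pf g" "pf q" "pf g'" "pf q'"
  shows "pb (\<lambda>y e. okc y (e 0) (e 1) (e 2) (e 3) (g y e) (q y e) (g' y e) (q' y e))"
proof (rule pf_comp4[where h = "\<lambda>y e g q g' q'. of_bool (okc y (e 0) (e 1) (e 2) (e 3) g q g' q')", OF _ assms])
  show "pb (\<lambda>y e. okc y (e (0 + 4)) (e (1 + 4)) (e (2 + 4)) (e (3 + 4)) (e 0) (e 1) (e 2) (e 3))"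
    unfolding okc_def compatible_def
    by (intro pf_intros pf_sentence_intros pf_offset)
qed

end

text \<open>Only the bits below \<open>tab_size\<close> are known to be table entries; the later
  bits, which form the output graph, are left abstract.\<close>

locale reduction_run = universal_sentence +
  fixes b :: "bool list \<Rightarrow> env \<Rightarrow> bool" and x :: "bool list" and k M :: nat
  assumes M: "(D + 1) ^ k \<le> M"
    and b: "\<And>l. l < tab_size (lead x) M \<Longrightarrow>
      b (word_rec b (kenv k M (length x)) x l) (case_nat l (kenv k M (length x))) =
      tab_bit (word_rec b (kenv k M (length x)) x l) l (length x)"
begin

abbreviation "W \<equiv> word_rec b (kenv k M (length x)) x"
abbreviation "n \<equiv> lead x"
abbreviation "input \<equiv> \<lambda>i. i < length x \<and> x ! i"

text \<open>The bit as it was when computed, so its value does not depend on the length of the word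
  from which it is looked up later.\<close>

definition Tab :: "nat \<Rightarrow> nat \<Rightarrow> nat \<Rightarrow> bool" where
  "Tab v w c = b (W (tab_index n v w c)) (case_nat (tab_index n v w c) (kenv k M (length x)))"

lemma look_W: "tab_index n v w c < l \<Longrightarrow> look (W l) l n v w c = Tab v w c"
  unfolding look_def Tab_def using nth_word_rec[of "tab_index n v w c" l] by auto

lemma M_pos: "0 < M"
  using M by (metis One_nat_def Suc_eq_plus1 gr0I le_zero_eq power_not_zero nat.distinct(1))

lemma tab_index_less:
  assumes "v < (n ^ s + 1) ^ D" "w < w'" "c < num_clauses n"
  shows "tab_index n v w c < w' * (n ^ s + 1) ^ D * num_clauses n"
  unfolding tab_index_def by (intro vertex_less assms)

lemma input_W: "xbit (W l) l = input"
  using xbit_word_rec by blast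

lemma Tab_branching:
  assumes v: "v < (n ^ s + 1) ^ D" and w: "w < M" and c: "c < num_clauses n"
  shows "Tab v w c = branching (n ^ s) d D (num_clauses n) (bad n input) sign (atom n) Tab v w c"
proof -
  let ?j = "tab_index n v w c"
  have j: "?j < tab_size n M"
    using tab_index_less[OF v w c] by (simp only: tab_size_def mult.assoc)
  have vwc: "?j mod num_clauses n = c" "?j div num_clauses n mod (n ^ s + 1) ^ D = v"
     "?j div num_clauses n div (n ^ s + 1) ^ D = w"
    unfolding tab_index_def vertex_div_mod[OF c, THEN conjunct1] vertex_div_mod[OF c, THEN conjunct2]
      vertex_div_mod[OF v, THEN conjunct1] vertex_div_mod[OF v, THEN conjunct2] by (rule refl)+
  have "Tab v w c = tab_bit (W ?j) ?j (length x)" unfolding Tab_def by (rule b[OF j])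
  also have "\<dots> = branching (n ^ s) d D (num_clauses n) (bad n input) sign (atom n) (look (W ?j) ?j n) v w c"
    unfolding tab_bit_def branch_def nlead_word_rec vwc input_W by (rule refl)
  also have "\<dots> = branching (n ^ s) d D (num_clauses n) (bad n input) sign (atom n) Tab v w c"
  proof (rule branching_cong)
    fix w' c' assume "w' < w" "c' < num_clauses n"
    then have "tab_index n v w' c' < w * (n ^ s + 1) ^ D * num_clauses n" by (rule tab_index_less[OF v])
    also have "\<dots> \<le> ?j" by (simp add: tab_index_def algebra_simps)
    finally show "look (W ?j) ?j n v w' c' = Tab v w' c'" by (rule look_W)
  qed simp
  finally show ?thesis .
qed

definition ok :: "nat \<Rightarrow> nat \<Rightarrow> nat \<Rightarrow> nat \<Rightarrow> bool" where
  "ok g q g' q' \<longleftrightarrow> is_code \<tau> x \<and> compatible (n ^ s) k d D (num_clauses n) M sign (atom n) Tab g q g' q'"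

text \<open>The bound on q ensures that the set coded in q addresses an entry inside the
  table.\<close>

lemma okc_W:
  assumes l: "tab_size n M \<le> l" and q: "q < num_values (n ^ s) k D"
  shows "okc (W l) l k M (length x) g q g' q' = ok g q g' q'"
proof -
  let ?N = "n ^ s"
  let ?v = "q div (?N + 1) div (k + 1)" and ?w = "(g - (k + 1)) mod M"
  have "?v < (?N + 1) ^ D" using q by (simp add: num_values_def less_mult_imp_div_less mult.assoc)
  then have "look (W l) l n ?v ?w c = Tab ?v ?w c" if "c < num_clauses n" for c
    using tab_index_less[of ?v ?w M c] that M_pos l
    by (intro look_W) (simp add: tab_size_def mult.assoc)
  then have "compatible ?N k d D (num_clauses n) M sign (atom n) (look (W l) l n) g q g' q' =
      compatible ?N k d D (num_clauses n) M sign (atom n) Tab g q g' q'"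
    unfolding compatible_def by (intro arg_cong2[where f = "(\<and>)"] refl) auto
  then show ?thesis
    unfolding okc_def ok_def nlead_word_rec is_code_def by (simp only: conj_assoc)
qed

lemma solution_iff:
  "(\<exists>sol. solution (num_groups k D M) (num_values (n ^ s) k D) ok sol) \<longleftrightarrow>
     (x, k) \<in> encode_problem \<tau> (p_WD \<tau> s (foldr Forall vs \<psi>))"
proof -
  have 1: "(x, k) \<in> encode_problem \<tau> (p_WD \<tau> s (foldr Forall vs \<psi>)) \<longleftrightarrow>
      is_code \<tau> x \<and> (decode \<tau> x, k) \<in> p_WD \<tau> s (foldr Forall vs \<psi>)"
    by (rule encode_problem_iff) (auto simp: p_WD_def)
  show ?thesis
  proof (cases "is_code \<tau> x")
    case False
    have "0 < num_groups k D M" by (simp add: num_groups_def)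
    then have "\<not> solution (num_groups k D M) (num_values (n ^ s) k D) ok sol" for sol
      unfolding solution_def ok_def using False by blast
    then show ?thesis using 1 False by blast
  next
    case True
    then have n: "0 < n" by (simp add: is_code_def)
    interpret clause_system "n ^ s" k d D "num_clauses n" M "bad n input" sign "atom n" Tab
      by (unfold_locales; (rule M | rule Tab_branching | rule atom_less[OF n] | simp); assumption?)
    have "solution (num_groups k D M) (num_values (n ^ s) k D) ok sol = consistent sol" for sol
      unfolding solution_def consistent_def ok_def using True by simp
    then have "(\<exists>sol. solution (num_groups k D M) (num_values (n ^ s) k D) ok sol) \<longleftrightarrow> (\<exists>S. solves S)"
      using solves_iff_consistent by simp
    also have "\<dots> \<longleftrightarrow> (\<exists>S \<subseteq> tuples (decode \<tau> x) s. card S = k \<and> models (decode \<tau> x) S (foldr Forall vs \<psi>))"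
      unfolding weighted_models_iff[OF True] solves_def by (rule refl)
    also have "\<dots> \<longleftrightarrow> (decode \<tau> x, k) \<in> p_WD \<tau> s (foldr Forall vs \<psi>)"
      using is_structure_decode[OF True] by (simp add: p_WD_def)
    finally show ?thesis using 1 True by blast
  qed
qed

end

lemma prenex_universal:
  "prenex (replicate m Qa) \<phi> \<Longrightarrow> \<exists>vs \<psi>. \<phi> = foldr Forall vs \<psi> \<and> quantifier_free \<psi>"
proof (induction m arbitrary: \<phi>)
  case 0
  then show ?case by (intro exI[of _ "[]"] exI[of _ \<phi>]) simp
next
  case (Suc m)
  obtain z \<phi>0 where z: "prenex (replicate m Qa) \<phi>0" "\<phi> = Forall z \<phi>0"
    using Suc.prems by (auto elim!: prenex_Cons)
  obtain vs \<psi> where "\<phi>0 = foldr Forall vs \<psi>" "quantifier_free \<psi>" using Suc.IH[OF z(1)] by blast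
  then show ?case using z(2) by (intro exI[of _ "z # vs"] exI[of _ \<psi>]) simp
qed

lemma wf_foldr_Forall: "wf_fm \<tau> s (foldr Forall vs \<psi>) = wf_fm \<tau> s \<psi>"
  by (induction vs) auto

text \<open>What both graph constructions have to provide. \<open>adj_cong\<close> is restricted to
  a < q because the computed constraint agrees with the intended one only for proper values;
  \<open>\<delta>\<close> counts the vertices chosen beyond one per variable.\<close>

locale graph_target =
  fixes size :: "nat \<Rightarrow> nat \<Rightarrow> nat" and adj :: "nat \<Rightarrow> nat \<Rightarrow> (nat \<Rightarrow> nat \<Rightarrow> nat \<Rightarrow> nat \<Rightarrow> bool) \<Rightarrow> nat \<Rightarrow> nat \<Rightarrow> bool"
    and \<delta> :: nat and Q :: param_problem
  assumes size_pos: "\<And>G q. 2 \<le> G \<Longrightarrow> 0 < q \<Longrightarrow> 0 < size G q"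
    and pf_size: "\<And>G q. pf G \<Longrightarrow> pf q \<Longrightarrow> pf (\<lambda>y e. size (G y e) (q y e))"
    and pb_adj: "\<And>G q okf u v. pf G \<Longrightarrow> pf q \<Longrightarrow> pf u \<Longrightarrow> pf v \<Longrightarrow>
      (\<And>f1 f2 f3 f4. pf f1 \<Longrightarrow> pf f2 \<Longrightarrow> pf f3 \<Longrightarrow> pf f4 \<Longrightarrow>
         pb (\<lambda>y e. okf y e (f1 y e) (f2 y e) (f3 y e) (f4 y e))) \<Longrightarrow>
      pb (\<lambda>y e. adj (G y e) (q y e) (okf y e) (u y e) (v y e))"
    and adj_cong: "\<And>G q ok ok'. 0 < q \<Longrightarrow> (\<And>g a g' a'. a < q \<Longrightarrow> ok g a g' a' = ok' g a g' a') \<Longrightarrow>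
      adj G q ok = adj G q ok'"
    and correct: "\<And>G q ok. 2 \<le> G \<Longrightarrow> 0 < q \<Longrightarrow>
      (encode graph_voc (graph (size G q) (adj G q ok)), G + \<delta>) \<in> Q \<longleftrightarrow> (\<exists>s. solution G q ok s)"
begin

theorem W1_hard: "W1_hard Q"
  unfolding W1_hard_def
proof
  fix P assume "P \<in> W1"
  then obtain \<tau> s m \<phi> where \<phi>: "\<phi> \<in> prenex_fms \<tau> s (replicate m Qa)"
    and P: "P \<le>\<^sub>f\<^sub>p\<^sub>t encode_problem \<tau> (p_WD \<tau> s \<phi>)"
    unfolding W1_def by (elim CollectE exE bexE)
  obtain vs \<psi> where vs: "\<phi> = foldr Forall vs \<psi>" "quantifier_free \<psi>"
    using prenex_universal[of m \<phi>] \<phi> by (auto simp: prenex_fms_def)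
  have "wf_fm \<tau> s \<phi>" using \<phi> by (simp add: prenex_fms_def)
  then have "wf_fm \<tau> s \<psi>" by (simp add: vs(1) wf_foldr_Forall)
  then interpret universal_sentence \<tau> s vs \<psi> using vs(2) by unfold_locales
  let ?n = "\<lambda>y e. nlead y (e 0) (e 3)"
  let ?G = "\<lambda>y e. num_groups (e 1) D (e 2)"
  let ?q = "\<lambda>y e. num_values (?n y e ^ s) (e 1) D"
  let ?N = "\<lambda>y e. size (?G y e) (?q y e)"
  let ?out = "\<lambda>y e. ?N y e + 1 + ?N y e * ?N y e"
  let ?L = "\<lambda>y e. tab_size (?n y e) (e 2) + ?out y e"
  let ?kk = "\<lambda>y e. ?G y e + \<delta>"
  let ?okf = "\<lambda>y e. okc y (e 0) (e 1) (e 2) (e 3)"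
  \<comment> \<open>The index in the final word of the bit computed at step \<open>e 0\<close>. The
    table is computed before the output and ends up behind it.\<close>
  let ?i = "\<lambda>y e. ?L y e - 1 - e 0"
  let ?adj = "\<lambda>y e. adj (?G y e) (?q y e) (?okf y e) ((?i y e - ?N y e - 1) mod ?N y e) ((?i y e - ?N y e - 1) div ?N y e)"
  \<comment> \<open>After the table, index i < N is a bit of the unary size, i = N the separator,
    and a larger i the adjacency bit number i - N - 1.\<close>
  let ?b = "\<lambda>y e. e 0 < tab_size (?n y e) (e 2) \<and> tab_bit y (e 0) (e 3) \<or>
     \<not> e 0 < tab_size (?n y e) (e 2) \<and> (?i y e < ?N y e \<or> ?N y e < ?i y e \<and> ?adj y e)"
  \<comment> \<open>The number of variables involves k but not the input length. Monotonicity
    matters because an earlier reduction bounds its parameter only from above.\<close>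
  let ?h = "\<lambda>k. num_groups k D ((D + 1) ^ k) + \<delta>"
  have n: "pf ?n" by (intro pf_nlead pf_var)
  have G: "pf ?G" unfolding num_groups_def by (intro pf_intros)
  have q: "pf ?q" unfolding num_values_def by (intro pf_intros n)
  have N: "pf ?N" by (rule pf_size[OF G q])
  have out: "pf ?out" by (intro pf_add pf_mult N pf_const)
  have ts: "pf (\<lambda>y e. tab_size (?n y e) (e 2))" by (intro pf_tab_size n pf_var)
  have L: "pf ?L" by (intro pf_add ts out)
  have i: "pf ?i" by (intro pf_diff L pf_const pf_var)
  have adj: "pb ?adj"
    by (rule pb_adj[OF G q]) (intro pf_mod pf_div pf_diff i N pf_const pb_okc; assumption)+
  have b: "pb ?b"
    by (intro pb_disj pb_conj pb_not pb_less pb_tab_bit adj i N ts pf_var)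
  show "P \<le>\<^sub>f\<^sub>p\<^sub>t Q"
  proof (rule fpt_word_reduction[OF P b L out, where kk = ?kk and B = "D + 1" and h = ?h])
    show "pf ?kk" by (intro pf_add G pf_const)
    show "0 < D + 1" by simp
    show "cf (\<lambda>x e. num_groups (e 0) D ((D + 1) ^ e 0) + \<delta>)"
      unfolding num_groups_def by (intro cf_add cf_mult cf_power_const cf_power cf_var cf_const)
    show "mono ?h"
      unfolding num_groups_def
      by (intro monoI add_mono mult_mono power_mono power_increasing) auto
    fix x k e l y
    assume e: "e = kenv k ((D + 1) ^ k) (length x)" and l: "l = ?L x (case_nat 0 e)" and y: "y = word_rec ?b e x l"
    let ?M = "(D + 1) ^ k"
    have e': "case_nat j e 0 = j" "case_nat j e 1 = k" "case_nat j e 2 = ?M" "case_nat j e 3 = length x" for j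
      by (simp_all add: e kenv_def numeral_2_eq_2 numeral_3_eq_3)
    let ?W = "word_rec ?b e x"
    have nW: "?n (?W j) (case_nat j e) = lead x" for j
      unfolding e' by (rule nlead_word_rec)
    let ?g = "num_groups k D ?M" and ?v = "num_values (lead x ^ s) k D"
    have gW: "?G (?W j) (case_nat j e) = ?g" for j unfolding e' by (rule refl)
    have qW: "?q (?W j) (case_nat j e) = ?v" for j unfolding nW unfolding e' by (rule refl)
    let ?t = "tab_size (lead x) ?M"
    let ?s = "size ?g ?v"
    let ?o = "?s + 1 + ?s * ?s"
    have LW: "?L (?W j) (case_nat j e) = ?t + ?o" for j unfolding gW qW nW unfolding e' by (rule refl)
    have l': "l = ?t + ?o" using LW[of 0] l by (simp only: word_rec.simps)
    have bW: "?b (?W j) (case_nat j e) \<longleftrightarrow> j < ?t \<and> tab_bit (?W j) j (length x) \<or>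
       \<not> j < ?t \<and> (?t + ?o - 1 - j < ?s \<or> ?s < ?t + ?o - 1 - j \<and>
          adj ?g ?v (okc (?W j) j k ?M (length x)) ((?t + ?o - 1 - j - ?s - 1) mod ?s) ((?t + ?o - 1 - j - ?s - 1) div ?s))" for j
      unfolding gW qW nW unfolding e' by (rule refl)
    interpret reduction_run \<tau> s vs \<psi> ?b x k ?M
    proof unfold_locales
      show "(D + 1) ^ k \<le> ?M" by simp
      fix j assume "j < ?t"
      then show "?b (word_rec ?b (kenv k ?M (length x)) x j) (case_nat j (kenv k ?M (length x))) =
        tab_bit (word_rec ?b (kenv k ?M (length x)) x j) j (length x)"
        using bW[of j] unfolding e by blast
    qed
    have g2: "2 \<le> ?g"
    proof -
      have "0 < (k + 1) ^ D * ?M" by (intro mult_pos_pos zero_less_power) auto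
      then show ?thesis unfolding num_groups_def by linarith
    qed
    have v0: "0 < ?v" by (simp add: num_values_def)
    have bits: "?b (?W (l - 1 - i)) (case_nat (l - 1 - i) e) \<longleftrightarrow>
       i < ?s \<or> ?s < i \<and> adj ?g ?v ok ((i - ?s - 1) mod ?s) ((i - ?s - 1) div ?s)" if i: "i < ?o" for i
    proof -
      let ?j = "l - 1 - i"
      have j: "?t \<le> ?j" "?t + ?o - 1 - ?j = i" using i unfolding l' by linarith+
      have "adj ?g ?v (okc (?W ?j) ?j k ?M (length x)) = adj ?g ?v ok"
        by (rule adj_cong[OF v0]) (use okc_W[OF j(1)] in \<open>simp only: e\<close>)
      then show ?thesis using j(1) unfolding bW j(2) by (simp only: not_less[symmetric]) auto
    qed
    have "take (?out y (case_nat l e)) y = take ?o (?W l)"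
      unfolding y gW qW by (rule refl)
    also have "\<dots> = map (\<lambda>i. ?b (?W (l - 1 - i)) (case_nat (l - 1 - i) e)) [0..<?o]"
      by (rule take_word_rec) (simp add: l')
    also have "\<dots> = map (\<lambda>i. i < ?s \<or> ?s < i \<and> adj ?g ?v ok ((i - ?s - 1) mod ?s) ((i - ?s - 1) div ?s)) [0..<?o]"
      by (rule map_cong[OF refl]) (use bits in \<open>simp only: set_upt atLeastLessThan_iff\<close>)
    also have "\<dots> = encode graph_voc (graph ?s (adj ?g ?v ok))"
      unfolding encode_graph
      by (rule nth_equalityI) (auto simp: nth_append nth_Cons' simp del: upt_Suc)
    finally have w: "take (?out y (case_nat l e)) y = encode graph_voc (graph ?s (adj ?g ?v ok))" .
    have "(x, k) \<in> encode_problem \<tau> (p_WD \<tau> s \<phi>) \<longleftrightarrow>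
       (take (?out y (case_nat l e)) y, ?kk y (case_nat l e)) \<in> Q"
      unfolding w vs(1) unfolding e' solution_iff[symmetric] by (rule correct[OF g2 v0, symmetric])
    moreover have "?kk y (case_nat l e) \<le> ?h k" unfolding e' by simp
    ultimately show "((x, k) \<in> encode_problem \<tau> (p_WD \<tau> s \<phi>) \<longleftrightarrow>
       (take (?out y (case_nat l e)) y, ?kk y (case_nat l e)) \<in> Q) \<and> ?kk y (case_nat l e) \<le> ?h k"
      by blast
  qed
qed

end

lemma pb_okv:
  assumes "pf q" "pf u" "pf v" "\<And>f1 f2 f3 f4. pf f1 \<Longrightarrow> pf f2 \<Longrightarrow> pf f3 \<Longrightarrow> pf f4 \<Longrightarrow>
         pb (\<lambda>y e. okf y e (f1 y e) (f2 y e) (f3 y e) (f4 y e))"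
  shows "pb (\<lambda>y e. okv (q y e) (okf y e) (u y e) (v y e))"
  unfolding okv_def by (intro assms(4) pf_div pf_mod assms(1-3))

lemma okv_cong:
  "0 < q \<Longrightarrow> (\<And>g a g' a'. a < q \<Longrightarrow> ok g a g' a' = ok' g a g' a') \<Longrightarrow> okv q ok = okv q ok'"
  unfolding okv_def by (intro ext) simp

text \<open>On outputs of the reduction, which are basic graphs, the three restrictions of a problem agree.\<close>

lemma graph_problem_iff:
  assumes "0 < n" "\<And>u v. adj u v \<Longrightarrow> adj v u" "\<And>u. \<not> adj u u"
    and Q: "Q \<in> {encode_problem graph_voc (p_models (=) graph_voc \<phi>),
       encode_problem graph_voc {(G, k) \<in> p_models (=) graph_voc \<phi>. undirected G},
       encode_problem graph_voc {(G, k) \<in> p_models (=) graph_voc \<phi>. basic G}}"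
  shows "(encode graph_voc (graph n adj), k) \<in> Q \<longleftrightarrow>
    (\<exists>X\<subseteq>{..<n}. card X = k \<and> models (graph n adj) ((\<lambda>c. [c]) ` X) \<phi>)"
proof -
  have b: "basic (graph n adj)" by (rule basic_graph) fact+
  then have u: "undirected (graph n adj)" by (simp add: basic_def)
  let ?P = "\<lambda>A k. \<exists>X\<subseteq>universe A. card X = k \<and> models A ((\<lambda>c. [c]) ` X) \<phi>"
  have sets: "p_models (=) graph_voc \<phi> = {(A, k). is_structure graph_voc A \<and> ?P A k}"
    "{(G, k) \<in> p_models (=) graph_voc \<phi>. undirected G} = {(A, k). is_structure graph_voc A \<and> (?P A k \<and> undirected A)}"
    "{(G, k) \<in> p_models (=) graph_voc \<phi>. basic G} = {(A, k). is_structure graph_voc A \<and> (?P A k \<and> basic A)}"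
    unfolding p_models_def by auto
  have "universe (graph n adj) = {..<n}" by (simp add: universe_def graph_def)
  then show ?thesis
    using Q b u encode_problem_graph_iff[OF assms(1), of adj k] unfolding sets by auto
qed

section \<open>Hardness of independent set and of total dominating set\<close>

lemma indep_set_W1_hard:
  assumes "Q \<in> {encode_problem graph_voc (p_models (=) graph_voc indep_fm),
       encode_problem graph_voc {(G, k) \<in> p_models (=) graph_voc indep_fm. undirected G},
       encode_problem graph_voc {(G, k) \<in> p_models (=) graph_voc indep_fm. basic G}}"
  shows "W1_hard Q"
proof -
  interpret graph_target "\<lambda>G q. G * q" "\<lambda>G. conflict" 0 Q
  proof unfold_locales
    fix G q :: nat and ok
    assume G: "2 \<le> G" and q: "0 < q"
    have "(encode graph_voc (graph (G * q) (conflict q ok)), G) \<in> Q \<longleftrightarrow>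
      (\<exists>X\<subseteq>{..<G * q}. card X = G \<and> models (graph (G * q) (conflict q ok)) ((\<lambda>c. [c]) ` X) indep_fm)"
      by (rule graph_problem_iff[OF _ _ _ assms]) (use G q in \<open>auto simp: conflict_def\<close>)
    also have "\<dots> \<longleftrightarrow> (\<exists>X\<subseteq>{..<G * q}. card X = G \<and> (\<forall>u\<in>X. \<forall>v\<in>X. \<not> conflict q ok u v))"
      unfolding models_indep by (intro ex_cong1 conj_cong refl) auto
    finally show "(encode graph_voc (graph (G * q) (conflict q ok)), G + 0) \<in> Q \<longleftrightarrow> (\<exists>s. solution G q ok s)"
      using indep_set_iff_solution[OF G, of q ok] by simp
  next
    fix G q u v :: "bool list \<Rightarrow> env \<Rightarrow> nat" and okf
    assume *: "pf G" "pf q" "pf u" "pf v" "\<And>f1 f2 f3 f4. pf f1 \<Longrightarrow> pf f2 \<Longrightarrow> pf f3 \<Longrightarrow> pf f4 \<Longrightarrow>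
         pb (\<lambda>y e. okf y e (f1 y e) (f2 y e) (f3 y e) (f4 y e))"
    show "pb (\<lambda>y e. conflict (q y e) (okf y e) (u y e) (v y e))"
      unfolding conflict_def
      by (intro pb_conj pb_disj pb_not pb_eq pf_div pb_okv *(1-4); rule *(5); assumption)
  next
    fix q :: nat and ok ok' :: "nat \<Rightarrow> nat \<Rightarrow> nat \<Rightarrow> nat \<Rightarrow> bool"
    assume "0 < q" "\<And>g a g' a'. a < q \<Longrightarrow> ok g a g' a' = ok' g a g' a'"
    from okv_cong[OF this] show "conflict q ok = conflict q ok'" unfolding conflict_def by simp
  qed (auto intro: pf_mult)
  show ?thesis by (rule W1_hard)
qed

lemma total_dom_set_W1_hard:
  assumes "Q \<in> {encode_problem graph_voc (p_models (=) graph_voc dom_fm),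
       encode_problem graph_voc {(G, k) \<in> p_models (=) graph_voc dom_fm. undirected G},
       encode_problem graph_voc {(G, k) \<in> p_models (=) graph_voc dom_fm. basic G}}"
  shows "W1_hard Q"
proof -
  interpret graph_target dom_size dom_adj 1 Q
  proof unfold_locales
    fix G q :: nat and ok
    assume G: "2 \<le> G" and q: "0 < q"
    have "(encode graph_voc (graph (dom_size G q) (dom_adj G q ok)), G + 1) \<in> Q \<longleftrightarrow>
      (\<exists>X\<subseteq>{..<dom_size G q}. card X = G + 1 \<and>
         models (graph (dom_size G q) (dom_adj G q ok)) ((\<lambda>c. [c]) ` X) dom_fm)"
      by (rule graph_problem_iff[OF _ _ _ assms]) (auto simp: dom_adj_def dom_size_def dest: dominates_less)
    also have "\<dots> \<longleftrightarrow> (\<exists>X\<subseteq>{..<dom_size G q}. card X = G + 1 \<and>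
         (\<forall>u<dom_size G q. \<exists>v\<in>X. dom_adj G q ok u v))"
      unfolding models_dom by (intro ex_cong1 conj_cong refl) blast
    finally show "(encode graph_voc (graph (dom_size G q) (dom_adj G q ok)), G + 1) \<in> Q \<longleftrightarrow> (\<exists>s. solution G q ok s)"
      using total_dom_iff_solution[of G q ok] G q by simp
  next
    fix G q u v :: "bool list \<Rightarrow> env \<Rightarrow> nat" and okf
    assume *: "pf G" "pf q" "pf u" "pf v" "\<And>f1 f2 f3 f4. pf f1 \<Longrightarrow> pf f2 \<Longrightarrow> pf f3 \<Longrightarrow> pf f4 \<Longrightarrow>
         pb (\<lambda>y e. okf y e (f1 y e) (f2 y e) (f3 y e) (f4 y e))"
    show "pb (\<lambda>y e. dom_adj (G y e) (q y e) (okf y e) (u y e) (v y e))"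
      unfolding dom_adj_def dominates_def Let_def
      by (intro pb_conj pb_disj pb_imp pb_not pb_eq pb_le pb_less pf_div pf_mod pf_add pf_mult pf_diff pf_const
        pb_okv *(1-4); rule *(5); assumption)
  next
    fix G q :: nat and ok ok' :: "nat \<Rightarrow> nat \<Rightarrow> nat \<Rightarrow> nat \<Rightarrow> bool"
    assume "0 < q" "\<And>g a g' a'. a < q \<Longrightarrow> ok g a g' a' = ok' g a g' a'"
    from okv_cong[OF this] show "dom_adj G q ok = dom_adj G q ok'"
      unfolding dom_adj_def dominates_def by simp
  next
    fix G q :: "bool list \<Rightarrow> env \<Rightarrow> nat"
    assume "pf G" "pf q"
    then show "pf (\<lambda>y e. dom_size (G y e) (q y e))"
      unfolding dom_size_def by (intro pf_add pf_mult pf_const)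
  qed (simp add: dom_size_def)
  show ?thesis by (rule W1_hard)
qed

section \<open>Extending circuits\<close>

definition vals :: "bool list \<Rightarrow> circuit \<Rightarrow> bool list" where
  "vals x C = foldl (\<lambda>vs g. vs @ [gate_value x vs g]) [] C"

definition depths :: "circuit \<Rightarrow> nat list" where
  "depths C = foldl (\<lambda>ds g. ds @ [gate_depth ds g]) [] C"

lemma vals_snoc: "vals x (C @ [g]) = vals x C @ [gate_value x (vals x C) g]"
  by (simp add: vals_def)

lemma depths_snoc: "depths (C @ [g]) = depths C @ [gate_depth (depths C) g]"
  by (simp add: depths_def)

lemma length_vals [simp]: "length (vals x C) = length C"
  by (induction C rule: rev_induct) (simp_all add: vals_snoc, simp add: vals_def)

lemma length_depths [simp]: "length (depths C) = length C"
  by (induction C rule: rev_induct) (simp_all add: depths_snoc, simp add: depths_def)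

lemma vals_append: "i < length C \<Longrightarrow> vals x (C @ D) ! i = vals x C ! i"
proof (induction D rule: rev_induct)
  case (snoc g D)
  have "vals x (C @ D @ [g]) = vals x (C @ D) @ [gate_value x (vals x (C @ D)) g]"
    using vals_snoc[of x "C @ D" g] by simp
  then show ?case using snoc by (simp add: nth_append)
qed simp

lemma depths_append: "i < length C \<Longrightarrow> depths (C @ D) ! i = depths C ! i"
proof (induction D rule: rev_induct)
  case (snoc g D)
  have "depths (C @ D @ [g]) = depths (C @ D) @ [gate_depth (depths (C @ D)) g]"
    using depths_snoc[of "C @ D" g] by simp
  then show ?case using snoc by (simp add: nth_append)
qed simp

definition wf_gates :: "nat \<Rightarrow> circuit \<Rightarrow> bool" where
  "wf_gates n C \<longleftrightarrow> (\<forall>i<length C. wires (C ! i) \<subseteq> {..<i} \<and> (\<forall>j. C ! i = Input j \<longrightarrow> j < n))"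

lemma wf_gates_snoc:
  "wf_gates n C \<Longrightarrow> wires g \<subseteq> {..<length C} \<Longrightarrow> (\<And>j. g = Input j \<Longrightarrow> j < n) \<Longrightarrow> wf_gates n (C @ [g])"
  by (auto simp: wf_gates_def nth_append less_Suc_eq)

text \<open>Depth is bounded for each new gate, not by a maximum over the circuit; so extensions
  appended one after another keep the bound d, although their sizes add up.\<close>

definition extension :: "nat \<Rightarrow> nat \<Rightarrow> circuit \<Rightarrow> circuit \<Rightarrow> bool" where
  "extension n d C D \<longleftrightarrow> wf_gates n (C @ D) \<and>
     (\<forall>i. length C \<le> i \<longrightarrow> i < length C + length D \<longrightarrow> depths (C @ D) ! i \<le> d)"

text \<open>Every circuit on \<open>n\<close> inputs can be extended by at most \<open>s\<close> gates of depth at most \<open>d\<close>, the last of which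
  computes \<open>F\<close>.\<close>

definition realizable :: "nat \<Rightarrow> nat \<Rightarrow> nat \<Rightarrow> (bool list \<Rightarrow> bool) \<Rightarrow> bool" where
  "realizable n d s F \<longleftrightarrow> (\<forall>C. wf_gates n C \<longrightarrow>
     (\<exists>D. D \<noteq> [] \<and> length D \<le> s \<and> extension n d C D \<and>
       (\<forall>x. length x = n \<longrightarrow> vals x (C @ D) ! (length C + length D - 1) = F x)))"

lemma realizableD:
  "realizable n d s F \<Longrightarrow> wf_gates n C \<Longrightarrow> \<exists>D. D \<noteq> [] \<and> length D \<le> s \<and> extension n d C D \<and>
       (\<forall>x. length x = n \<longrightarrow> vals x (C @ D) ! (length C + length D - 1) = F x)"
  unfolding realizable_def by (elim allE) (erule mp)

lemma realizableI:
  assumes "\<And>C. wf_gates n C \<Longrightarrow> \<exists>D. D \<noteq> [] \<and> length D \<le> s \<and> extension n d C D \<and>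
       (\<forall>x. length x = n \<longrightarrow> vals x (C @ D) ! (length C + length D - 1) = F x)"
  shows "realizable n d s F"
  unfolding realizable_def using assms by (intro allI impI)

lemma extension_mono: "extension n d C D \<Longrightarrow> d \<le> d' \<Longrightarrow> extension n d' C D"
  unfolding extension_def using le_trans by blast

lemma realizable_mono:
  assumes "realizable n d s F" "d \<le> d'" "s \<le> s'"
  shows "realizable n d' s' F"
proof (rule realizableI)
  fix C assume "wf_gates n C"
  from realizableD[OF assms(1) this] obtain D where D: "D \<noteq> []" "length D \<le> s" "extension n d C D"
    and D4: "\<forall>x. length x = n \<longrightarrow> vals x (C @ D) ! (length C + length D - 1) = F x"
    by (elim exE conjE) (rule that)
  note D = D D4[rule_format]
  then show "\<exists>D. D \<noteq> [] \<and> length D \<le> s' \<and> extension n d' C D \<and>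
       (\<forall>x. length x = n \<longrightarrow> vals x (C @ D) ! (length C + length D - 1) = F x)"
    using assms(2,3) by (intro exI[of _ D]) (simp add: extension_mono)
qed

lemma realizable_cong:
  assumes "realizable n d s F" "\<And>x. length x = n \<Longrightarrow> F x = G x"
  shows "realizable n d s G"
proof (rule realizableI)
  fix C assume "wf_gates n C"
  from realizableD[OF assms(1) this] obtain D where D: "D \<noteq> []" "length D \<le> s" "extension n d C D"
    and D4: "\<forall>x. length x = n \<longrightarrow> vals x (C @ D) ! (length C + length D - 1) = F x"
    by (elim exE conjE) (rule that)
  note D = D D4[rule_format]
  then show "\<exists>D. D \<noteq> [] \<and> length D \<le> s \<and> extension n d C D \<and>
       (\<forall>x. length x = n \<longrightarrow> vals x (C @ D) ! (length C + length D - 1) = G x)"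
    using assms(2) by (intro exI[of _ D]) simp
qed

lemma extension_trans:
  assumes "extension n d C D" "extension n d (C @ D) D'"
  shows "extension n d C (D @ D')"
  unfolding extension_def
proof (intro conjI allI impI)
  show "wf_gates n (C @ D @ D')" using assms(2) by (simp add: extension_def)
  fix i assume i: "length C \<le> i" "i < length C + length (D @ D')"
  show "depths (C @ D @ D') ! i \<le> d"
  proof (cases "i < length (C @ D)")
    case True
    then have "depths ((C @ D) @ D') ! i = depths (C @ D) ! i" by (rule depths_append)
    then show ?thesis using assms(1) i True by (simp add: extension_def)
  next
    case False
    then show ?thesis using assms(2) i by (simp add: extension_def)
  qed
qed

lemma realizable_gate:
  assumes wf: "wf_gates n (C @ D)" and ext: "extension n d C D" and d: "d \<le> d'"
    and g: "wires g \<subseteq> {..<length (C @ D)}" "\<And>j. g = Input j \<Longrightarrow> j < n"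
    and dg: "gate_depth (depths (C @ D)) g \<le> d'"
  shows "extension n d' C (D @ [g])"
  unfolding extension_def
proof (intro conjI allI impI)
  show "wf_gates n (C @ D @ [g])" using wf_gates_snoc[OF wf g] by simp
  fix i assume i: "length C \<le> i" "i < length C + length (D @ [g])"
  have eq: "depths (C @ D @ [g]) = depths (C @ D) @ [gate_depth (depths (C @ D)) g]"
    using depths_snoc[of "C @ D" g] by simp
  show "depths (C @ D @ [g]) ! i \<le> d'"
  proof (cases "i < length (C @ D)")
    case True
    then have "depths (C @ D) ! i \<le> d" using ext i by (simp add: extension_def)
    then show ?thesis using True d unfolding eq by (simp add: nth_append)
  next
    case False
    then show ?thesis using i dg unfolding eq by (simp add: nth_append)
  qed
qed

lemma extension_Nil: "wf_gates n C \<Longrightarrow> extension n d C []"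
  by (simp add: extension_def)

lemma realizable_Input:
  assumes "j < n" shows "realizable n 0 1 (\<lambda>x. x ! j)"
  unfolding realizable_def
proof (intro allI impI)
  fix C assume C: "wf_gates n C"
  have "extension n 0 C ([] @ [Input j])"
    by (rule realizable_gate[OF _ extension_Nil[OF C]]) (use C assms in auto)
  then show "\<exists>D. D \<noteq> [] \<and> length D \<le> 1 \<and> extension n 0 C D \<and>
       (\<forall>x. length x = n \<longrightarrow> vals x (C @ D) ! (length C + length D - 1) = x ! j)"
    by (intro exI[of _ "[Input j]"]) (simp add: vals_snoc nth_append)
qed

lemma realizable_list:
  assumes "\<forall>j\<in>set js. realizable n d s (F j)" "wf_gates n C"
  shows "\<exists>D ix. length D \<le> length js * s \<and> extension n d C D \<and>
    (\<forall>j\<in>set js. length C \<le> ix j \<and> ix j < length C + length D \<and>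
       (\<forall>x. length x = n \<longrightarrow> vals x (C @ D) ! ix j = F j x))"
  using assms(1)
proof (induction js)
  case Nil
  then show ?case using extension_Nil[OF assms(2)] by (intro exI[of _ "[]"]) simp
next
  case (Cons j js)
  have "\<forall>j\<in>set js. realizable n d s (F j)" using Cons.prems by simp
  from Cons.IH[OF this] obtain D ix where D: "length D \<le> length js * s" "extension n d C D"
    and D3: "\<forall>j\<in>set js. length C \<le> ix j \<and> ix j < length C + length D \<and>
       (\<forall>x. length x = n \<longrightarrow> vals x (C @ D) ! ix j = F j x)"
    by (elim exE conjE) (rule that)
  note D = D bspec[OF D3]
  have "wf_gates n (C @ D)" using D(2) by (simp add: extension_def)
  from realizableD[OF bspec[OF Cons.prems list.set_intros(1)] this]
  obtain D' where D': "D' \<noteq> []" "length D' \<le> s" "extension n d (C @ D) D'"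
      and D'4: "\<forall>x. length x = n \<longrightarrow> vals x ((C @ D) @ D') ! (length (C @ D) + length D' - 1) = F j x"
    by (elim exE conjE) (rule that)
  note D' = D' D'4[rule_format]
  let ?ix = "ix(j := length (C @ D) + length D' - 1)"
  show ?case
  proof (intro exI[of _ "D @ D'"] exI[of _ ?ix] conjI ballI)
    show "length (D @ D') \<le> length (j # js) * s" using D(1) D'(2) by simp
    show "extension n d C (D @ D')" by (rule extension_trans[OF D(2) D'(3)])
    fix j' assume j': "j' \<in> set (j # js)"
    have l: "0 < length D'" using D'(1) by simp
    have l2: "length C \<le> length (C @ D) + length D' - 1"
      "length (C @ D) + length D' - 1 < length C + length (D @ D')"
      using l unfolding length_append by linarith+
    show "length C \<le> ?ix j'"
    proof (cases "j' = j")
      case True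
      then show ?thesis using l2(1) by (simp only: fun_upd_same)
    next
      case False
      then show ?thesis using j' D(3)[of j'] by simp
    qed
    show "?ix j' < length C + length (D @ D')"
    proof (cases "j' = j")
      case True
      then show ?thesis using l2(2) by (simp only: fun_upd_same)
    next
      case False
      then show ?thesis using j' D(3)[of j'] by simp
    qed
    show "\<forall>x. length x = n \<longrightarrow> vals x (C @ D @ D') ! ?ix j' = F j' x"
    proof (cases "j' = j")
      case True
      then show ?thesis using D'(4) by simp
    next
      case False
      then have "j' \<in> set js" using j' by simp
      from D(3)[OF this] show ?thesis
        using False vals_append[of "ix j'" "C @ D" _ D'] by simp
    qed
  qed
qed

lemma realizable_gate_list:
  assumes "\<forall>j\<in>set js. realizable n d s (F j)"
    and g: "\<And>is. wires (g is) = set is" "\<And>is ds. gate_depth ds (g is) = Suc (Max (insert 0 ((!) ds ` set is)))"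
      "\<And>is j. g is \<noteq> Input j"
    and F: "\<And>ix x vs. (\<And>j. j \<in> set js \<Longrightarrow> vs ! ix j = F j x) \<Longrightarrow> gate_value x vs (g (map ix js)) = G x"
  shows "realizable n (Suc d) (length js * s + 1) G"
  unfolding realizable_def
proof (intro allI impI)
  fix C assume C: "wf_gates n C"
  from realizable_list[of js n d s F C, OF assms(1) C] obtain D ix
    where D: "length D \<le> length js * s" "extension n d C D"
    and D3: "\<forall>j\<in>set js. length C \<le> ix j \<and> ix j < length C + length D \<and>
       (\<forall>x. length x = n \<longrightarrow> vals x (C @ D) ! ix j = F j x)"
    by (elim exE conjE) (rule that)
  note D = D bspec[OF D3]
  let ?g = "g (map ix js)"
  have "extension n (Suc d) C (D @ [?g])"
  proof (rule realizable_gate[OF _ D(2)])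
    show "wf_gates n (C @ D)" using D(2) by (simp add: extension_def)
    show "wires ?g \<subseteq> {..<length (C @ D)}" using D(3) by (auto simp: g(1))
    have "depths (C @ D) ! ix j \<le> d" if "j \<in> set js" for j
      using D(2,3) that by (simp add: extension_def)
    then show "gate_depth (depths (C @ D)) ?g \<le> Suc d" by (auto simp: g(2))
  qed (auto simp: g(3))
  moreover have "vals x (C @ D @ [?g]) ! (length C + length (D @ [?g]) - 1) = G x" if "length x = n" for x
  proof -
    have "vals x (C @ D @ [?g]) = vals x (C @ D) @ [gate_value x (vals x (C @ D)) ?g]"
      using vals_snoc[of x "C @ D" ?g] by simp
    moreover have "gate_value x (vals x (C @ D)) ?g = G x" by (rule F) (use D(3) that in blast)
    ultimately show ?thesis by (simp add: nth_append)
  qed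
  ultimately show "\<exists>D. D \<noteq> [] \<and> length D \<le> length js * s + 1 \<and> extension n (Suc d) C D \<and>
       (\<forall>x. length x = n \<longrightarrow> vals x (C @ D) ! (length C + length D - 1) = G x)"
    using D(1) by (intro exI[of _ "D @ [?g]"]) simp
qed

text \<open>The size 2 * s instead of s + 1 keeps all bounds products, which compose without
  expansion.\<close>

lemma realizable_not:
  assumes "realizable n d s F" "1 \<le> s"
  shows "realizable n (Suc d) (2 * s) (\<lambda>x. \<not> F x)"
proof (rule realizable_mono)
  show "realizable n (Suc d) (s + 1) (\<lambda>x. \<not> F x)"
    unfolding realizable_def
  proof (intro allI impI)
    fix C assume C: "wf_gates n C"
    from realizableD[OF assms(1) C] obtain D where D: "D \<noteq> []" "length D \<le> s" "extension n d C D"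
       and D4: "\<forall>x. length x = n \<longrightarrow> vals x (C @ D) ! (length C + length D - 1) = F x"
  by (elim exE conjE) (rule that)
note D = D D4[rule_format]
    let ?i = "length C + length D - 1"
    let ?g = "NotGate ?i"
    have l: "0 < length D" using D(1) by simp
    have "extension n (Suc d) C (D @ [?g])"
    proof (rule realizable_gate[OF _ D(3)])
      show "wf_gates n (C @ D)" using D(3) by (simp add: extension_def)
      show "wires ?g \<subseteq> {..<length (C @ D)}" using l by auto
      have "length C \<le> ?i" "?i < length C + length D" using l by linarith+
      then have "depths (C @ D) ! ?i \<le> d" using D(3) unfolding extension_def by blast
      then show "gate_depth (depths (C @ D)) ?g \<le> Suc d" by simp
    qed auto
    moreover have "vals x (C @ D @ [?g]) ! (length C + length (D @ [?g]) - 1) = (\<not> F x)" if "length x = n" for x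
    proof -
      have "vals x (C @ D @ [?g]) = vals x (C @ D) @ [gate_value x (vals x (C @ D)) ?g]"
        using vals_snoc[of x "C @ D" ?g] by simp
      then show ?thesis using D(4)[OF that] by (simp add: nth_append)
    qed
    ultimately show "\<exists>D. D \<noteq> [] \<and> length D \<le> s + 1 \<and> extension n (Suc d) C D \<and>
         (\<forall>x. length x = n \<longrightarrow> vals x (C @ D) ! (length C + length D - 1) = (\<not> F x))"
      using D(2) by (intro exI[of _ "D @ [?g]"]) simp
  qed
qed (use assms in auto)

lemma realizable_ball:
  assumes "finite J" "card J \<le> N" "1 \<le> N" "1 \<le> s" "\<And>j. j \<in> J \<Longrightarrow> realizable n d s (F j)"
  shows "realizable n (Suc d) (2 * N * s) (\<lambda>x. \<forall>j\<in>J. F j x)"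
    and "realizable n (Suc d) (2 * N * s) (\<lambda>x. \<exists>j\<in>J. F j x)"
proof -
  obtain js where js: "set js = J" "distinct js" using assms(1) finite_distinct_list by blast
  then have l: "length js \<le> N" using assms(2) distinct_card by metis
  have le: "length js * s + 1 \<le> 2 * N * s"
  proof -
    have "length js * s \<le> N * s" by (rule mult_le_mono1[OF l])
    moreover have "1 * 1 \<le> N * s" by (rule mult_le_mono[OF assms(3,4)])
    moreover have "2 * N * s = N * s + N * s" by simp
    ultimately show ?thesis by linarith
  qed
  have "realizable n (Suc d) (length js * s + 1) (\<lambda>x. \<forall>j\<in>J. F j x)"
    by (rule realizable_gate_list[where g = AndGate and F = F]) (use assms(5) js(1) in auto)
  then show "realizable n (Suc d) (2 * N * s) (\<lambda>x. \<forall>j\<in>J. F j x)"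
    by (rule realizable_mono) (use le in auto)
  have "realizable n (Suc d) (length js * s + 1) (\<lambda>x. \<exists>j\<in>J. F j x)"
    by (rule realizable_gate_list[where g = OrGate and F = F]) (use assms(5) js(1) in auto)
  then show "realizable n (Suc d) (2 * N * s) (\<lambda>x. \<exists>j\<in>J. F j x)"
    by (rule realizable_mono) (use le in auto)
qed

lemma realizable_const: "realizable n 1 1 (\<lambda>x. b)"
proof (cases b)
  case True
  have "realizable n (Suc 0) (length [] * 0 + 1) (\<lambda>x. True)"
    by (rule realizable_gate_list[where g = AndGate and F = "\<lambda>_ _. True"]) auto
  then show ?thesis using True by simp
next
  case False
  have "realizable n (Suc 0) (length [] * 0 + 1) (\<lambda>x. False)"
    by (rule realizable_gate_list[where g = OrGate and F = "\<lambda>_ _. True"]) auto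
  then show ?thesis using False by simp
qed

lemma realizable_const': "1 \<le> d \<Longrightarrow> 1 \<le> s \<Longrightarrow> realizable n d s (\<lambda>x. b)"
  by (rule realizable_mono[OF realizable_const])

lemma realizable_conj:
  assumes "realizable n d s F" "realizable n d s G" "1 \<le> s"
  shows "realizable n (Suc d) (4 * s) (\<lambda>x. F x \<and> G x)"
    and "realizable n (Suc d) (4 * s) (\<lambda>x. F x \<or> G x)"
proof -
  have r: "realizable n d s (if j = 0 then F else G)" for j :: nat using assms by simp
  show "realizable n (Suc d) (4 * s) (\<lambda>x. F x \<and> G x)"
    using realizable_ball(1)[of "{0, 1 :: nat}" 2 s n d "\<lambda>j. if j = 0 then F else G"] r assms(3)
    by simp
  show "realizable n (Suc d) (4 * s) (\<lambda>x. F x \<or> G x)"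
    using realizable_ball(2)[of "{0, 1 :: nat}" 2 s n d "\<lambda>j. if j = 0 then F else G"] r assms(3)
    by simp
qed

text \<open>With the values of the variables fixed, a relational atom is a single input bit and all
  other atoms are constants. So depth and size depend on the formula alone.\<close>

lemma realizable_ev:
  "\<exists>d s. 1 \<le> d \<and> 1 \<le> s \<and> (\<forall>n u v \<beta>. realizable n d s (\<lambda>x. ev \<tau> u (\<lambda>i. i < length x \<and> x ! i) v \<beta> \<psi>))"
proof (induction \<psi>)
  case (Rel i xs)
  have "realizable n 1 1 (\<lambda>x. ev \<tau> u (\<lambda>i. i < length x \<and> x ! i) v \<beta> (Rel i xs))" for n u v \<beta>
  proof (cases "offset \<tau> u i + num u (map v xs) < n")
    case True
    show ?thesis
      by (rule realizable_cong[OF realizable_mono[OF realizable_Input[OF True]]]) (use True in auto)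
  next
    case False
    show ?thesis
      by (rule realizable_cong[OF realizable_const[of _ False]]) (use False in auto)
  qed
  then show ?case by blast
next
  case (Neg \<psi>)
  then obtain d s where "1 \<le> s" "\<And>n u v \<beta>. realizable n d s (\<lambda>x. ev \<tau> u (\<lambda>i. i < length x \<and> x ! i) v \<beta> \<psi>)"
    by blast
  then have "1 \<le> Suc d \<and> 1 \<le> 2 * s \<and> (\<forall>n u v \<beta>. realizable n (Suc d) (2 * s) (\<lambda>x. ev \<tau> u (\<lambda>i. i < length x \<and> x ! i) v \<beta> (Neg \<psi>)))"
    using realizable_not by simp
  then show ?case by (intro exI)
next
  case (Conj \<psi> \<chi>)
  then obtain d s d' s' where *: "1 \<le> s" "\<And>n u v \<beta>. realizable n d s (\<lambda>x. ev \<tau> u (\<lambda>i. i < length x \<and> x ! i) v \<beta> \<psi>)"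
     "\<And>n u v \<beta>. realizable n d' s' (\<lambda>x. ev \<tau> u (\<lambda>i. i < length x \<and> x ! i) v \<beta> \<chi>)" by blast
  have "realizable n (Suc (max d d')) (4 * max s s') (\<lambda>x. ev \<tau> u (\<lambda>i. i < length x \<and> x ! i) v \<beta> (Conj \<psi> \<chi>))" for n u v \<beta>
    unfolding ev.simps by (rule realizable_conj(1); (rule realizable_mono[OF *(2)] realizable_mono[OF *(3)])?) (use *(1) in auto)
  moreover have "1 \<le> Suc (max d d') \<and> 1 \<le> 4 * max s s'" using *(1) by simp
  ultimately show ?case by blast
next
  case (Disj \<psi> \<chi>)
  then obtain d s d' s' where *: "1 \<le> s" "\<And>n u v \<beta>. realizable n d s (\<lambda>x. ev \<tau> u (\<lambda>i. i < length x \<and> x ! i) v \<beta> \<psi>)"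
     "\<And>n u v \<beta>. realizable n d' s' (\<lambda>x. ev \<tau> u (\<lambda>i. i < length x \<and> x ! i) v \<beta> \<chi>)" by blast
  have "realizable n (Suc (max d d')) (4 * max s s') (\<lambda>x. ev \<tau> u (\<lambda>i. i < length x \<and> x ! i) v \<beta> (Disj \<psi> \<chi>))" for n u v \<beta>
    unfolding ev.simps by (rule realizable_conj(2); (rule realizable_mono[OF *(2)] realizable_mono[OF *(3)])?) (use *(1) in auto)
  moreover have "1 \<le> Suc (max d d') \<and> 1 \<le> 4 * max s s'" using *(1) by simp
  ultimately show ?case by blast
qed (rule exI[of _ 1], rule exI[of _ 1], simp only: ev.simps realizable_const order_refl simp_thms)+

section \<open>Threshold circuits from perfect hash families\<close>

lemma Suc_power_ge: "p ^ n + n * p ^ (n - 1) \<le> Suc p ^ n"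
proof (induction n)
  case (Suc n)
  have "p ^ Suc n + Suc n * p ^ n \<le> Suc p * (p ^ n + n * p ^ (n - 1))"
    by (cases n) (simp_all add: algebra_simps)
  also have "\<dots> \<le> Suc p * Suc p ^ n" by (rule mult_le_mono2[OF Suc.IH])
  finally show ?case by simp
qed simp

text \<open>The inequality (1 - 1/q)^q <= 1/2, from the first two terms of the binomial expansion of
  q^q = ((q - 1) + 1)^q.\<close>

lemma bernoulli_half: "0 < q \<Longrightarrow> 2 * (q - 1) ^ q \<le> (q :: nat) ^ q"
proof (cases q)
  case (Suc p)
  have "2 * p ^ Suc p \<le> p ^ Suc p + Suc p * p ^ (Suc p - 1)" by simp
  also have "\<dots> \<le> Suc p ^ Suc p" by (rule Suc_power_ge)
  finally show ?thesis unfolding Suc by simp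
qed simp

text \<open>A random map from u points to k colours is bijective on a given k-set with probability
  at least 1/k^k: one fixed bijection on the set extends in k^(u - k) ways. Double counting then
  yields a map that is good for at least this fraction of \<open>R\<close>.\<close>

lemma hash_average:
  fixes u :: nat
  assumes k: "0 < k" and R: "finite R" "\<And>Z. Z \<in> R \<Longrightarrow> Z \<subseteq> {..<u} \<and> card Z = k"
  shows "\<exists>h. card R \<le> k ^ k * card {Z \<in> R. h ` Z = {..<k}}"
proof (rule ccontr)
  assume "\<not> ?thesis"
  then have less: "k ^ k * card {Z \<in> R. h ` Z = {..<k}} < card R" for h
    by (simp add: not_le)
  let ?F = "{..<u} \<rightarrow>\<^sub>E {..<k}"
  have fin: "finite ?F" by (intro finite_PiE finite_lessThan)
  have cF: "card ?F = k ^ u" by (simp add: card_funcsetE)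
  then have "?F \<noteq> {}" using k by (metis card.empty power_not_zero less_irrefl)
  have ge: "k ^ (u - k) \<le> card {h \<in> ?F. h ` Z = {..<k}}" if Z: "Z \<in> R" for Z
  proof -
    have fZ: "finite Z" "Z \<subseteq> {..<u}" "card Z = k" using R(2)[OF Z] finite_subset by auto
    then obtain f where f: "bij_betw f Z {..<k}"
      using finite_same_card_bij[of Z "{..<k}"] by auto
    let ?g = "\<lambda>g z. if z \<in> Z then f z else g z"
    let ?F' = "({..<u} - Z) \<rightarrow>\<^sub>E {..<k}"
    have inj: "inj_on ?g ?F'"
    proof (rule inj_onI)
      fix g g' assume g: "g \<in> ?F'" "g' \<in> ?F'" and eq: "?g g = ?g g'"
      show "g = g'"
      proof (rule PiE_ext[OF g])
        fix z assume "z \<in> {..<u} - Z"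
        then show "g z = g' z" using fun_cong[OF eq, of z] by simp
      qed
    qed
    have "?g ` ?F' \<subseteq> {h \<in> ?F. h ` Z = {..<k}}"
    proof (rule image_subsetI)
      fix g assume g: "g \<in> ?F'"
      have "?g g ` Z = f ` Z" by auto
      moreover have "f ` Z = {..<k}" using f by (simp add: bij_betw_def)
      moreover have "?g g \<in> ?F"
      proof (rule PiE_I)
        show "?g g z \<in> {..<k}" if "z \<in> {..<u}" for z
          using that g \<open>f ` Z = {..<k}\<close> by (cases "z \<in> Z") auto
        show "?g g z = undefined" if z: "z \<notin> {..<u}" for z
        proof -
          have "z \<notin> Z" using z fZ(2) by blast
          then show ?thesis using PiE_arb[OF g, of z] z by simp
        qed
      qed
      ultimately show "?g g \<in> {h \<in> ?F. h ` Z = {..<k}}" by simp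
    qed
    then have "card ?F' \<le> card {h \<in> ?F. h ` Z = {..<k}}"
      by (rule card_inj_on_le[OF inj]) (simp add: fin)
    moreover have "card ?F' = k ^ (u - k)"
      using fZ by (simp add: card_funcsetE card_Diff_subset)
    ultimately show ?thesis by simp
  qed
  have "R \<noteq> {}" using less[of id] by auto
  then have ku: "k \<le> u" using R(2) card_mono[OF finite_lessThan, of _ u] by (metis all_not_in_conv card_lessThan)
  have "(\<Sum>h\<in>?F. k ^ k * card {Z \<in> R. h ` Z = {..<k}}) < (\<Sum>h\<in>?F. card R)"
    by (rule sum_strict_mono[OF fin \<open>?F \<noteq> {}\<close>]) (rule less)
  then have 1: "k ^ k * (\<Sum>h\<in>?F. card {Z \<in> R. h ` Z = {..<k}}) < k ^ u * card R"
    by (simp add: sum_distrib_left cF)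
  have 2: "(\<Sum>h\<in>?F. card {Z \<in> R. h ` Z = {..<k}}) = (\<Sum>Z\<in>R. card {h \<in> ?F. h ` Z = {..<k}})"
    using sum.swap_restrict[OF fin R(1), of "\<lambda>_ _. 1 :: nat" "\<lambda>h Z. h ` Z = {..<k}"] by simp
  have 3: "card R * k ^ (u - k) \<le> (\<Sum>Z\<in>R. card {h \<in> ?F. h ` Z = {..<k}})"
    using sum_mono[of R "\<lambda>_. k ^ (u - k)", OF ge] by simp
  have "k ^ k * (card R * k ^ (u - k)) < k ^ u * card R"
    by (rule le_less_trans[OF mult_le_mono2[OF 3] 1[unfolded 2]])
  moreover have "k ^ k * k ^ (u - k) = k ^ u" using ku by (simp flip: power_add)
  ultimately show False by (simp add: mult.commute mult.left_commute)
qed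

text \<open>Greedy choice: each new map handles at least the fraction 1/k^k of the sets still
  uncovered.\<close>

lemma hash_cover:
  fixes u :: nat
  assumes k: "0 < k" and R: "finite R" "\<And>Z. Z \<in> R \<Longrightarrow> Z \<subseteq> {..<u} \<and> card Z = k"
  shows "\<exists>H. finite H \<and> card H \<le> t \<and>
    (k ^ k) ^ t * card {Z \<in> R. \<forall>h\<in>H. h ` Z \<noteq> {..<k}} \<le> (k ^ k - 1) ^ t * card R"
proof (induction t)
  case 0
  show ?case by (intro exI[of _ "{}"]) simp
next
  case (Suc t)
  let ?q = "k ^ k"
  let ?U = "\<lambda>H. {Z \<in> R. \<forall>h\<in>H. h ` Z \<noteq> {..<k}}"
  obtain H where H: "finite H" "card H \<le> t" "?q ^ t * card (?U H) \<le> (?q - 1) ^ t * card R"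
    using Suc.IH by blast
  have fU: "finite (?U H)" using R(1) by simp
  obtain h where h: "card (?U H) \<le> ?q * card {Z \<in> ?U H. h ` Z = {..<k}}"
    using hash_average[OF k fU, of u] R(2) by auto
  let ?G = "{Z \<in> ?U H. h ` Z = {..<k}}"
  have eq: "?U (insert h H) = ?U H - ?G" by auto
  have sub: "?G \<subseteq> ?U H" by blast
  have "card (?U (insert h H)) = card (?U H) - card ?G"
    unfolding eq by (rule card_Diff_subset[OF finite_subset[OF sub fU] sub])
  then have "?q * card (?U (insert h H)) \<le> (?q - 1) * card (?U H)"
    using h by (simp add: diff_mult_distrib diff_mult_distrib2)
  then have "?q ^ t * (?q * card (?U (insert h H))) \<le> ?q ^ t * ((?q - 1) * card (?U H))"
    by (rule mult_le_mono2)
  also have "\<dots> = (?q - 1) * (?q ^ t * card (?U H))" by simp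
  also have "\<dots> \<le> (?q - 1) * ((?q - 1) ^ t * card R)" by (rule mult_le_mono2[OF H(3)])
  finally have "?q ^ Suc t * card (?U (insert h H)) \<le> (?q - 1) ^ Suc t * card R"
    by (simp add: mult.assoc mult.left_commute)
  moreover have "card (insert h H) \<le> Suc t" using H(1,2) by (simp add: card_insert_if)
  ultimately show ?case using H(1) by (intro exI[of _ "insert h H"]) simp
qed

text \<open>There are at most 2^u sets, and k^k * (u + 1) greedy rounds halve the uncovered part u +
  1 times, so less than one set remains.\<close>

lemma perfect_hash_family:
  "\<exists>H. finite H \<and> card H \<le> k ^ k * (u + 1) \<and> (\<forall>Z\<subseteq>{..<u}. card Z = k \<longrightarrow> (\<exists>h\<in>H. h ` Z = {..<k}))"
proof (cases "k = 0")
  case True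
  have "Z = {}" if "Z \<subseteq> {..<u}" "card Z = 0" for Z
    using that finite_subset[OF that(1)] by simp
  then show ?thesis using True by (intro exI[of _ "{id}"]) auto
next
  case False
  let ?q = "k ^ k" let ?t = "k ^ k * (u + 1)"
  let ?R = "{Z. Z \<subseteq> {..<u} \<and> card Z = k}"
  have sub: "?R \<subseteq> Pow {..<u}" by auto
  have fR: "finite ?R" by (rule finite_subset[OF sub]) simp
  have cR: "card ?R \<le> 2 ^ u" using card_mono[OF _ sub] by (simp add: card_Pow)
  obtain H where H: "finite H" "card H \<le> ?t"
    "?q ^ ?t * card {Z \<in> ?R. \<forall>h\<in>H. h ` Z \<noteq> {..<k}} \<le> (?q - 1) ^ ?t * card ?R"
    using hash_cover[OF _ fR, of k u ?t] False by auto
  let ?r = "card {Z \<in> ?R. \<forall>h\<in>H. h ` Z \<noteq> {..<k}}"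
  have "2 * (?q ^ ?t * ?r) \<le> 2 * ((?q - 1) ^ ?t * 2 ^ u)"
    using H(3) cR by (meson mult_le_mono2 order_trans)
  also have "\<dots> = (2 * (?q - 1) ^ ?q) ^ (u + 1)"
    by (simp add: power_mult_distrib power_mult power_add)
  also have "\<dots> \<le> (?q ^ ?q) ^ (u + 1)" by (rule power_mono[OF bernoulli_half]) (use False in auto)
  also have "\<dots> = ?q ^ ?t" by (simp only: power_mult)
  finally have "?q ^ ?t * (2 * ?r) \<le> ?q ^ ?t * 1" by simp
  moreover have "0 < ?q ^ ?t" using False by simp
  ultimately have "2 * ?r \<le> 1" by (rule mult_left_le_imp_le)
  then have "?r = 0" by linarith
  moreover have "finite {Z \<in> ?R. \<forall>h\<in>H. h ` Z \<noteq> {..<k}}" using fR by simp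
  ultimately have "{Z \<in> ?R. \<forall>h\<in>H. h ` Z \<noteq> {..<k}} = {}" by (simp only: card_0_eq)
  then have "\<forall>Z\<subseteq>{..<u}. card Z = k \<longrightarrow> (\<exists>h\<in>H. h ` Z = {..<k})" by blast
  then show ?thesis using H(1,2) by blast
qed

text \<open>At least k points satisfy b iff some map of the family gives each of k colours to such a
  point. This is an or of ands of ors, whence depth 3; the maps are fixed in the circuit.\<close>

lemma realizable_threshold:
  assumes b: "\<And>z. z < u \<Longrightarrow> realizable n d s (b z)" and s: "1 \<le> s"
  shows "realizable n (d + 3) (8 * (k ^ k * (u + 1)) * (k + 1) * (u + 1) * s) (\<lambda>x. k \<le> card {z. z < u \<and> b z x})"
proof -
  obtain H where H: "finite H" "card H \<le> k ^ k * (u + 1)"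
    "\<And>Z. Z \<subseteq> {..<u} \<Longrightarrow> card Z = k \<Longrightarrow> \<exists>h\<in>H. h ` Z = {..<k}"
    using perfect_hash_family[of k u] by metis
  have iff: "(\<exists>h\<in>H. \<forall>c\<in>{..<k}. \<exists>z\<in>{z. z < u \<and> h z = c}. b z x) \<longleftrightarrow> k \<le> card {z. z < u \<and> b z x}" for x
  proof
    assume "\<exists>h\<in>H. \<forall>c\<in>{..<k}. \<exists>z\<in>{z. z < u \<and> h z = c}. b z x"
    then obtain h where "\<forall>c\<in>{..<k}. \<exists>z\<in>{z. z < u \<and> h z = c}. b z x" by blast
    then have h: "\<exists>z. z < u \<and> h z = c \<and> b z x" if "c < k" for c using that by auto
    have "{..<k} \<subseteq> h ` {z. z < u \<and> b z x}"
    proof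
      fix c assume "c \<in> {..<k}"
      then obtain z where "z < u" "h z = c" "b z x" using h[of c] by auto
      then show "c \<in> h ` {z. z < u \<and> b z x}" by (intro image_eqI[of _ _ z]) simp_all
    qed
    then have "card {..<k} \<le> card (h ` {z. z < u \<and> b z x})" by (rule card_mono[rotated]) simp
    also have "\<dots> \<le> card {z. z < u \<and> b z x}" by (rule card_image_le) simp
    finally show "k \<le> card {z. z < u \<and> b z x}" by simp
  next
    assume "k \<le> card {z. z < u \<and> b z x}"
    then obtain Z where Z: "Z \<subseteq> {z. z < u \<and> b z x}" "card Z = k"
      using obtain_subset_with_card_n by metis
    then have "Z \<subseteq> {..<u}" by auto
    from H(3)[OF this Z(2)] obtain h where h: "h \<in> H" "h ` Z = {..<k}" by blast
    have "\<exists>z\<in>{z. z < u \<and> h z = c}. b z x" if "c \<in> {..<k}" for c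
    proof -
      have "c \<in> h ` Z" using that h(2) by simp
      then obtain z where "z \<in> Z" "h z = c" by blast
      then show ?thesis using Z(1) by blast
    qed
    then show "\<exists>h\<in>H. \<forall>c\<in>{..<k}. \<exists>z\<in>{z. z < u \<and> h z = c}. b z x" using h(1) by blast
  qed
  have 1: "realizable n (Suc d) (2 * (u + 1) * s) (\<lambda>x. \<exists>z\<in>{z. z < u \<and> h z = c}. b z x)" for h and c :: nat
  proof (rule realizable_ball(2))
    have "card {z. z < u \<and> h z = c} \<le> card {..<u}" by (rule card_mono) auto
    then show "card {z. z < u \<and> h z = c} \<le> u + 1" by simp
  qed (use b s in auto)
  have 2: "realizable n (Suc (Suc d)) (2 * (k + 1) * (2 * (u + 1) * s))
     (\<lambda>x. \<forall>c\<in>{..<k}. \<exists>z\<in>{z. z < u \<and> h z = c}. b z x)" for h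
    by (rule realizable_ball(1)) (use 1 s in auto)
  have 3: "realizable n (Suc (Suc (Suc d))) (2 * (k ^ k * (u + 1)) * (2 * (k + 1) * (2 * (u + 1) * s)))
     (\<lambda>x. \<exists>h\<in>H. \<forall>c\<in>{..<k}. \<exists>z\<in>{z. z < u \<and> h z = c}. b z x)"
  proof (rule realizable_ball(2)[OF H(1,2)])
    have "0 < k ^ k" by (cases k) auto
    then have "0 < k ^ k * (u + 1)" by (intro mult_pos_pos) auto
    then show "1 \<le> k ^ k * (u + 1)" by (simp only: Suc_le_eq One_nat_def)
    show "1 \<le> 2 * (k + 1) * (2 * (u + 1) * s)" using s by simp
  qed (rule 2)
  have e: "2 * a * (2 * b' * (2 * c * s)) = 8 * a * b' * c * s" for a b' c :: nat by simp
  show ?thesis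
    using realizable_cong[OF 3 iff] unfolding e by (rule realizable_mono) simp_all
qed

section \<open>Sentences with prefix e...ea\<close>

text \<open>Outside Y the elements violating Q are forced into C and those satisfying P are
  permitted. \<open>P w \<or> Q w\<close> makes the forced ones permitted, so every intermediate
  size is attained. \<open>card B <= k\<close> is listed separately because of the truncated
  subtraction.\<close>

lemma exists_weight_between:
  assumes U: "finite U" and Y: "Y \<subseteq> U" and B: "B \<subseteq> Y"
  shows "(\<exists>C\<subseteq>U. C \<inter> Y = B \<and> card C = k \<and> (\<forall>w\<in>U - Y. (w \<in> C \<longrightarrow> P w) \<and> (w \<notin> C \<longrightarrow> Q w))) \<longleftrightarrow>
    card B \<le> k \<and> (\<forall>w\<in>U - Y. P w \<or> Q w) \<and> card {w \<in> U - Y. \<not> Q w} \<le> k - card B \<and>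
    k - card B \<le> card {w \<in> U - Y. P w}" (is "?L \<longleftrightarrow> ?R")
proof
  assume ?L
  then obtain C where C: "C \<subseteq> U" "C \<inter> Y = B" "card C = k"
    "\<And>w. w \<in> U - Y \<Longrightarrow> (w \<in> C \<longrightarrow> P w) \<and> (w \<notin> C \<longrightarrow> Q w)" by blast
  have fin: "finite C" "finite Y" using C(1) Y U finite_subset by blast+
  have "card C = card (C \<inter> Y) + card (C - Y)"
    using fin(1) by (metis Int_Diff_disjoint Un_Diff_Int card_Un_disjoint finite_Diff finite_Int inf_commute sup_commute)
  then have "card B \<le> k" "card (C - Y) = k - card B" using C(2,3) by auto
  moreover have "card {w \<in> U - Y. \<not> Q w} \<le> card (C - Y)"
    by (rule card_mono) (use fin C(4) in auto)
  moreover have "card (C - Y) \<le> card {w \<in> U - Y. P w}"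
    by (rule card_mono) (use U C(1,4) in auto)
  ultimately show ?R using C(4) by auto
next
  assume R: ?R
  let ?A = "{w \<in> U - Y. \<not> Q w}" let ?D = "{w \<in> U - Y. P w}"
  have "?A \<subseteq> ?D" using R by blast
  moreover have "finite ?D" using U by simp
  ultimately obtain E where E: "?A \<subseteq> E" "E \<subseteq> ?D" "card E = k - card B"
    using exists_subset_between[of ?A "k - card B" ?D] R by blast
  have "finite B" "finite E" using U Y B E(2) finite_subset[of _ U] by blast+
  moreover have "B \<inter> E = {}" using B E(2) by blast
  ultimately have "card (B \<union> E) = k" using R E(3) by (simp add: card_Un_disjoint)
  moreover have "(B \<union> E) \<inter> Y = B" using B E(2) by blast
  moreover have "B \<union> E \<subseteq> U" using B Y E(2) by blast
  moreover have "(w \<in> B \<union> E \<longrightarrow> P w) \<and> (w \<notin> B \<union> E \<longrightarrow> Q w)" if "w \<in> U - Y" for w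
    using that B E(1,2) by blast
  ultimately show ?L by (intro exI[of _ "B \<union> E"]) blast
qed

lemma ex_less_mult: "0 < n \<Longrightarrow> (\<exists>a<n * (k::nat). P (a mod n) (a div n)) \<longleftrightarrow> (\<exists>u<n. \<exists>a<k. P u a)"
  using all_less_mult[of n k "\<lambda>u a. \<not> P u a"] by auto

lemma sat_foldr_Exists:
  assumes "0 < usize A"
  shows "sat A S v (foldr Exists ys \<chi>) \<longleftrightarrow> (\<exists>a < usize A ^ length ys. sat A S (asg (usize A) a 0 ys v) \<chi>)"
proof (induction ys arbitrary: v)
  case (Cons z ys)
  let ?n = "usize A"
  have "sat A S v (foldr Exists (z # ys) \<chi>) \<longleftrightarrow>
      (\<exists>u<?n. \<exists>a<?n ^ length ys. sat A S (asg ?n a 0 ys (v(z := u))) \<chi>)"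
    by (simp only: foldr.simps o_apply sat.simps Cons.IH universe_def Bex_def lessThan_iff)
  also have "\<dots> \<longleftrightarrow> (\<exists>a<?n * ?n ^ length ys. sat A S (asg ?n (a div ?n) 0 ys (v(z := a mod ?n))) \<chi>)"
    using ex_less_mult[OF assms, of _ "\<lambda>u a. sat A S (asg ?n a 0 ys (v(z := u))) \<chi>"] by simp
  finally show ?case by (simp add: asg_Suc) (simp add: digit_def)
qed simp

lemma prenex_exists_forall:
  "prenex (replicate m Qe @ [Qa]) \<phi> \<Longrightarrow>
     \<exists>ys z \<psi>. \<phi> = foldr Exists ys (Forall z \<psi>) \<and> length ys = m \<and> quantifier_free \<psi>"
proof (induction m arbitrary: \<phi>)
  case 0
  then have "prenex [Qa] \<phi>" by simp
  then obtain z \<psi> where "prenex [] \<psi>" "\<phi> = Forall z \<psi>" by (auto elim!: prenex_Cons)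
  then show ?case by (intro exI[of _ "[]"] exI[of _ z] exI[of _ \<psi>]) simp
next
  case (Suc m)
  then have "prenex (Qe # replicate m Qe @ [Qa]) \<phi>" by simp
  then obtain y \<phi>0 where y: "prenex (replicate m Qe @ [Qa]) \<phi>0" "\<phi> = Exists y \<phi>0"
    by (auto elim!: prenex_Cons)
  obtain ys z \<psi> where "\<phi>0 = foldr Exists ys (Forall z \<psi>)" "length ys = m" "quantifier_free \<psi>"
    using Suc.IH[OF y(1)] by blast
  then show ?case using y(2) by (intro exI[of _ "y # ys"] exI[of _ z] exI[of _ \<psi>]) simp
qed

lemma wf_foldr_Exists: "wf_fm \<tau> s (foldr Exists ys \<psi>) = wf_fm \<tau> s \<psi>"
  by (induction ys) auto

lemma asg_notin: "y \<notin> set ys \<Longrightarrow> asg n a i ys v y = v y"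
  by (induction ys arbitrary: i v) auto

text \<open>The elements whose membership in \<open>X\<close> is guessed: the values of the existential variables, and \<open>0\<close>, the
  value of all variables that are not quantified.\<close>

definition touched :: "nat \<Rightarrow> nat \<Rightarrow> nat list \<Rightarrow> nat set" where
  "touched u a ys = insert 0 (asg u a 0 ys (\<lambda>_. 0) ` set ys)"

lemma asg_touched: "asg u a 0 ys (\<lambda>_. 0) y \<in> touched u a ys"
  unfolding touched_def by (cases "y \<in> set ys") (auto simp: asg_notin)

lemma touched_less: "0 < u \<Longrightarrow> touched u a ys \<subseteq> {..<u}"
  unfolding touched_def using asg_less[of u "\<lambda>_. 0" a 0 ys] by auto

lemma finite_touched: "finite (touched u a ys)"
  by (simp add: touched_def)

lemma card_touched: "card (touched u a ys) \<le> length ys + 1"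
proof -
  have "card (asg u a 0 ys (\<lambda>_. 0) ` set ys) \<le> length ys"
    using card_image_le[OF finite_set, of "asg u a 0 ys (\<lambda>_. 0)" ys] card_length[of ys] by linarith
  then show ?thesis unfolding touched_def by (simp add: card_insert_if)
qed

text \<open>Atoms of X are evaluated at touched elements and at w only, so a set B with the right
  trace on these replaces X.\<close>

definition matrix_holds ::
    "vocabulary \<Rightarrow> nat \<Rightarrow> nat list \<Rightarrow> nat \<Rightarrow> fm \<Rightarrow> nat \<Rightarrow> nat set \<Rightarrow> nat \<Rightarrow> bool list \<Rightarrow> bool" where
  "matrix_holds \<tau> u ys z \<psi> a B w x \<longleftrightarrow> ev \<tau> u (\<lambda>i. i < length x \<and> x ! i) ((asg u a 0 ys (\<lambda>_. 0))(z := w))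
     (\<lambda>xs. map ((asg u a 0 ys (\<lambda>_. 0))(z := w)) xs \<in> (\<lambda>c. [c]) ` B) \<psi>"

text \<open>The upper bound on the forced elements is written as a negated threshold, so that only
  thresholds up to k + 1 occur. Each conjunct is in a form that circuits of constant depth
  evaluate.\<close>

definition weight_condition where
  "weight_condition \<tau> u ys z \<psi> k a B x \<longleftrightarrow> card B \<le> k \<and>
     ((\<forall>w\<in>touched u a ys. matrix_holds \<tau> u ys z \<psi> a B w x) \<and>
     ((\<forall>w\<in>{..<u} - touched u a ys. matrix_holds \<tau> u ys z \<psi> a (insert w B) w x \<or> matrix_holds \<tau> u ys z \<psi> a B w x) \<and>
     ((k - card B \<le> card {w. w < u \<and> w \<notin> touched u a ys \<and> matrix_holds \<tau> u ys z \<psi> a (insert w B) w x}) \<and>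
      (\<not> k - card B + 1 \<le> card {w. w < u \<and> w \<notin> touched u a ys \<and> \<not> matrix_holds \<tau> u ys z \<psi> a B w x}))))"

text \<open>Once the existential values and the trace of X on them are fixed, the matrix at w
  depends on X only through the membership of w. This needs a single universal variable behind all
  existential ones; then the untouched elements are independent of each other and only their number
  matters.\<close>

lemma models_iff_weight_condition:
  assumes x: "is_code \<tau> x" and qf: "quantifier_free \<psi>" and wf: "wf_fm \<tau> 1 \<psi>"
  shows "(\<exists>C\<subseteq>{..<lead x}. card C = k \<and> models (decode \<tau> x) ((\<lambda>c. [c]) ` C) (foldr Exists ys (Forall z \<psi>))) \<longleftrightarrow>
    (\<exists>a\<in>{..<lead x ^ length ys}. \<exists>B\<in>Pow (touched (lead x) a ys). weight_condition \<tau> (lead x) ys z \<psi> k a B x)"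
proof -
  let ?u = "lead x" let ?A = "decode \<tau> x"
  have u: "0 < ?u" using x by (simp add: is_code_def)
  have us: "usize ?A = ?u" by (simp add: decode_def)
  have sat: "sat ?A ((\<lambda>c. [c]) ` C) ((asg ?u a 0 ys (\<lambda>_. 0))(z := w)) \<psi> = matrix_holds \<tau> ?u ys z \<psi> a B w x"
    if w: "w < ?u" and B: "\<And>y. y \<in> insert w (touched ?u a ys) \<Longrightarrow> y \<in> C \<longleftrightarrow> y \<in> B" for C a w B
    unfolding matrix_holds_def
  proof (rule sat_iff_ev[OF x _ _ qf wf])
    show "((asg ?u a 0 ys (\<lambda>_. 0))(z := w)) y < ?u" for y
      using w asg_less[OF u, of "\<lambda>_. 0"] u by simp
    fix xs :: "nat list" assume "length xs = 1"
    then obtain y where xs: "xs = [y]" by (cases xs) auto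
    have "((asg ?u a 0 ys (\<lambda>_. 0))(z := w)) y \<in> insert w (touched ?u a ys)"
      using asg_touched by simp
    from B[OF this] show "map ((asg ?u a 0 ys (\<lambda>_. 0))(z := w)) xs \<in> (\<lambda>c. [c]) ` B \<longleftrightarrow>
        map ((asg ?u a 0 ys (\<lambda>_. 0))(z := w)) xs \<in> (\<lambda>c. [c]) ` C"
      unfolding xs list.map singleton_in_image by (rule sym)
  qed
  have m: "models ?A ((\<lambda>c. [c]) ` C) (foldr Exists ys (Forall z \<psi>)) \<longleftrightarrow> (\<exists>a<?u ^ length ys. \<forall>w<?u.
      sat ?A ((\<lambda>c. [c]) ` C) ((asg ?u a 0 ys (\<lambda>_. 0))(z := w)) \<psi>)" for C
    unfolding models_def using sat_foldr_Exists[of ?A "(\<lambda>c. [c]) ` C" "\<lambda>_. 0" ys "Forall z \<psi>"] u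
    by (simp add: us universe_def Ball_def)
  have one: "(\<exists>C\<subseteq>{..<?u}. C \<inter> touched ?u a ys = B \<and> card C = k \<and> (\<forall>w<?u.
      sat ?A ((\<lambda>c. [c]) ` C) ((asg ?u a 0 ys (\<lambda>_. 0))(z := w)) \<psi>)) \<longleftrightarrow> weight_condition \<tau> ?u ys z \<psi> k a B x"
    if B: "B \<subseteq> touched ?u a ys" for a B
  proof -
    let ?Y = "touched ?u a ys" let ?H = "matrix_holds \<tau> ?u ys z \<psi> a"
    have Y: "?Y \<subseteq> {..<?u}" by (rule touched_less[OF u])
    have all: "(\<forall>w<?u. sat ?A ((\<lambda>c. [c]) ` C) ((asg ?u a 0 ys (\<lambda>_. 0))(z := w)) \<psi>) \<longleftrightarrow>
      (\<forall>w\<in>?Y. ?H B w x) \<and> (\<forall>w\<in>{..<?u} - ?Y. (w \<in> C \<longrightarrow> ?H (insert w B) w x) \<and> (w \<notin> C \<longrightarrow> ?H B w x))"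
      if C: "C \<inter> ?Y = B" for C
    proof -
      have 1: "sat ?A ((\<lambda>c. [c]) ` C) ((asg ?u a 0 ys (\<lambda>_. 0))(z := w)) \<psi> = ?H B w x" if "w < ?u" "w \<in> ?Y \<or> w \<notin> C" for w
        by (rule sat[OF that(1)]) (use C that(2) B in blast)
      have 2: "sat ?A ((\<lambda>c. [c]) ` C) ((asg ?u a 0 ys (\<lambda>_. 0))(z := w)) \<psi> = ?H (insert w B) w x" if "w < ?u" "w \<notin> ?Y" "w \<in> C" for w
        by (rule sat[OF that(1)]) (use C that(2,3) B in blast)
      have Yu: "w < ?u" if "w \<in> ?Y" for w using Y that by auto
      show ?thesis
      proof
        assume a: "\<forall>w<?u. sat ?A ((\<lambda>c. [c]) ` C) ((asg ?u a 0 ys (\<lambda>_. 0))(z := w)) \<psi>"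
        show "(\<forall>w\<in>?Y. ?H B w x) \<and> (\<forall>w\<in>{..<?u} - ?Y. (w \<in> C \<longrightarrow> ?H (insert w B) w x) \<and> (w \<notin> C \<longrightarrow> ?H B w x))"
        proof (intro conjI ballI impI)
          fix w assume w: "w \<in> ?Y"
          show "?H B w x" using a[rule_format, OF Yu[OF w]] 1[OF Yu[OF w] disjI1[OF w]] by (simp only:)
        next
          fix w assume w: "w \<in> {..<?u} - ?Y" "w \<in> C"
          then have w': "w < ?u" "w \<notin> ?Y" by auto
          show "?H (insert w B) w x" using a[rule_format, OF w'(1)] 2[OF w' w(2)] by (simp only:)
        next
          fix w assume w: "w \<in> {..<?u} - ?Y" "w \<notin> C"
          then have w': "w < ?u" "w \<notin> ?Y" by auto
          show "?H B w x" using a[rule_format, OF w'(1)] 1[OF w'(1) disjI2[OF w(2)]] by (simp only:)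
        qed
      next
        assume a: "(\<forall>w\<in>?Y. ?H B w x) \<and> (\<forall>w\<in>{..<?u} - ?Y. (w \<in> C \<longrightarrow> ?H (insert w B) w x) \<and> (w \<notin> C \<longrightarrow> ?H B w x))"
        show "\<forall>w<?u. sat ?A ((\<lambda>c. [c]) ` C) ((asg ?u a 0 ys (\<lambda>_. 0))(z := w)) \<psi>"
        proof (intro allI impI)
          fix w assume w: "w < ?u"
          consider "w \<in> ?Y" | "w \<notin> ?Y" "w \<in> C" | "w \<notin> ?Y" "w \<notin> C" by blast
          then show "sat ?A ((\<lambda>c. [c]) ` C) ((asg ?u a 0 ys (\<lambda>_. 0))(z := w)) \<psi>"
          proof cases
            case c: 1
            then show ?thesis unfolding 1[OF w disjI1[OF c]] using a by blast
          next
            case c: 2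
            then show ?thesis unfolding 2[OF w c] using a w by simp
          next
            case c: 3
            then show ?thesis unfolding 1[OF w disjI2[OF c(2)]] using a w by simp
          qed
        qed
      qed
    qed
    have "(\<exists>C\<subseteq>{..<?u}. C \<inter> ?Y = B \<and> card C = k \<and> (\<forall>w<?u.
      sat ?A ((\<lambda>c. [c]) ` C) ((asg ?u a 0 ys (\<lambda>_. 0))(z := w)) \<psi>)) \<longleftrightarrow>
      (\<exists>C\<subseteq>{..<?u}. C \<inter> ?Y = B \<and> card C = k \<and>
        ((\<forall>w\<in>?Y. ?H B w x) \<and> (\<forall>w\<in>{..<?u} - ?Y. (w \<in> C \<longrightarrow> ?H (insert w B) w x) \<and> (w \<notin> C \<longrightarrow> ?H B w x))))"
      by (intro ex_cong1 conj_cong refl all) 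
    also have "\<dots> \<longleftrightarrow> (\<forall>w\<in>?Y. ?H B w x) \<and> (\<exists>C\<subseteq>{..<?u}. C \<inter> ?Y = B \<and> card C = k \<and>
        (\<forall>w\<in>{..<?u} - ?Y. (w \<in> C \<longrightarrow> ?H (insert w B) w x) \<and> (w \<notin> C \<longrightarrow> ?H B w x)))"
      by (simp only: ex_simps[symmetric] conj_ac)
    also have "\<dots> \<longleftrightarrow> weight_condition \<tau> ?u ys z \<psi> k a B x"
    proof -
      have s: "{w \<in> {..<?u} - ?Y. \<not> ?H B w x} = {w. w < ?u \<and> w \<notin> ?Y \<and> \<not> ?H B w x}"
        "{w \<in> {..<?u} - ?Y. ?H (insert w B) w x} = {w. w < ?u \<and> w \<notin> ?Y \<and> ?H (insert w B) w x}" by auto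
      have "\<not> k - card B + 1 \<le> c \<longleftrightarrow> c \<le> k - card B" for c by linarith
      then show ?thesis
        unfolding exists_weight_between[OF finite_lessThan Y B] weight_condition_def s by (simp only: conj_ac)
    qed
    finally show ?thesis .
  qed
  have "(\<exists>C\<subseteq>{..<?u}. card C = k \<and> models ?A ((\<lambda>c. [c]) ` C) (foldr Exists ys (Forall z \<psi>))) \<longleftrightarrow>
    (\<exists>a\<in>{..<?u ^ length ys}. \<exists>B\<in>Pow (touched ?u a ys). \<exists>C\<subseteq>{..<?u}. C \<inter> touched ?u a ys = B \<and> card C = k \<and>
      (\<forall>w<?u. sat ?A ((\<lambda>c. [c]) ` C) ((asg ?u a 0 ys (\<lambda>_. 0))(z := w)) \<psi>))" (is "?L \<longleftrightarrow> ?R")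
  proof
    assume ?L
    then obtain C a where C: "C \<subseteq> {..<?u}" "card C = k" "a < ?u ^ length ys"
      "\<forall>w<?u. sat ?A ((\<lambda>c. [c]) ` C) ((asg ?u a 0 ys (\<lambda>_. 0))(z := w)) \<psi>" unfolding m by (elim exE conjE)
    then show ?R
      by (intro bexI[of _ a] bexI[of _ "C \<inter> touched ?u a ys"] exI[of _ C] conjI refl) auto
  next
    assume ?R
    then obtain a C where "a < ?u ^ length ys" "C \<subseteq> {..<?u}" "card C = k"
      "\<forall>w<?u. sat ?A ((\<lambda>c. [c]) ` C) ((asg ?u a 0 ys (\<lambda>_. 0))(z := w)) \<psi>" by (elim bexE exE conjE) simp
    then show ?L unfolding m by (intro exI[of _ C] conjI exI[of _ a])
  qed
  also have "\<dots> \<longleftrightarrow> (\<exists>a\<in>{..<?u ^ length ys}. \<exists>B\<in>Pow (touched ?u a ys). weight_condition \<tau> ?u ys z \<psi> k a B x)"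
    by (intro bex_cong refl one) simp
  finally show ?thesis .
qed

section \<open>Size and depth of the circuits for item (1)\<close>

lemma threshold_bound_mono:
  assumes "j \<le> k + 1" "s \<le> 2 * s'"
  shows "8 * (j ^ j * (u + 1)) * (j + 1) * (u + 1) * s \<le> 16 * ((k + 1) ^ (k + 1) * (u + 1)) * (k + 2) * (u + 1) * (s' :: nat)"
proof -
  have "j ^ j \<le> (k + 1) ^ j" using assms(1) by (intro power_mono) auto
  also have "\<dots> \<le> (k + 1) ^ (k + 1)" using assms(1) by (intro power_increasing) auto
  finally have "8 * (j ^ j * (u + 1)) * (j + 1) * (u + 1) * s \<le> 8 * ((k + 1) ^ (k + 1) * (u + 1)) * (k + 2) * (u + 1) * (2 * s')"
    using assms by (intro mult_le_mono le_refl) auto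
  moreover have "8 * a * b * c * (2 * s') = 16 * a * b * c * s'" for a b c :: nat by simp
  ultimately show ?thesis by (simp only:)
qed

text \<open>The negated threshold on negated inputs has depth d + 5, and \<open>?S\<close> bounds
  both threshold circuits. Four nested conjunctions add 4 to the depth and the factor 4^4 = 256 to
  the size.\<close>

lemma realizable_weight_condition:
  assumes ev: "1 \<le> d" "1 \<le> s" "\<And>u v \<beta>. realizable n d s (\<lambda>x. ev \<tau> u (\<lambda>i. i < length x \<and> x ! i) v \<beta> \<psi>)"
    and u: "0 < u"
  shows "realizable n (d + 9) (256 * (32 * ((k + 1) ^ (k + 1) * (u + 1)) * (k + 2) * (u + 1) * s))
     (weight_condition \<tau> u ys z \<psi> k a B)"
proof -
  let ?Y = "touched u a ys" let ?H = "matrix_holds \<tau> u ys z \<psi> a"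
  let ?S = "32 * ((k + 1) ^ (k + 1) * (u + 1)) * (k + 2) * (u + 1) * s"
  have H: "realizable n d s (?H B' w)" for B' w
    unfolding matrix_holds_def by (rule ev(3))
  have pos: "1 \<le> (k + 1) ^ (k + 1)" by (rule one_le_power) simp
  have small: "8 * (u + 1) * s \<le> ?S"
  proof -
    have "8 * (1 * (u + 1)) * 1 * 1 * s \<le> ?S" using pos by (intro mult_le_mono) auto
    then show ?thesis by simp
  qed
  have S1: "1 \<le> ?S"
  proof -
    have "1 * 1 \<le> 8 * (u + 1) * s" using ev(2) by (intro mult_le_mono) auto
    then show ?thesis using small by linarith
  qed
  have cY: "card ?Y \<le> u + 1" using card_mono[OF finite_lessThan touched_less[OF u]] by (simp add: le_SucI)
  have cD: "card ({..<u} - ?Y) \<le> u + 1"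
    using card_mono[of "{..<u}" "{..<u} - ?Y"] by (simp add: le_SucI)
  have 0: "realizable n (d + 8) (64 * ?S) (\<lambda>x. card B \<le> k)"
    by (rule realizable_const') (use S1 in auto)
  have 1: "realizable n (d + 7) (16 * ?S) (\<lambda>x. \<forall>w\<in>?Y. ?H B w x)"
  proof (rule realizable_mono[OF realizable_ball(1)[OF finite_touched cY _ ev(2) H]])
    show "2 * (u + 1) * s \<le> 16 * ?S" using small by linarith
  qed simp_all
  have 2: "realizable n (d + 6) (4 * ?S) (\<lambda>x. \<forall>w\<in>{..<u} - ?Y. ?H (insert w B) w x \<or> ?H B w x)"
  proof (rule realizable_mono)
    show "realizable n (Suc (Suc d)) (2 * (u + 1) * (4 * s)) (\<lambda>x. \<forall>w\<in>{..<u} - ?Y. ?H (insert w B) w x \<or> ?H B w x)"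
      by (rule realizable_ball(1)[OF _ cD]) (use ev(2) in \<open>auto intro!: realizable_conj(2) H\<close>)
    show "2 * (u + 1) * (4 * s) \<le> 4 * ?S" using small by linarith
  qed simp
  have 3: "realizable n (d + 5) ?S (\<lambda>x. k - card B \<le> card {w. w < u \<and> w \<notin> ?Y \<and> ?H (insert w B) w x})"
  proof (rule realizable_mono[OF realizable_threshold])
    show "realizable n d s (\<lambda>x. w \<notin> ?Y \<and> ?H (insert w B) w x)" for w
      by (cases "w \<in> ?Y") (use H ev realizable_const'[OF ev(1,2)] in auto)
    show "8 * ((k - card B) ^ (k - card B) * (u + 1)) * (k - card B + 1) * (u + 1) * s \<le> ?S"
      using threshold_bound_mono[of "k - card B" k s s u] by linarith
  qed (use ev in auto)
  have 4: "realizable n (d + 5) ?S (\<lambda>x. \<not> k - card B + 1 \<le> card {w. w < u \<and> w \<notin> ?Y \<and> \<not> ?H B w x})"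
  proof (rule realizable_mono[OF realizable_not[OF realizable_threshold]])
    show "realizable n (Suc d) (2 * s) (\<lambda>x. w \<notin> ?Y \<and> \<not> ?H B w x)" for w
      by (cases "w \<in> ?Y") (use realizable_not[OF H ev(2)] ev realizable_const'[of "Suc d" "2 * s"] in auto)
    let ?j = "k - card B + 1"
    show "2 * (8 * (?j ^ ?j * (u + 1)) * (?j + 1) * (u + 1) * (2 * s)) \<le> ?S"
      using threshold_bound_mono[of ?j k "2 * s" s u] by linarith
    have "0 < ?j ^ ?j" by simp
    then have "0 < 8 * (?j ^ ?j * (u + 1)) * (?j + 1) * (u + 1) * (2 * s)"
      using ev(2) by (intro mult_pos_pos) auto
    then show "1 \<le> 8 * (?j ^ ?j * (u + 1)) * (?j + 1) * (u + 1) * (2 * s)" by (simp only: Suc_le_eq One_nat_def)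
  qed (use ev in auto)
  note 34 = realizable_conj(1)[OF 3 4 S1]
  have "realizable n (d + 6) (4 * ?S) (\<lambda>x. (k - card B \<le> card {w. w < u \<and> w \<notin> ?Y \<and> ?H (insert w B) w x}) \<and>
     (\<not> k - card B + 1 \<le> card {w. w < u \<and> w \<notin> ?Y \<and> \<not> ?H B w x}))"
    by (rule realizable_mono[OF 34]) auto
  note 234 = realizable_conj(1)[OF 2 this]
  have "realizable n (d + 7) (16 * ?S) (\<lambda>x. (\<forall>w\<in>{..<u} - ?Y. ?H (insert w B) w x \<or> ?H B w x) \<and>
    ((k - card B \<le> card {w. w < u \<and> w \<notin> ?Y \<and> ?H (insert w B) w x}) \<and>
     (\<not> k - card B + 1 \<le> card {w. w < u \<and> w \<notin> ?Y \<and> \<not> ?H B w x})))"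
    by (rule realizable_mono[OF 234]) (use S1 in auto)
  note 1234 = realizable_conj(1)[OF 1 this]
  have "realizable n (d + 8) (64 * ?S) (\<lambda>x. (\<forall>w\<in>?Y. ?H B w x) \<and>
    ((\<forall>w\<in>{..<u} - ?Y. ?H (insert w B) w x \<or> ?H B w x) \<and>
    ((k - card B \<le> card {w. w < u \<and> w \<notin> ?Y \<and> ?H (insert w B) w x}) \<and>
     (\<not> k - card B + 1 \<le> card {w. w < u \<and> w \<notin> ?Y \<and> \<not> ?H B w x}))))"
    by (rule realizable_mono[OF 1234]) (use S1 in auto)
  note all = realizable_conj(1)[OF 0 this]
  have "realizable n (Suc (d + 8)) (4 * (64 * ?S)) (\<lambda>x. weight_condition \<tau> u ys z \<psi> k a B x)"
    unfolding weight_condition_def by (rule all) (use S1 in linarith)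
  then show ?thesis by (rule realizable_mono) auto
qed

lemma para_AC0_I:
  assumes f: "computable f" and r: "\<And>n k. realizable n d (f k * (n + 1) ^ c) (\<lambda>x. (x, k) \<in> Q)"
  shows "Q \<in> para_AC0"
proof -
  have "\<exists>C. is_circuit n C \<and> depth C \<le> d \<and> length C \<le> f k * (n + 1) ^ c \<and>
     (\<forall>x. length x = n \<longrightarrow> ((x, k) \<in> Q \<longleftrightarrow> accepts C x))" for n k
  proof -
    have "wf_gates n []" by (simp add: wf_gates_def)
    from realizableD[OF r this, of k] obtain C where C: "C \<noteq> []" "length C \<le> f k * (n + 1) ^ c"
      "extension n d [] C" and C4: "\<forall>x. length x = n \<longrightarrow> vals x ([] @ C) ! (length ([] :: circuit) + length C - 1) = ((x, k) \<in> Q)"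
      by (elim exE conjE) (rule that)
    have "is_circuit n C" using C(1,3) by (simp add: is_circuit_def extension_def wf_gates_def)
    moreover have "depth C \<le> d"
    proof -
      have dp: "depth C = Max (set (depths C))" by (simp add: depth_def depths_def)
      have "set (depths C) \<noteq> {}" using C(1) length_depths[of C] by (metis length_0_conv set_empty)
      moreover have "a \<le> d" if "a \<in> set (depths C)" for a
        using that C(3) by (auto simp: in_set_conv_nth extension_def)
      ultimately show ?thesis unfolding dp by (intro Max.boundedI) auto
    qed
    moreover have "(x, k) \<in> Q \<longleftrightarrow> accepts C x" if "length x = n" for x
    proof -
      have "accepts C x = last (vals x C)" by (simp add: accepts_def vals_def)
      also have "\<dots> = vals x C ! (length C - 1)"
        using C(1) length_vals[of x C] by (metis last_conv_nth length_0_conv)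
      finally show ?thesis using C4 that by simp
    qed
    ultimately show ?thesis using C(2) by blast
  qed
  then obtain C where C: "\<And>n k. is_circuit n (C n k) \<and> depth (C n k) \<le> d \<and> length (C n k) \<le> f k * (n + 1) ^ c \<and>
     (\<forall>x. length x = n \<longrightarrow> ((x, k) \<in> Q \<longleftrightarrow> accepts (C n k) x))" by metis
  show ?thesis unfolding para_AC0_def
    by (intro CollectI exI[of _ C] exI[of _ f] exI[of _ c] exI[of _ d] conjI f allI) (use C in simp_all)
qed

text \<open>The length of a code determines the size of the universe, so the circuit for a given
  length is built for one fixed u.\<close>

lemma offset_strict_mono: "u < u' \<Longrightarrow> offset \<tau> u i < offset \<tau> u' i"
proof -
  assume u: "u < u'"
  then have "(\<Sum>l<i. u ^ (\<tau> ! l)) \<le> (\<Sum>l<i. u' ^ (\<tau> ! l))" by (intro sum_mono power_mono) auto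
  then show ?thesis using u by (simp add: offset_def)
qed

lemma lead_eq_iff: "u < length x \<Longrightarrow> lead x = u \<longleftrightarrow> (\<forall>i\<in>{..<u}. x ! i) \<and> \<not> x ! u"
proof
  assume u: "u < length x" and l: "lead x = u"
  have "x ! i" if "i < u" for i
  proof -
    have i: "i < length (takeWhile id x)" using that l by (simp add: lead_def)
    from nth_mem[OF i] have "takeWhile id x ! i" by (auto dest: set_takeWhileD)
    then show ?thesis using takeWhile_nth[OF i] by simp
  qed
  moreover have "\<not> x ! u" using u l nth_length_takeWhile[of id x] by (simp add: lead_def)
  ultimately show "(\<forall>i\<in>{..<u}. x ! i) \<and> \<not> x ! u" by simp
next
  assume u: "u < length x" and a: "(\<forall>i\<in>{..<u}. x ! i) \<and> \<not> x ! u"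
  have "takeWhile id x = take u x"
    by (rule takeWhile_eq_take_P_nth) (use u a in auto)
  then show "lead x = u" using u by (simp add: lead_def)
qed

text \<open>\<open>R\<close> is a circuit test for the restriction P on the decoded structure. The
  three classes differ only in P: trivial, symmetric, or symmetric and loopless.\<close>

theorem p_models_para_AC0:
  assumes \<phi>: "\<phi> \<in> prenex_fms \<tau> 1 (replicate m Qe @ [Qa])"
    and R: "\<And>n u. 0 < u \<Longrightarrow> n = offset \<tau> u (length \<tau>) \<Longrightarrow> realizable n dp (sp * (n + 1) ^ cp) (R u)"
    and P: "\<And>x. is_code \<tau> x \<Longrightarrow> R (lead x) x = P (decode \<tau> x)"
  shows "encode_problem \<tau> {(A, k) \<in> p_models (=) \<tau> \<phi>. P A} \<in> para_AC0"
proof -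
  let ?Q = "encode_problem \<tau> {(A, k) \<in> p_models (=) \<tau> \<phi>. P A}"
  obtain ys z \<psi> where \<psi>: "\<phi> = foldr Exists ys (Forall z \<psi>)" "length ys = m" "quantifier_free \<psi>"
    using prenex_exists_forall[of m \<phi>] \<phi> by (auto simp: prenex_fms_def)
  have "wf_fm \<tau> 1 \<phi>" using \<phi> by (simp add: prenex_fms_def)
  then have wf: "wf_fm \<tau> 1 \<psi>" by (simp add: \<psi>(1) wf_foldr_Exists)
  obtain d s where ev: "1 \<le> d" "1 \<le> s" and ev': "\<forall>n u v \<beta>. realizable n d s (\<lambda>x. ev \<tau> u (\<lambda>i. i < length x \<and> x ! i) v \<beta> \<psi>)"
    using realizable_ev[of \<tau> \<psi>] by (elim exE conjE) (rule that)
  \<comment> \<open>All growth in k stems from the hash families and sits in \<open>?g\<close>.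
    \<open>?K1\<close> collects the constants of the disjunctions over assignments and traces, 8
    pays for the test of \<open>lead\<close>, and \<open>sp\<close> for \<open>R\<close>. The
    exponent m + 2 comes from u ^ m assignments and two factors u + 1 in the threshold
    circuits.\<close>
  let ?g = "\<lambda>k. (k + 1) ^ (k + 1) * (k + 2)"
  let ?K1 = "2 * (2 * 2 ^ (m + 1) * (256 * (32 * s)))"
  let ?K = "?K1 + 8 + sp"
  let ?c = "m + 2 + cp"
  let ?Z = "\<lambda>k n. ?K * ?g k * (n + 1) ^ ?c"
  have Zge: "K' * (if b then ?g k else 1) * (n + 1) ^ c' \<le> ?Z k n" if "K' \<le> ?K" "c' \<le> ?c" for K' c' k n b
  proof -
    have "1 * 1 \<le> ?g k" by (rule mult_le_mono[OF one_le_power]) auto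
    then show ?thesis using that by (intro mult_le_mono power_increasing) auto
  qed
  show ?thesis
  proof (rule para_AC0_I)
    show "computable (\<lambda>k. 16 * (?K * ?g k))"
      by (rule computable_cf) (intro cf_add cf_mult cf_power cf_var cf_const)
    fix n k
    have Z1: "1 \<le> ?Z k n" using Zge[of 1 0 False k n] by simp
    show "realizable n (d + dp + 20) (16 * (?K * ?g k) * (n + 1) ^ ?c) (\<lambda>x. (x, k) \<in> ?Q)"
    proof (cases "\<exists>u>0. n = offset \<tau> u (length \<tau>)")
      \<comment> \<open>No code has this length, so the constant circuit false is correct.\<close>
      case False
      have "(x, k) \<notin> ?Q" if "length x = n" for x
      proof -
        have "\<not> is_code \<tau> x" using False that unfolding is_code_def by metis
        moreover have "(x, k) \<in> ?Q \<longrightarrow> is_code \<tau> x"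
          using encode_problem_iff[of "{(A, k) \<in> p_models (=) \<tau> \<phi>. P A}" \<tau> x k]
          by (auto simp: p_models_def)
        ultimately show ?thesis by blast
      qed
      then show ?thesis
        by (intro realizable_cong[OF realizable_const'[where b = False]]) (use Z1 in auto)
    next
      case True
      then obtain u where u: "0 < u" "n = offset \<tau> u (length \<tau>)" by blast
      have un: "u < n" using u(2) by (simp add: offset_def)
      let ?W = "\<lambda>x. \<exists>a\<in>{..<u ^ m}. \<exists>B\<in>Pow (touched u a ys). weight_condition \<tau> u ys z \<psi> k a B x"
      have iff: "((lead x = u) \<and> (R u x \<and> ?W x)) \<longleftrightarrow> (x, k) \<in> ?Q" if x: "length x = n" for x
      proof -
        have code: "is_code \<tau> x \<longleftrightarrow> lead x = u"
        proof
          assume "is_code \<tau> x"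
          then have "offset \<tau> (lead x) (length \<tau>) = offset \<tau> u (length \<tau>)" using x u(2) by (simp add: is_code_def)
          then show "lead x = u" by (metis linorder_neqE_nat nat_neq_iff offset_strict_mono)
        qed (use x u in \<open>simp add: is_code_def\<close>)
        have "(x, k) \<in> ?Q \<longleftrightarrow> is_code \<tau> x \<and> (decode \<tau> x, k) \<in> {(A, k) \<in> p_models (=) \<tau> \<phi>. P A}"
          by (rule encode_problem_iff) (auto simp: p_models_def)
        moreover have "(decode \<tau> x, k) \<in> {(A, k) \<in> p_models (=) \<tau> \<phi>. P A} \<longleftrightarrow> R u x \<and> ?W x" if c: "is_code \<tau> x"
        proof -
          have l: "lead x = u" using c code by simp
          have "universe (decode \<tau> x) = {..<u}" by (simp add: universe_def decode_def l)
          then have "(decode \<tau> x, k) \<in> p_models (=) \<tau> \<phi> \<longleftrightarrow>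
             (\<exists>C\<subseteq>{..<lead x}. card C = k \<and> models (decode \<tau> x) ((\<lambda>c. [c]) ` C) (foldr Exists ys (Forall z \<psi>)))"
            using is_structure_decode[OF c] by (simp add: p_models_def \<psi>(1) l)
          also have "\<dots> \<longleftrightarrow> ?W x" using models_iff_weight_condition[OF c \<psi>(3) wf, of k ys z] unfolding l \<psi>(2) .
          finally show ?thesis using P[OF c] l by auto
        qed
        ultimately show ?thesis using code by blast
      qed
      have inner: "realizable n (Suc (d + 9)) (2 * 2 ^ (m + 1) * (256 * (32 * ((k + 1) ^ (k + 1) * (u + 1)) * (k + 2) * (u + 1) * s)))
          (\<lambda>x. \<exists>B\<in>Pow (touched u a ys). weight_condition \<tau> u ys z \<psi> k a B x)" for a
      proof (rule realizable_ball(2))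
        show "finite (Pow (touched u a ys))" by (simp add: finite_touched)
        \<comment> \<open>At most m + 1 elements are touched: the m existential values and the
          default 0.\<close>
        show "card (Pow (touched u a ys)) \<le> 2 ^ (m + 1)"
          using card_touched[of u a ys] \<psi>(2) by (simp add: card_Pow finite_touched power_increasing del: power_Suc)
        have "0 < (k + 1) ^ (k + 1)" by simp
        then have "0 < 256 * (32 * ((k + 1) ^ (k + 1) * (u + 1)) * (k + 2) * (u + 1) * s)"
          using ev(2) by (intro mult_pos_pos) auto
        then show "1 \<le> 256 * (32 * ((k + 1) ^ (k + 1) * (u + 1)) * (k + 2) * (u + 1) * s)"
          by (simp only: Suc_le_eq One_nat_def)
        show "realizable n (d + 9) (256 * (32 * ((k + 1) ^ (k + 1) * (u + 1)) * (k + 2) * (u + 1) * s))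
           (weight_condition \<tau> u ys z \<psi> k a B)" for B
          by (rule realizable_weight_condition[OF ev _ u(1)]) (use ev' in blast)
      qed simp
      have "realizable n (Suc (Suc (d + 9))) (2 * u ^ m * (2 * 2 ^ (m + 1) * (256 * (32 * ((k + 1) ^ (k + 1) * (u + 1)) * (k + 2) * (u + 1) * s)))) ?W"
      proof (rule realizable_ball(2)[OF _ _ _ _ inner])
        show "1 \<le> u ^ m" using u(1) by simp
        have "0 < (k + 1) ^ (k + 1)" by simp
        then have "0 < 2 * 2 ^ (m + 1) * (256 * (32 * ((k + 1) ^ (k + 1) * (u + 1)) * (k + 2) * (u + 1) * s))"
          using ev(2) by (intro mult_pos_pos) auto
        then show "1 \<le> 2 * 2 ^ (m + 1) * (256 * (32 * ((k + 1) ^ (k + 1) * (u + 1)) * (k + 2) * (u + 1) * s))"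
          by (simp only: Suc_le_eq One_nat_def)
      qed auto
      then have W: "realizable n (d + dp + 18) (?Z k n) ?W"
      proof (rule realizable_mono)
        have "2 * u ^ m * (2 * 2 ^ (m + 1) * (256 * (32 * ((k + 1) ^ (k + 1) * (u + 1)) * (k + 2) * (u + 1) * s)))
            = ?K1 * ?g k * (u ^ m * (u + 1) ^ 2)"
        proof -
          have "2 * p * (2 * q * (256 * (32 * (a * v) * b * v * s))) = 2 * (2 * q * (256 * (32 * s))) * (a * b) * (p * v ^ 2)"
            for p q a b v :: nat by (simp add: power2_eq_square)
          then show ?thesis .
        qed
        also have "\<dots> \<le> ?K1 * ?g k * ((n + 1) ^ m * (n + 1) ^ 2)"
          using un by (intro mult_le_mono power_mono le_refl) auto
        also have "\<dots> = ?K1 * (if True then ?g k else 1) * (n + 1) ^ (m + 2)" by (simp only: power_add if_True)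
        also have "\<dots> \<le> ?Z k n" by (rule Zge) auto
        finally show "2 * u ^ m * (2 * 2 ^ (m + 1) * (256 * (32 * ((k + 1) ^ (k + 1) * (u + 1)) * (k + 2) * (u + 1) * s))) \<le> ?Z k n" .
      qed simp
      have RR: "realizable n (d + dp + 18) (?Z k n) (R u)"
        by (rule realizable_mono[OF R[OF u]]) (use Zge[of sp cp False k n] in auto)
      have RW: "realizable n (d + dp + 19) (4 * ?Z k n) (\<lambda>x. R u x \<and> ?W x)"
        using realizable_conj(1)[OF RR W Z1] by (rule realizable_mono) auto
      have Lu: "realizable n (d + dp + 19) (4 * ?Z k n) (\<lambda>x. lead x = u)"
      proof (rule realizable_cong)
        have a: "realizable n 1 (2 * (u + 1) * 1) (\<lambda>x. \<forall>i\<in>{..<u}. x ! i)"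
          using realizable_ball(1)[of "{..<u}" "u + 1" 1 n 0 "\<lambda>i x. x ! i"] un realizable_Input by simp
        have b: "realizable n 1 (2 * (u + 1) * 1) (\<lambda>x. \<not> x ! u)"
          by (rule realizable_mono[OF realizable_not[OF realizable_Input[OF un] le_refl]]) auto
        have "realizable n (Suc 1) (4 * (2 * (u + 1) * 1)) (\<lambda>x. (\<forall>i\<in>{..<u}. x ! i) \<and> \<not> x ! u)"
          by (rule realizable_conj(1)[OF a b]) simp
        then show "realizable n (d + dp + 19) (4 * ?Z k n) (\<lambda>x. (\<forall>i\<in>{..<u}. x ! i) \<and> \<not> x ! u)"
        proof (rule realizable_mono)
          have "4 * (2 * (u + 1) * 1) \<le> 8 * (if False then ?g k else 1) * (n + 1) ^ 1" using un by simp
          also have "\<dots> \<le> ?Z k n" by (rule Zge) auto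
          finally show "4 * (2 * (u + 1) * 1) \<le> 4 * ?Z k n" by linarith
        qed simp
      qed (use un lead_eq_iff in simp)
      have "realizable n (Suc (d + dp + 19)) (4 * (4 * ?Z k n)) (\<lambda>x. lead x = u \<and> (R u x \<and> ?W x))"
        by (rule realizable_conj(1)[OF Lu RW]) (use Z1 in linarith)
      then have "realizable n (Suc (d + dp + 19)) (4 * (4 * ?Z k n)) (\<lambda>x. (x, k) \<in> ?Q)"
        by (rule realizable_cong) (rule iff)
      then show ?thesis by (rule realizable_mono) simp_all
    qed
  qed
qed

section \<open>Recognizing undirected and basic graphs\<close>

lemma edges_decode:
  "[i, j] \<in> edges (decode graph_voc x) \<longleftrightarrow>
     i < lead x \<and> j < lead x \<and> x ! (offset graph_voc (lead x) 0 + num (lead x) [i, j])"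
  by (auto simp: decode_def graph_voc_def)

text \<open>One test for both graph classes: with \<open>irr\<close>, an edge from i to i falsifies
  both disjuncts, which excludes loops.\<close>

definition symmetric_code :: "bool \<Rightarrow> nat \<Rightarrow> bool list \<Rightarrow> bool" where
  "symmetric_code irr u x \<longleftrightarrow> (\<forall>(i, j)\<in>{..<u} \<times> {..<u}.
     \<not> x ! (offset graph_voc u 0 + num u [i, j]) \<or>
     \<not> (irr \<and> i = j) \<and> x ! (offset graph_voc u 0 + num u [j, i]))"

lemma realizable_symmetric_code:
  assumes u: "0 < u" and n: "n = offset graph_voc u (length graph_voc)"
  shows "realizable n 4 (64 * (n + 1) ^ 2) (symmetric_code irr u)"
proof -
  have I: "offset graph_voc u 0 + num u [i, j] < n" if "i < u" "j < u" for i j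
    unfolding n by (rule offset_less) (use num_less[of "[i, j]" u] that in \<open>auto simp: graph_voc_def power2_eq_square\<close>)
  let ?e = "\<lambda>i j x. x ! (offset graph_voc u 0 + num u [i, j])"
  have e: "realizable n 1 2 (\<lambda>x. \<not> ?e i j x)" if "i < u" "j < u" for i j
    using realizable_not[OF realizable_Input[OF I[OF that]]] by simp
  have e': "realizable n 2 8 (\<lambda>x. \<not> (irr \<and> i = j) \<and> ?e j i x)" if "i < u" "j < u" for i j
  proof (cases "irr \<and> i = j")
    case True
    then show ?thesis using realizable_const'[of 2 8 n False] by simp
  next
    case False
    then show ?thesis using realizable_mono[OF realizable_Input[OF I[OF that(2,1)]], of 2 8] by simp
  qed
  have "realizable n (Suc 2) (4 * 8) (\<lambda>x. \<not> ?e i j x \<or> \<not> (irr \<and> i = j) \<and> ?e j i x)" if "i < u" "j < u" for i j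
    by (rule realizable_conj(2)[OF realizable_mono[OF e[OF that]] e'[OF that]]) auto
  then have "realizable n (Suc (Suc 2)) (2 * (n + 1) ^ 2 * (4 * 8))
     (\<lambda>x. \<forall>p\<in>{..<u} \<times> {..<u}. \<not> ?e (fst p) (snd p) x \<or> \<not> (irr \<and> fst p = snd p) \<and> ?e (snd p) (fst p) x)"
  proof (intro realizable_ball(1))
    have "u * u \<le> (n + 1) * (n + 1)" unfolding n offset_def by (intro mult_le_mono) auto
    then show "card ({..<u} \<times> {..<u}) \<le> (n + 1) ^ 2" by (simp add: card_cartesian_product power2_eq_square)
  qed auto
  then show ?thesis
    unfolding symmetric_code_def by (rule realizable_cong[OF realizable_mono]) auto
qed

lemma symmetric_code_iff:
  assumes x: "is_code graph_voc x"
  shows "symmetric_code False (lead x) x \<longleftrightarrow> undirected (decode graph_voc x)"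
    and "symmetric_code True (lead x) x \<longleftrightarrow> basic (decode graph_voc x)"
  unfolding basic_def undirected_def edges_decode symmetric_code_def
  using is_structure_decode[OF x] by auto

theorem mainTheorem1:
  fixes p :: pattern
  shows "\<forall>\<C> \<in> {p_FD (=) p, p_FD_undirected (=) p, p_FD_basic (=) p}.
           ((\<exists>m. subseq p (replicate m Qe @ [Qa])) \<longrightarrow> \<C> \<subseteq> para_AC0) \<and>
           (subseq [Qa, Qa] p \<or> subseq [Qa, Qe] p \<longrightarrow> (\<exists>Q \<in> \<C>. W1_hard Q))"
proof -
  have easy: "p_FD (=) p \<subseteq> para_AC0" "p_FD_undirected (=) p \<subseteq> para_AC0" "p_FD_basic (=) p \<subseteq> para_AC0"
    if p: "subseq p (replicate m Qe @ [Qa])" for m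
  proof -
    let ?q = "replicate m Qe @ [Qa]"
    have "p_FD (=) ?q \<subseteq> para_AC0"
    proof
      fix Q assume "Q \<in> p_FD (=) ?q"
      then obtain \<tau> \<phi> where Q: "Q = encode_problem \<tau> (p_models (=) \<tau> \<phi>)" and \<phi>: "\<phi> \<in> prenex_fms \<tau> 1 ?q"
        unfolding p_FD_def by (elim CollectE exE conjE)
      \<comment> \<open>Arbitrary structures are the case of the trivial restriction.\<close>
      have "encode_problem \<tau> {(A, k) \<in> p_models (=) \<tau> \<phi>. True} \<in> para_AC0"
        by (rule p_models_para_AC0[OF \<phi>, where R = "\<lambda>_ _. True" and dp = 1 and sp = 1 and cp = 0])
          (use realizable_const in auto)
      then show "Q \<in> para_AC0" by (simp add: Q)
    qed
    moreover have "p_FD_undirected (=) ?q \<subseteq> para_AC0"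
    proof
      fix Q assume "Q \<in> p_FD_undirected (=) ?q"
      then obtain \<phi> where Q: "Q = encode_problem graph_voc {(G, k) \<in> p_models (=) graph_voc \<phi>. undirected G}"
        and \<phi>: "\<phi> \<in> prenex_fms graph_voc 1 ?q" unfolding p_FD_undirected_def by (elim CollectE exE conjE)
      show "Q \<in> para_AC0"
        unfolding Q by (rule p_models_para_AC0[OF \<phi> realizable_symmetric_code symmetric_code_iff(1)])
    qed
    moreover have "p_FD_basic (=) ?q \<subseteq> para_AC0"
    proof
      fix Q assume "Q \<in> p_FD_basic (=) ?q"
      then obtain \<phi> where Q: "Q = encode_problem graph_voc {(G, k) \<in> p_models (=) graph_voc \<phi>. basic G}"
        and \<phi>: "\<phi> \<in> prenex_fms graph_voc 1 ?q" unfolding p_FD_basic_def by (elim CollectE exE conjE)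
      show "Q \<in> para_AC0"
        unfolding Q by (rule p_models_para_AC0[OF \<phi> realizable_symmetric_code symmetric_code_iff(2)])
    qed
    ultimately show "p_FD (=) p \<subseteq> para_AC0" "p_FD_undirected (=) p \<subseteq> para_AC0" "p_FD_basic (=) p \<subseteq> para_AC0"
      using p_FD_mono[OF p, of "(=)"] by (meson subset_trans)+
  qed
  have hard: "\<exists>Q \<in> p_FD (=) p. W1_hard Q" "\<exists>Q \<in> p_FD_undirected (=) p. W1_hard Q" "\<exists>Q \<in> p_FD_basic (=) p. W1_hard Q"
    if q: "subseq q p" and \<phi>: "\<phi> \<in> prenex_fms graph_voc 1 q"
      and h: "\<And>Q. Q \<in> {encode_problem graph_voc (p_models (=) graph_voc \<phi>),
       encode_problem graph_voc {(G, k) \<in> p_models (=) graph_voc \<phi>. undirected G},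
       encode_problem graph_voc {(G, k) \<in> p_models (=) graph_voc \<phi>. basic G}} \<Longrightarrow> W1_hard Q"
    for q \<phi>
  proof -
    have "encode_problem graph_voc (p_models (=) graph_voc \<phi>) \<in> p_FD (=) q"
      unfolding p_FD_def by (intro CollectI exI[of _ graph_voc] exI[of _ \<phi>] conjI refl \<phi>)
    then have "encode_problem graph_voc (p_models (=) graph_voc \<phi>) \<in> p_FD (=) p"
      by (rule subsetD[OF p_FD_mono(1)[OF q]])
    then show "\<exists>Q \<in> p_FD (=) p. W1_hard Q" by (rule bexI[rotated]) (rule h, simp)
    have "encode_problem graph_voc {(G, k) \<in> p_models (=) graph_voc \<phi>. undirected G} \<in> p_FD_undirected (=) q"
      unfolding p_FD_undirected_def by (intro CollectI exI[of _ \<phi>] conjI refl \<phi>)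
    then have "encode_problem graph_voc {(G, k) \<in> p_models (=) graph_voc \<phi>. undirected G} \<in> p_FD_undirected (=) p"
      by (rule subsetD[OF p_FD_mono(2)[OF q]])
    then show "\<exists>Q \<in> p_FD_undirected (=) p. W1_hard Q" by (rule bexI[rotated]) (rule h, simp)
    have "encode_problem graph_voc {(G, k) \<in> p_models (=) graph_voc \<phi>. basic G} \<in> p_FD_basic (=) q"
      unfolding p_FD_basic_def by (intro CollectI exI[of _ \<phi>] conjI refl \<phi>)
    then have "encode_problem graph_voc {(G, k) \<in> p_models (=) graph_voc \<phi>. basic G} \<in> p_FD_basic (=) p"
      by (rule subsetD[OF p_FD_mono(3)[OF q]])
    then show "\<exists>Q \<in> p_FD_basic (=) p. W1_hard Q" by (rule bexI[rotated]) (rule h, simp)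
  qed
  have "\<exists>Q \<in> \<C>. W1_hard Q"
    if "\<C> \<in> {p_FD (=) p, p_FD_undirected (=) p, p_FD_basic (=) p}" "subseq [Qa, Qa] p \<or> subseq [Qa, Qe] p" for \<C>
    using that(2)
  proof
    assume "subseq [Qa, Qa] p"
    from hard[OF this indep_fm_prenex indep_set_W1_hard] show ?thesis using that(1) by auto
  next
    assume "subseq [Qa, Qe] p"
    from hard[OF this dom_fm_prenex total_dom_set_W1_hard] show ?thesis using that(1) by auto
  qed
  moreover have "\<C> \<subseteq> para_AC0"
    if "\<C> \<in> {p_FD (=) p, p_FD_undirected (=) p, p_FD_basic (=) p}" "subseq p (replicate m Qe @ [Qa])" for \<C> m
    using that(1) easy[OF that(2)] by auto
  ultimately show ?thesis by blast
qed

end
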